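(* Let $k$ be a field, $q\in k\setminus\{0\}$, and let $\Lambda=\Lambda(q)$ be the $6$-dimensional $k$-algebra generated by $x,y,z$ subject to the relations $x^2,\ y^2,\ z^2,\ yz,\ xy+qyx,\ xz-zx,\ zy-zx$. For $\alpha\in k$ let $M(\alpha)$ be the $3$-dimensional left $\Lambda$-module with basis $v,v',v''$ such that $xv=\alpha v'$, $yv=v'$, $zv=v''$, and $v',v''$ are annihilated by $x,y,z$. If the multiplicative order of $q$ is infinite, then $M(q)$ and $M(q)^*$ are both semi-Gorenstein-projective, but $M(q)$ is not torsionless, thus not Gorenstein-projective; all the syzygy modules $\Omega^tM(q)$ and $\Omega^t(M(q)^* )$ with $t\ge0$ are $3$-dimensional and indecomposable; the module $M(q)^{**}\simeq\Omega M(1)$ is also $3$-dimensional, but decomposable.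
   Context: The algebra $\Lambda(q)$ has $k$-basis $1,x,y,z,yx,zx$. All modules are finitely generated. For a left module $M$, $M^*=\operatorname{Hom}(M,{}_\Lambda\Lambda)$ is a right module (and similarly for right modules). $M$ is torsionless if it is a submodule of a projective module. $\Omega M$ is the kernel of a projective cover of $M$. A (left or right) module $M$ is semi-Gorenstein-projective if $\operatorname{Ext}^i(M,\Lambda)=0$ for all $i\ge1$, with $\Lambda$ the regular module on the same side. $M$ is Gorenstein-projective if it is isomorphic to the image of $d^0\colon P^0\to P^1$ for some doubly infinite exact sequence $P^\bullet$ of projective modules such that $\operatorname{Hom}(P^\bullet,\Lambda)$ is exact. *)

theory Defs
  imports "HOL-Algebra.Algebra"
begin

section \<open>Modules over a not necessarily commutative ring\<close>

text \<open>
  The record type \<open>module\<close> of \<open>HOL-Algebra\<close> is reused, but its locale \<open>module\<close> requires a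
  commutative ring. The ring-multiplicative fields \<open>mult\<close> and \<open>one\<close> of the record carry no meaning
  for a module. A right module over \<open>R\<close> is a left module over \<open>opp R\<close>.
\<close>

locale left_module = R?: ring R + M?: abelian_group M
  for R :: "'r ring" (structure) and M :: "('r, 'm) module" (structure) +
  assumes smult_closed:
      "\<lbrakk>a \<in> carrier R; x \<in> carrier M\<rbrakk> \<Longrightarrow> a \<odot>\<^bsub>M\<^esub> x \<in> carrier M"
    and smult_l_distr:
      "\<lbrakk>a \<in> carrier R; b \<in> carrier R; x \<in> carrier M\<rbrakk> \<Longrightarrow>
        (a \<oplus> b) \<odot>\<^bsub>M\<^esub> x = a \<odot>\<^bsub>M\<^esub> x \<oplus>\<^bsub>M\<^esub> b \<odot>\<^bsub>M\<^esub> x"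
    and smult_r_distr:
      "\<lbrakk>a \<in> carrier R; x \<in> carrier M; y \<in> carrier M\<rbrakk> \<Longrightarrow>
        a \<odot>\<^bsub>M\<^esub> (x \<oplus>\<^bsub>M\<^esub> y) = a \<odot>\<^bsub>M\<^esub> x \<oplus>\<^bsub>M\<^esub> a \<odot>\<^bsub>M\<^esub> y"
    and smult_assoc:
      "\<lbrakk>a \<in> carrier R; b \<in> carrier R; x \<in> carrier M\<rbrakk> \<Longrightarrow>
        (a \<otimes> b) \<odot>\<^bsub>M\<^esub> x = a \<odot>\<^bsub>M\<^esub> (b \<odot>\<^bsub>M\<^esub> x)"
    and smult_one:
      "x \<in> carrier M \<Longrightarrow> \<one> \<odot>\<^bsub>M\<^esub> x = x"

definition fg_module :: "'r ring \<Rightarrow> ('r, 'm) module \<Rightarrow> bool" where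
  "fg_module R M \<longleftrightarrow> left_module R M \<and>
     (\<exists>S. finite S \<and> S \<subseteq> carrier M \<and>
        (\<forall>N. submodule N R M \<and> S \<subseteq> N \<longrightarrow> N = carrier M))"

definition opp :: "'r ring \<Rightarrow> 'r ring" where
  "opp R = R\<lparr>monoid.mult := \<lambda>a b. b \<otimes>\<^bsub>R\<^esub> a\<rparr>"

definition regular :: "'r ring \<Rightarrow> ('r, 'r) module" where
  "regular R = \<lparr>carrier = carrier R, monoid.mult = (\<otimes>\<^bsub>R\<^esub>), monoid.one = \<one>\<^bsub>R\<^esub>, ring.zero = \<zero>\<^bsub>R\<^esub>,
     ring.add = (\<oplus>\<^bsub>R\<^esub>), module.smult = (\<otimes>\<^bsub>R\<^esub>)\<rparr>"

abbreviation restrict_mod :: "('r, 'm) module \<Rightarrow> 'm set \<Rightarrow> ('r, 'm) module" where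
  "restrict_mod M U \<equiv> M\<lparr>carrier := U\<rparr>"

text \<open>Homomorphisms are extensional, i.e. \<open>undefined\<close> off the carrier.\<close>

definition Hom :: "'r ring \<Rightarrow> ('r, 'm) module \<Rightarrow> ('r, 'n) module \<Rightarrow> ('m \<Rightarrow> 'n) set" where
  "Hom R M N = {f \<in> carrier M \<rightarrow>\<^sub>E carrier N.
     (\<forall>x\<in>carrier M. \<forall>y\<in>carrier M. f (x \<oplus>\<^bsub>M\<^esub> y) = f x \<oplus>\<^bsub>N\<^esub> f y) \<and>
     (\<forall>a\<in>carrier R. \<forall>x\<in>carrier M. f (a \<odot>\<^bsub>M\<^esub> x) = a \<odot>\<^bsub>N\<^esub> f x)}"

definition mod_iso :: "'r ring \<Rightarrow> ('r, 'm) module \<Rightarrow> ('r, 'n) module \<Rightarrow> bool" where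
  "mod_iso R M N \<longleftrightarrow> (\<exists>f\<in>Hom R M N. bij_betw f (carrier M) (carrier N))"

definition zero_hom :: "('r, 'm) module \<Rightarrow> ('r, 'n) module \<Rightarrow> 'm \<Rightarrow> 'n" where
  "zero_hom M N = (\<lambda>m\<in>carrier M. \<zero>\<^bsub>N\<^esub>)"

definition Hom_group :: "'r ring \<Rightarrow> ('r, 'm) module \<Rightarrow> ('r, 'n) module \<Rightarrow> ('m \<Rightarrow> 'n) monoid" where
  "Hom_group R M N = \<lparr>carrier = Hom R M N,
     monoid.mult = \<lambda>f g. \<lambda>m\<in>carrier M. f m \<oplus>\<^bsub>N\<^esub> g m, monoid.one = zero_hom M N\<rparr>"

text \<open>
  The dual \<open>Hom(M, R)\<close> of a left \<open>R\<close>-module, with right action \<open>(\<phi> r)(m) = \<phi>(m) r\<close>, as a left module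
  over \<open>opp R\<close>. The dual of a right module is obtained by taking \<open>opp R\<close> for \<open>R\<close>; it is a left
  module over \<open>opp (opp R) = R\<close>.
\<close>

definition dual :: "'r ring \<Rightarrow> ('r, 'm) module \<Rightarrow> ('r, 'm \<Rightarrow> 'r) module" where
  "dual R M = \<lparr>carrier = Hom R M (regular R), monoid.mult = undefined, monoid.one = undefined,
     ring.zero = zero_hom M (regular R),
     ring.add = \<lambda>f g. \<lambda>m\<in>carrier M. f m \<oplus>\<^bsub>R\<^esub> g m,
     module.smult = \<lambda>r f. \<lambda>m\<in>carrier M. f m \<otimes>\<^bsub>R\<^esub> r\<rparr>"

definition direct_decomp :: "'r ring \<Rightarrow> ('r, 'm) module \<Rightarrow> 'm set \<Rightarrow> 'm set \<Rightarrow> bool" where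
  "direct_decomp R M U V \<longleftrightarrow> submodule U R M \<and> submodule V R M \<and>
     U \<inter> V = {\<zero>\<^bsub>M\<^esub>} \<and> U <+>\<^bsub>M\<^esub> V = carrier M"

definition decomposable :: "'r ring \<Rightarrow> ('r, 'm) module \<Rightarrow> bool" where
  "decomposable R M \<longleftrightarrow>
     (\<exists>U V. direct_decomp R M U V \<and> U \<noteq> {\<zero>\<^bsub>M\<^esub>} \<and> V \<noteq> {\<zero>\<^bsub>M\<^esub>})"

definition indecomposable :: "'r ring \<Rightarrow> ('r, 'm) module \<Rightarrow> bool" where
  "indecomposable R M \<longleftrightarrow> carrier M \<noteq> {\<zero>\<^bsub>M\<^esub>} \<and> \<not> decomposable R M"

text \<open>
  Dimension over the field \<open>'k\<close>, which acts through \<open>\<iota> :: 'k \<Rightarrow> 'r\<close>: there is a basis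
  \<open>b 0, \<dots>, b (n - 1)\<close>.
\<close>

definition has_dim :: "('k::field \<Rightarrow> 'r) \<Rightarrow> ('r, 'm) module \<Rightarrow> nat \<Rightarrow> bool" where
  "has_dim \<iota> M n \<longleftrightarrow> (\<exists>b \<in> {..<n} \<rightarrow> carrier M. \<forall>m\<in>carrier M.
     \<exists>!c. c \<in> {..<n} \<rightarrow>\<^sub>E UNIV \<and> m = (\<Oplus>\<^bsub>M\<^esub>i\<in>{..<n}. \<iota> (c i) \<odot>\<^bsub>M\<^esub> b i))"


section \<open>Projective modules, covers and resolutions\<close>

text \<open>
  \<open>R\<^sup>n\<close> as the set of functions vanishing from \<open>n\<close> on. Every finitely generated \<open>R\<close>-module is
  isomorphic to one with carrier in \<open>nat \<Rightarrow> 'r\<close> (choose representatives in some \<open>R\<^sup>n\<close>), so this is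
  the type over which existentially quantified finitely generated modules range below.
\<close>

definition free_mod :: "'r ring \<Rightarrow> nat \<Rightarrow> ('r, nat \<Rightarrow> 'r) module" where
  "free_mod R n = \<lparr>carrier = {f. (\<forall>i<n. f i \<in> carrier R) \<and> (\<forall>i\<ge>n. f i = \<zero>\<^bsub>R\<^esub>)},
     monoid.mult = undefined, monoid.one = undefined, ring.zero = (\<lambda>i. \<zero>\<^bsub>R\<^esub>),
     ring.add = \<lambda>f g i. f i \<oplus>\<^bsub>R\<^esub> g i, module.smult = \<lambda>r f i. r \<otimes>\<^bsub>R\<^esub> f i\<rparr>"

text \<open>Finitely generated projective: isomorphic to a direct summand of some \<open>R\<^sup>n\<close>.\<close>

definition projective :: "'r ring \<Rightarrow> ('r, 'm) module \<Rightarrow> bool" where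
  "projective R P \<longleftrightarrow> left_module R P \<and>
     (\<exists>n U V. direct_decomp R (free_mod R n) U V \<and> mod_iso R P (restrict_mod (free_mod R n) U))"

definition torsionless :: "'r ring \<Rightarrow> ('r, 'm) module \<Rightarrow> bool" where
  "torsionless R M \<longleftrightarrow>
     (\<exists>P :: ('r, nat \<Rightarrow> 'r) module. projective R P \<and> (\<exists>f\<in>Hom R M P. inj_on f (carrier M)))"

definition projective_cover ::
    "'r ring \<Rightarrow> ('r, 'p) module \<Rightarrow> ('p \<Rightarrow> 'm) \<Rightarrow> ('r, 'm) module \<Rightarrow> bool" where
  "projective_cover R P f M \<longleftrightarrow> projective R P \<and> f \<in> Hom R P M \<and> f ` carrier P = carrier M \<and>
     (\<forall>U. submodule U R P \<and> U <+>\<^bsub>P\<^esub> a_kernel P M f = carrier P \<longrightarrow> U = carrier P)"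

text \<open>\<open>is_syzygy R t M N\<close>: the module \<open>N\<close> is isomorphic to \<open>\<Omega>\<^sup>t M\<close>.\<close>

primrec is_syzygy ::
    "'r ring \<Rightarrow> nat \<Rightarrow> ('r, 'm) module \<Rightarrow> ('r, nat \<Rightarrow> 'r) module \<Rightarrow> bool" where
  "is_syzygy R 0 M N \<longleftrightarrow> left_module R N \<and> mod_iso R N M"
| "is_syzygy R (Suc t) M N \<longleftrightarrow> left_module R N \<and>
     (\<exists>L (P :: ('r, nat \<Rightarrow> 'r) module) f. is_syzygy R t M L \<and> projective_cover R P f L \<and>
        mod_iso R N (restrict_mod P (a_kernel P L f)))"

text \<open>\<open>\<dots> \<rightarrow> P 1 \<rightarrow> P 0 \<rightarrow> M \<rightarrow> 0\<close> with maps \<open>d n : P (n + 1) \<rightarrow> P n\<close> and \<open>e : P 0 \<rightarrow> M\<close>.\<close>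

definition projective_resolution ::
    "'r ring \<Rightarrow> ('r, 'm) module \<Rightarrow> (nat \<Rightarrow> ('r, nat \<Rightarrow> 'r) module) \<Rightarrow>
     (nat \<Rightarrow> (nat \<Rightarrow> 'r) \<Rightarrow> nat \<Rightarrow> 'r) \<Rightarrow> ((nat \<Rightarrow> 'r) \<Rightarrow> 'm) \<Rightarrow> bool" where
  "projective_resolution R M P d e \<longleftrightarrow>
     (\<forall>n. projective R (P n)) \<and> (\<forall>n. d n \<in> Hom R (P (Suc n)) (P n)) \<and>
     e \<in> Hom R (P 0) M \<and> e ` carrier (P 0) = carrier M \<and>
     d 0 ` carrier (P 1) = a_kernel (P 0) M e \<and>
     (\<forall>n. d (Suc n) ` carrier (P (Suc (Suc n))) = a_kernel (P (Suc n)) (P n) (d n))"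


section \<open>Ext and (semi-)Gorenstein-projective modules\<close>

text \<open>Kernel of \<open>f\<^sup>* : Hom(B, N) \<rightarrow> Hom(A, N)\<close> for \<open>f : A \<rightarrow> B\<close>, and image of
  \<open>g\<^sup>* : Hom(C, N) \<rightarrow> Hom(B, N)\<close> for \<open>g : B \<rightarrow> C\<close>.\<close>

definition ker_pullback ::
    "'r ring \<Rightarrow> ('r, 'a) module \<Rightarrow> ('a \<Rightarrow> 'b) \<Rightarrow> ('r, 'b) module \<Rightarrow> ('r, 'n) module \<Rightarrow>
     ('b \<Rightarrow> 'n) set" where
  "ker_pullback R A f B N = {\<phi> \<in> Hom R B N. compose (carrier A) \<phi> f = zero_hom A N}"

definition im_pullback ::
    "'r ring \<Rightarrow> ('r, 'b) module \<Rightarrow> ('b \<Rightarrow> 'c) \<Rightarrow> ('r, 'c) module \<Rightarrow> ('r, 'n) module \<Rightarrow>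
     ('b \<Rightarrow> 'n) set" where
  "im_pullback R B g C N = (\<lambda>\<psi>. compose (carrier B) \<psi> g) ` Hom R C N"

definition Hom_cohomology ::
    "'r ring \<Rightarrow> (nat \<Rightarrow> ('r, 'p) module) \<Rightarrow> (nat \<Rightarrow> 'p \<Rightarrow> 'p) \<Rightarrow> nat \<Rightarrow> ('r, 'n) module \<Rightarrow>
     ('p \<Rightarrow> 'n) set monoid" where
  "Hom_cohomology R P d i N =
     (Hom_group R (P i) N)\<lparr>carrier := ker_pullback R (P (Suc i)) (d i) (P i) N\<rparr> Mod
     (case i of 0 \<Rightarrow> {zero_hom (P 0) N} | Suc j \<Rightarrow> im_pullback R (P i) (d j) (P j) N)"

text \<open>The group \<open>Ext\<^sup>i(M, N)\<close>, computed from a chosen resolution of \<open>M\<close> by finitely generated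
  projectives; a different choice gives an isomorphic group.\<close>

definition Ext ::
    "'r ring \<Rightarrow> nat \<Rightarrow> ('r, 'm) module \<Rightarrow> ('r, 'n) module \<Rightarrow> ((nat \<Rightarrow> 'r) \<Rightarrow> 'n) set monoid" where
  "Ext R i M N =
     (let (P, d) = (SOME (P, d). \<exists>e. projective_resolution R M P d e) in Hom_cohomology R P d i N)"

definition semi_Gorenstein_projective :: "'r ring \<Rightarrow> ('r, 'm) module \<Rightarrow> bool" where
  "semi_Gorenstein_projective R M \<longleftrightarrow>
     fg_module R M \<and> (\<forall>i\<ge>1. trivial_group (Ext R i M (regular R)))"

definition Gorenstein_projective :: "'r ring \<Rightarrow> ('r, 'm) module \<Rightarrow> bool" where
  "Gorenstein_projective R M \<longleftrightarrow> fg_module R M \<and>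
     (\<exists>(P :: int \<Rightarrow> ('r, nat \<Rightarrow> 'r) module) d.
        (\<forall>i. projective R (P i)) \<and> (\<forall>i. d i \<in> Hom R (P i) (P (i + 1))) \<and>
        (\<forall>i. d i ` carrier (P i) = a_kernel (P (i + 1)) (P (i + 2)) (d (i + 1))) \<and>
        (\<forall>i. im_pullback R (P (i + 1)) (d (i + 1)) (P (i + 2)) (regular R) =
             ker_pullback R (P i) (d i) (P (i + 1)) (regular R)) \<and>
        mod_iso R M (restrict_mod (P 1) (d 0 ` carrier (P 0))))"


section \<open>The algebra \<open>\<Lambda>(q)\<close> and the modules \<open>M(\<alpha>)\<close>\<close>

datatype gen = gx | gy | gz

text \<open>The free algebra \<open>k\<langle>x, y, z\<rangle>\<close>: finitely supported functions on words, with convolution.\<close>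

definition free_alg :: "(gen list \<Rightarrow> 'k::field) ring" where
  "free_alg = \<lparr>carrier = {f. finite {w. f w \<noteq> 0}},
     monoid.mult = \<lambda>f g w. \<Sum>i\<le>length w. f (take i w) * g (drop i w),
     monoid.one = \<lambda>w. if w = [] then 1 else 0,
     ring.zero = \<lambda>w. 0, ring.add = \<lambda>f g w. f w + g w\<rparr>"

definition word :: "gen list \<Rightarrow> gen list \<Rightarrow> 'k::field" where
  "word u = (\<lambda>w. if w = u then 1 else 0)"

definition relations :: "'k::field \<Rightarrow> (gen list \<Rightarrow> 'k) set" where
  "relations q = {word [gx, gx], word [gy, gy], word [gz, gz], word [gy, gz],
     (\<lambda>w. word [gx, gy] w + q * word [gy, gx] w),
     (\<lambda>w. word [gx, gz] w - word [gz, gx] w),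
     (\<lambda>w. word [gz, gy] w - word [gz, gx] w)}"

definition Lam :: "'k::field \<Rightarrow> (gen list \<Rightarrow> 'k) set ring" where
  "Lam q = free_alg Quot (Idl\<^bsub>free_alg\<^esub> (relations q))"

text \<open>The structure map \<open>k \<rightarrow> \<Lambda>(q)\<close>.\<close>

definition scal :: "'k::field \<Rightarrow> 'k \<Rightarrow> (gen list \<Rightarrow> 'k) set" where
  "scal q c = Idl\<^bsub>free_alg\<^esub> (relations q) +>\<^bsub>free_alg\<^esub> (\<lambda>w. c * word [] w)"

text \<open>Triples \<open>(a, b, c)\<close> stand for \<open>a v + b v' + c v''\<close>.\<close>

fun gen_act :: "'k::field \<Rightarrow> gen \<Rightarrow> 'k \<times> 'k \<times> 'k \<Rightarrow> 'k \<times> 'k \<times> 'k" where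
  "gen_act \<alpha> gx (a, b, c) = (0, \<alpha> * a, 0)"
| "gen_act \<alpha> gy (a, b, c) = (0, a, 0)"
| "gen_act \<alpha> gz (a, b, c) = (0, 0, a)"

definition free_act ::
    "'k::field \<Rightarrow> (gen list \<Rightarrow> 'k) \<Rightarrow> 'k \<times> 'k \<times> 'k \<Rightarrow> 'k \<times> 'k \<times> 'k" where
  "free_act \<alpha> f m =
     (\<Sum>w | f w \<noteq> 0. f w * fst (foldr (gen_act \<alpha>) w m),
      \<Sum>w | f w \<noteq> 0. f w * fst (snd (foldr (gen_act \<alpha>) w m)),
      \<Sum>w | f w \<noteq> 0. f w * snd (snd (foldr (gen_act \<alpha>) w m)))"

text \<open>
  Elements of \<open>\<Lambda>(q)\<close> are cosets \<open>C\<close> of the ideal of relations; since the relations annihilate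
  the triples, all members of \<open>C\<close> act in the same way. (\<open>q\<close> occurs only via the elements of
  \<open>\<Lambda>(q)\<close> to which the action is applied.)
\<close>

definition Mod_alpha :: "'k::field \<Rightarrow> ((gen list \<Rightarrow> 'k) set, 'k \<times> 'k \<times> 'k) module" where
  "Mod_alpha \<alpha> = \<lparr>carrier = UNIV, monoid.mult = undefined, monoid.one = undefined, ring.zero = (0, 0, 0),
     ring.add = \<lambda>(a, b, c) (a', b', c'). (a + a', b + b', c + c'),
     module.smult = \<lambda>C m. the_elem ((\<lambda>f. free_act \<alpha> f m) ` C)\<rparr>"

end

theory Submission
  imports Defs
begin

text \<open>
  Write \<open>m(a)\<close> for \<open>x - a y\<close> and \<open>I(a)\<close> for the span of \<open>m(a), yx, zx\<close>. All products of three
  generators vanish in \<open>\<Lambda>(q)\<close>, so multiplying out in the basis \<open>1, x, y, z, yx, zx\<close> shows that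
  \<open>\<Lambda> m(a) = I(a)\<close> if \<open>a \<noteq> 1\<close>, that \<open>m(a) \<Lambda> = I(a)\<close> always, that the left annihilator of \<open>m(a)\<close> is
  \<open>I(q a)\<close> if \<open>a \<noteq> 1\<close>, and that its right annihilator is always \<open>I(a / q)\<close>. The value \<open>a = 1\<close> is
  exceptional because \<open>z m(a) = (1 - a) zx\<close>.

  The module \<open>M(a)\<close> is \<open>\<Lambda> / I(a)\<close>. Since no positive power of \<open>q\<close> is \<open>1\<close>, right multiplications by
  \<open>m(q), m(q\<^sup>2), \<dots>\<close> form a resolution of \<open>M(q)\<close> by copies of \<open>\<Lambda>\<close>. Under \<open>Hom(-, \<Lambda>)\<close> they become left
  multiplications by the same elements, and these are exact by the formula for right annihilators.
  Each syzygy is \<open>\<Lambda> / I(q\<^sup>n)\<close> for some \<open>n > 0\<close>, a 3-dimensional cyclic module over a local ring, hence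
  indecomposable. The dual \<open>M(q)\<^sup>*\<close> consists of the \<open>s\<close> with \<open>m(q) s = 0\<close>, which is \<open>I(1) = m(1) \<Lambda>\<close>, and
  the same argument on the other side runs along \<open>m(1/q), m(1/q\<^sup>2), \<dots>\<close>
  (\<open>semi_Gorenstein_projective_of_annihilator_chain\<close> and \<open>syzygies_of_annihilator_chain\<close> are stated
  for an arbitrary ring in order to serve both sides).

  The bidual \<open>M(q)\<^sup>*\<^sup>*\<close> is the left annihilator of \<open>m(1/q)\<close>, again \<open>I(1)\<close>, which is also the kernel of
  \<open>\<Lambda> \<rightarrow> M(1)\<close>. As a left module \<open>I(1)\<close> splits, because \<open>\<Lambda> m(1)\<close> misses \<open>zx\<close>. Finally, a homomorphism
  \<open>M(q) \<rightarrow> \<Lambda>\<close> sends \<open>v\<close> into the right annihilator \<open>I(1)\<close> of \<open>m(q)\<close>, and \<open>z I(1) = 0\<close>; so all of them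
  kill \<open>v'' = z v\<close> and \<open>M(q)\<close> is not torsionless.

  Ext is defined through an unspecified resolution and the syzygies through arbitrary projective
  covers. The general part of the development therefore shows that vanishing of the cohomology may be
  tested on one resolution (\<open>exactness_independent_of_resolution\<close>) and that kernels of projective
  covers are unique up to isomorphism (\<open>projective_cover_kernel_unique\<close>).
\<close>

section \<open>Modules and their homomorphisms\<close>

lemma left_moduleI:
  fixes R (structure) and M (structure)
  assumes "ring R" "abelian_group M"
    and "\<And>a x. \<lbrakk>a \<in> carrier R; x \<in> carrier M\<rbrakk> \<Longrightarrow> a \<odot>\<^bsub>M\<^esub> x \<in> carrier M"
    and "\<And>a b x. \<lbrakk>a \<in> carrier R; b \<in> carrier R; x \<in> carrier M\<rbrakk> \<Longrightarrow>
        (a \<oplus> b) \<odot>\<^bsub>M\<^esub> x = a \<odot>\<^bsub>M\<^esub> x \<oplus>\<^bsub>M\<^esub> b \<odot>\<^bsub>M\<^esub> x"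
    and "\<And>a x y. \<lbrakk>a \<in> carrier R; x \<in> carrier M; y \<in> carrier M\<rbrakk> \<Longrightarrow>
        a \<odot>\<^bsub>M\<^esub> (x \<oplus>\<^bsub>M\<^esub> y) = a \<odot>\<^bsub>M\<^esub> x \<oplus>\<^bsub>M\<^esub> a \<odot>\<^bsub>M\<^esub> y"
    and "\<And>a b x. \<lbrakk>a \<in> carrier R; b \<in> carrier R; x \<in> carrier M\<rbrakk> \<Longrightarrow>
        (a \<otimes> b) \<odot>\<^bsub>M\<^esub> x = a \<odot>\<^bsub>M\<^esub> (b \<odot>\<^bsub>M\<^esub> x)"
    and "\<And>x. x \<in> carrier M \<Longrightarrow> \<one> \<odot>\<^bsub>M\<^esub> x = x"
  shows "left_module R M"
  using assms by (intro left_module.intro left_module_axioms.intro)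

context left_module
begin

lemma smult_l_null [simp]: "x \<in> carrier M \<Longrightarrow> \<zero> \<odot>\<^bsub>M\<^esub> x = \<zero>\<^bsub>M\<^esub>"
  by (metis M.add.r_cancel_one' R.l_zero R.zero_closed smult_closed smult_l_distr)

lemma smult_r_null [simp]: "a \<in> carrier R \<Longrightarrow> a \<odot>\<^bsub>M\<^esub> \<zero>\<^bsub>M\<^esub> = \<zero>\<^bsub>M\<^esub>"
  by (metis M.add.r_cancel_one' M.l_zero M.zero_closed smult_closed smult_r_distr)

lemma smult_l_minus:
  "\<lbrakk>a \<in> carrier R; x \<in> carrier M\<rbrakk> \<Longrightarrow> (\<ominus> a) \<odot>\<^bsub>M\<^esub> x = \<ominus>\<^bsub>M\<^esub> (a \<odot>\<^bsub>M\<^esub> x)"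
  by (metis M.minus_equality R.add.inv_closed R.l_neg smult_closed smult_l_distr smult_l_null)

lemma minus_eq_zero_iff:
  assumes "x \<in> carrier M" "y \<in> carrier M"
  shows "x \<ominus>\<^bsub>M\<^esub> y = \<zero>\<^bsub>M\<^esub> \<longleftrightarrow> x = y"
  by (metis assms M.add.inv_closed M.minus_equality M.minus_minus M.minus_eq M.r_neg)

lemma submoduleI:
  assumes sub: "H \<subseteq> carrier M" and zero: "\<zero>\<^bsub>M\<^esub> \<in> H"
    and add: "\<And>a b. \<lbrakk>a \<in> H; b \<in> H\<rbrakk> \<Longrightarrow> a \<oplus>\<^bsub>M\<^esub> b \<in> H"
    and smult: "\<And>a x. \<lbrakk>a \<in> carrier R; x \<in> H\<rbrakk> \<Longrightarrow> a \<odot>\<^bsub>M\<^esub> x \<in> H"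
  shows "submodule H R M"
proof -
  have "\<ominus>\<^bsub>M\<^esub> a \<in> H" if "a \<in> H" for a
    using smult[of "\<ominus> \<one>" a] smult_l_minus[of \<one> a] smult_one that sub by auto
  then show ?thesis
    using assms by (intro submodule.intro subgroup.intro) (simp_all add: submodule_axioms_def a_inv_def)
qed

lemma submoduleD:
  assumes "submodule H R M"
  shows "H \<subseteq> carrier M" and "\<zero>\<^bsub>M\<^esub> \<in> H"
    and "\<And>a b. \<lbrakk>a \<in> H; b \<in> H\<rbrakk> \<Longrightarrow> a \<oplus>\<^bsub>M\<^esub> b \<in> H"
    and "\<And>a. a \<in> H \<Longrightarrow> \<ominus>\<^bsub>M\<^esub> a \<in> H"
    and "\<And>a x. \<lbrakk>a \<in> carrier R; x \<in> H\<rbrakk> \<Longrightarrow> a \<odot>\<^bsub>M\<^esub> x \<in> H"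
proof -
  interpret S: submodule H R M by fact
  show "H \<subseteq> carrier M" "\<zero>\<^bsub>M\<^esub> \<in> H" 
    and "\<And>a b. \<lbrakk>a \<in> H; b \<in> H\<rbrakk> \<Longrightarrow> a \<oplus>\<^bsub>M\<^esub> b \<in> H"
    and "\<And>a. a \<in> H \<Longrightarrow> \<ominus>\<^bsub>M\<^esub> a \<in> H"
    and "\<And>a x. \<lbrakk>a \<in> carrier R; x \<in> H\<rbrakk> \<Longrightarrow> a \<odot>\<^bsub>M\<^esub> x \<in> H"
    using S.subset S.one_closed S.m_closed S.m_inv_closed by (auto simp: a_inv_def)
qed

lemma carrier_submodule: "submodule (carrier M) R M"
  by (rule submoduleI) (auto intro: smult_closed)

lemma zero_submodule: "submodule {\<zero>\<^bsub>M\<^esub>} R M"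
  by (rule submoduleI) auto

lemma restrict_left_module:
  assumes "submodule H R M"
  shows "left_module R (restrict_mod M H)"
proof (rule left_moduleI)
  note H = submoduleD[OF assms]
  show "ring R" by (rule R.ring_axioms)
  show "abelian_group (restrict_mod M H)"
  proof (rule abelian_groupI)
    fix x assume "x \<in> carrier (restrict_mod M H)"
    then show "\<exists>y\<in>carrier (restrict_mod M H). y \<oplus>\<^bsub>restrict_mod M H\<^esub> x = \<zero>\<^bsub>restrict_mod M H\<^esub>"
      using H by (intro bexI[of _ "\<ominus>\<^bsub>M\<^esub> x"]) (auto simp: M.l_neg)
  qed (use H in \<open>auto simp: M.a_ac subset_iff\<close>)
qed (use submoduleD[OF assms] in \<open>auto simp: smult_l_distr smult_r_distr smult_assoc smult_one subset_iff\<close>)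

end

lemma HomI:
  assumes "\<And>x. x \<in> carrier M \<Longrightarrow> f x \<in> carrier N"
    and "\<And>x. x \<notin> carrier M \<Longrightarrow> f x = undefined"
    and "\<And>x y. \<lbrakk>x \<in> carrier M; y \<in> carrier M\<rbrakk> \<Longrightarrow> f (x \<oplus>\<^bsub>M\<^esub> y) = f x \<oplus>\<^bsub>N\<^esub> f y"
    and "\<And>a x. \<lbrakk>a \<in> carrier R; x \<in> carrier M\<rbrakk> \<Longrightarrow> f (a \<odot>\<^bsub>M\<^esub> x) = a \<odot>\<^bsub>N\<^esub> f x"
  shows "f \<in> Hom R M N"
  using assms by (auto simp: Hom_def PiE_def extensional_def)

lemma restrict_Hom:
  assumes "left_module R M"
    and "\<And>x. x \<in> carrier M \<Longrightarrow> f x \<in> carrier N"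
    and "\<And>x y. \<lbrakk>x \<in> carrier M; y \<in> carrier M\<rbrakk> \<Longrightarrow> f (x \<oplus>\<^bsub>M\<^esub> y) = f x \<oplus>\<^bsub>N\<^esub> f y"
    and "\<And>a x. \<lbrakk>a \<in> carrier R; x \<in> carrier M\<rbrakk> \<Longrightarrow> f (a \<odot>\<^bsub>M\<^esub> x) = a \<odot>\<^bsub>N\<^esub> f x"
  shows "(\<lambda>x\<in>carrier M. f x) \<in> Hom R M N"
proof -
  interpret M: left_module R M by fact
  show ?thesis by (rule HomI) (auto simp: assms M.smult_closed)
qed

lemma Hom_closed: "\<lbrakk>f \<in> Hom R M N; x \<in> carrier M\<rbrakk> \<Longrightarrow> f x \<in> carrier N"
  and Hom_ext: "\<lbrakk>f \<in> Hom R M N; x \<notin> carrier M\<rbrakk> \<Longrightarrow> f x = undefined"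
  and Hom_add: "\<lbrakk>f \<in> Hom R M N; x \<in> carrier M; y \<in> carrier M\<rbrakk> \<Longrightarrow> f (x \<oplus>\<^bsub>M\<^esub> y) = f x \<oplus>\<^bsub>N\<^esub> f y"
  and Hom_smult: "\<lbrakk>f \<in> Hom R M N; a \<in> carrier R; x \<in> carrier M\<rbrakk> \<Longrightarrow> f (a \<odot>\<^bsub>M\<^esub> x) = a \<odot>\<^bsub>N\<^esub> f x"
  by (auto simp: Hom_def PiE_def extensional_def)

lemma Hom_eqI:
  assumes "f \<in> Hom R M N" "g \<in> Hom R M N'" "\<And>x. x \<in> carrier M \<Longrightarrow> f x = g x"
  shows "f = g"
proof
  fix x show "f x = g x"
    using assms(3) Hom_ext[OF assms(1)] Hom_ext[OF assms(2)] by (cases "x \<in> carrier M") simp_all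
qed

lemma Hom_zero:
  assumes "left_module R M" "left_module R N" "f \<in> Hom R M N"
  shows "f \<zero>\<^bsub>M\<^esub> = \<zero>\<^bsub>N\<^esub>"
proof -
  interpret M: left_module R M by fact
  interpret N: left_module R N by fact
  show ?thesis
    using Hom_smult[OF assms(3), of "\<zero>\<^bsub>R\<^esub>" "\<zero>\<^bsub>M\<^esub>"] Hom_closed[OF assms(3), of "\<zero>\<^bsub>M\<^esub>"] by simp
qed

lemma Hom_neg:
  assumes "left_module R M" "left_module R N" "f \<in> Hom R M N" "x \<in> carrier M"
  shows "f (\<ominus>\<^bsub>M\<^esub> x) = \<ominus>\<^bsub>N\<^esub> f x"
proof -
  interpret M: left_module R M by fact
  interpret N: left_module R N by fact
  have "f (\<ominus>\<^bsub>M\<^esub> x) \<oplus>\<^bsub>N\<^esub> f x = \<zero>\<^bsub>N\<^esub>"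
    using Hom_add[OF assms(3), of "\<ominus>\<^bsub>M\<^esub> x" x] assms(4) Hom_zero[OF assms(1-3)] by (simp add: M.M.l_neg)
  then show ?thesis
    using Hom_closed[OF assms(3)] assms(4) N.M.minus_equality by simp
qed

lemma Hom_minus:
  assumes "left_module R M" "left_module R N" "f \<in> Hom R M N" "x \<in> carrier M" "y \<in> carrier M"
  shows "f (x \<ominus>\<^bsub>M\<^esub> y) = f x \<ominus>\<^bsub>N\<^esub> f y"
proof -
  interpret M: left_module R M by fact
  show ?thesis
    using assms by (simp add: a_minus_def Hom_add[OF assms(3)] Hom_neg[OF assms(1-3)])
qed

lemma Hom_compose:
  assumes "left_module R A" "f \<in> Hom R A B" "g \<in> Hom R B C"
  shows "compose (carrier A) g f \<in> Hom R A C"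
  unfolding compose_def
  by (rule restrict_Hom)
    (use assms in \<open>simp_all add: Hom_closed[OF assms(2)] Hom_closed[OF assms(3)] Hom_add[OF assms(2)]
      Hom_add[OF assms(3)] Hom_smult[OF assms(2)] Hom_smult[OF assms(3)]\<close>)

lemma Hom_id: "left_module R M \<Longrightarrow> (\<lambda>x\<in>carrier M. x) \<in> Hom R M M"
  by (rule restrict_Hom) auto

lemma zero_hom_Hom:
  assumes "left_module R M" "left_module R N"
  shows "zero_hom M N \<in> Hom R M N"
proof -
  interpret N: left_module R N by fact
  show ?thesis unfolding zero_hom_def
    by (rule restrict_Hom[OF assms(1)]) auto
qed

lemma Hom_pointwise_add:
  assumes "left_module R M" "left_module R N" "f \<in> Hom R M N" "g \<in> Hom R M N"
  shows "(\<lambda>x\<in>carrier M. f x \<oplus>\<^bsub>N\<^esub> g x) \<in> Hom R M N"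
proof -
  interpret N: left_module R N by fact
  show ?thesis
    by (rule restrict_Hom[OF assms(1)])
      (simp_all add: Hom_closed[OF assms(3)] Hom_closed[OF assms(4)] Hom_add[OF assms(3)]
        Hom_add[OF assms(4)] Hom_smult[OF assms(3)] Hom_smult[OF assms(4)] N.smult_r_distr N.M.a_ac)
qed

lemma Hom_pointwise_neg:
  assumes "left_module R M" "left_module R N" "f \<in> Hom R M N"
  shows "(\<lambda>x\<in>carrier M. \<ominus>\<^bsub>N\<^esub> f x) \<in> Hom R M N"
proof -
  interpret N: left_module R N by fact
  have "\<ominus>\<^bsub>N\<^esub> (a \<odot>\<^bsub>N\<^esub> x) = a \<odot>\<^bsub>N\<^esub> (\<ominus>\<^bsub>N\<^esub> x)" if "a \<in> carrier R" "x \<in> carrier N" for a x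
    using that
    by (metis N.M.add.inv_closed N.M.l_neg N.M.minus_equality N.smult_closed N.smult_r_distr N.smult_r_null)
  then show ?thesis
    by (intro restrict_Hom[OF assms(1)])
      (simp_all add: Hom_closed[OF assms(3)] Hom_add[OF assms(3)] Hom_smult[OF assms(3)] N.M.minus_add)
qed

lemma a_kernel_iff: "x \<in> a_kernel M N f \<longleftrightarrow> x \<in> carrier M \<and> f x = \<zero>\<^bsub>N\<^esub>"
  by (simp add: a_kernel_def')

lemma kernel_submodule:
  assumes "left_module R M" "left_module R N" "f \<in> Hom R M N"
  shows "submodule (a_kernel M N f) R M"
proof -
  interpret M: left_module R M by fact
  interpret N: left_module R N by fact
  show ?thesis
    by (rule M.submoduleI)
      (auto simp: a_kernel_iff Hom_add[OF assms(3)] Hom_smult[OF assms(3)] Hom_zero[OF assms] M.smult_closed)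
qed

lemma image_submodule:
  assumes "left_module R M" "left_module R N" "f \<in> Hom R M N" "submodule U R M"
  shows "submodule (f ` U) R N"
proof -
  interpret M: left_module R M by fact
  interpret N: left_module R N by fact
  note U = M.submoduleD[OF assms(4)]
  show ?thesis
  proof (rule N.submoduleI)
    show "\<zero>\<^bsub>N\<^esub> \<in> f ` U"
      using U(2) Hom_zero[OF assms(1-3)] by force
    fix a b assume "a \<in> f ` U" "b \<in> f ` U"
    then obtain u v where uv: "a = f u" "b = f v" "u \<in> U" "v \<in> U" by blast
    then have "a \<oplus>\<^bsub>N\<^esub> b = f (u \<oplus>\<^bsub>M\<^esub> v)"
      using Hom_add[OF assms(3)] U(1) by (simp add: subset_iff)
    then show "a \<oplus>\<^bsub>N\<^esub> b \<in> f ` U" using U(3) uv by blast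
  next
    fix r a assume r: "r \<in> carrier R" and "a \<in> f ` U"
    then obtain u where u: "a = f u" "u \<in> U" by blast
    then have "r \<odot>\<^bsub>N\<^esub> a = f (r \<odot>\<^bsub>M\<^esub> u)"
      using Hom_smult[OF assms(3) r] U(1) by (simp add: subset_iff)
    then show "r \<odot>\<^bsub>N\<^esub> a \<in> f ` U" using U(5) u r by blast
  qed (use U(1) Hom_closed[OF assms(3)] in auto)
qed

lemma mod_iso_refl: "left_module R M \<Longrightarrow> mod_iso R M M"
  unfolding mod_iso_def
  by (rule bexI[OF _ Hom_id]) (auto simp: bij_betw_def inj_on_def)

lemma mod_iso_trans:
  assumes "left_module R A" "mod_iso R A B" "mod_iso R B C"
  shows "mod_iso R A C"
proof -
  obtain f g where fg: "f \<in> Hom R A B" "bij_betw f (carrier A) (carrier B)"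
      "g \<in> Hom R B C" "bij_betw g (carrier B) (carrier C)"
    using assms(2,3) unfolding mod_iso_def by blast
  have "bij_betw (compose (carrier A) g f) (carrier A) (carrier C)"
    using bij_betw_trans[OF fg(2,4)] by (rule bij_betw_cong[THEN iffD1, rotated]) (auto simp: compose_def)
  then show ?thesis
    unfolding mod_iso_def using Hom_compose[OF assms(1) fg(1,3)] by blast
qed

lemma Hom_inverse:
  assumes "left_module R A" "left_module R B" and f: "f \<in> Hom R A B" "bij_betw f (carrier A) (carrier B)"
  obtains g where "g \<in> Hom R B A" "bij_betw g (carrier B) (carrier A)"
    "\<And>x. x \<in> carrier A \<Longrightarrow> g (f x) = x" "\<And>y. y \<in> carrier B \<Longrightarrow> f (g y) = y"
proof
  interpret A: left_module R A by fact
  interpret B: left_module R B by fact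
  let ?h = "the_inv_into (carrier A) f"
  let ?g = "\<lambda>y\<in>carrier B. ?h y"
  have inj: "inj_on f (carrier A)" and im: "f ` carrier A = carrier B"
    using f(2) by (auto simp: bij_betw_def)
  have h: "?h y \<in> carrier A" "f (?h y) = y" if "y \<in> carrier B" for y
    using that inj im by (auto intro: the_inv_into_into f_the_inv_into_f)
  have hf: "?h (f x) = x" if "x \<in> carrier A" for x
    using that inj by (rule the_inv_into_f_f[rotated])
  show "?g \<in> Hom R B A"
  proof (rule restrict_Hom[OF assms(2) h(1)], assumption)
    fix x y assume xy: "x \<in> carrier B" "y \<in> carrier B"
    show "?h (x \<oplus>\<^bsub>B\<^esub> y) = ?h x \<oplus>\<^bsub>A\<^esub> ?h y"
      using hf[of "?h x \<oplus>\<^bsub>A\<^esub> ?h y"] Hom_add[OF f(1)] h xy by simp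
  next
    fix a y assume xy: "a \<in> carrier R" "y \<in> carrier B"
    show "?h (a \<odot>\<^bsub>B\<^esub> y) = a \<odot>\<^bsub>A\<^esub> ?h y"
      using hf[of "a \<odot>\<^bsub>A\<^esub> ?h y"] Hom_smult[OF f(1)] h xy by (simp add: A.smult_closed)
  qed
  show "bij_betw ?g (carrier B) (carrier A)"
    using bij_betw_the_inv_into[OF f(2)] by (rule bij_betw_cong[THEN iffD1, rotated]) auto
  show "?g (f x) = x" if "x \<in> carrier A" for x
    using that hf Hom_closed[OF f(1)] by simp
  show "f (?g y) = y" if "y \<in> carrier B" for y
    using that h by simp
qed

lemma mod_iso_sym:
  assumes "left_module R A" "left_module R B" "mod_iso R A B"
  shows "mod_iso R B A"
  using assms unfolding mod_iso_def by (metis Hom_inverse)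

section \<open>The regular module, free modules and projective modules\<close>

lemma regular_simps [simp]:
  "carrier (regular R) = carrier R" "\<zero>\<^bsub>regular R\<^esub> = \<zero>\<^bsub>R\<^esub>"
  "x \<oplus>\<^bsub>regular R\<^esub> y = x \<oplus>\<^bsub>R\<^esub> y" "x \<odot>\<^bsub>regular R\<^esub> y = x \<otimes>\<^bsub>R\<^esub> y"
  by (simp_all add: regular_def)

lemma regular_left_module:
  assumes "ring R" shows "left_module R (regular R)"
proof -
  interpret ring R by fact
  have "abelian_group (regular R)"
    by (rule abelian_groupI) (auto simp: a_ac intro: l_neg)
  then show ?thesis
    by (rule left_moduleI[OF assms]) (auto simp: l_distr r_distr m_assoc)
qed

lemma free_mod_carrier:
  "f \<in> carrier (free_mod R n) \<longleftrightarrow> (\<forall>i<n. f i \<in> carrier R) \<and> (\<forall>i\<ge>n. f i = \<zero>\<^bsub>R\<^esub>)"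
  by (simp add: free_mod_def)

lemma free_mod_simps [simp]:
  "\<zero>\<^bsub>free_mod R n\<^esub> = (\<lambda>i. \<zero>\<^bsub>R\<^esub>)"
  "f \<oplus>\<^bsub>free_mod R n\<^esub> g = (\<lambda>i. f i \<oplus>\<^bsub>R\<^esub> g i)"
  "r \<odot>\<^bsub>free_mod R n\<^esub> f = (\<lambda>i. r \<otimes>\<^bsub>R\<^esub> f i)"
  by (simp_all add: free_mod_def)

lemma free_mod_coord: "\<lbrakk>ring R; f \<in> carrier (free_mod R n)\<rbrakk> \<Longrightarrow> f i \<in> carrier R"
  by (cases "i < n") (auto simp: free_mod_carrier ring.ring_simprules)

lemma free_left_module:
  assumes "ring R" shows "left_module R (free_mod R n)"
proof -
  interpret ring R by fact
  note cl = free_mod_coord[OF assms]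
  have "abelian_group (free_mod R n)"
  proof (rule abelian_groupI)
    fix f g h assume f: "f \<in> carrier (free_mod R n)"
    show "\<exists>g\<in>carrier (free_mod R n). g \<oplus>\<^bsub>free_mod R n\<^esub> f = \<zero>\<^bsub>free_mod R n\<^esub>"
      using f cl[OF f] by (intro bexI[of _ "\<lambda>i. \<ominus>\<^bsub>R\<^esub> f i"]) (auto simp: l_neg free_mod_carrier)
    show "\<zero>\<^bsub>free_mod R n\<^esub> \<oplus>\<^bsub>free_mod R n\<^esub> f = f" by (simp add: cl[OF f])
    assume g: "g \<in> carrier (free_mod R n)"
    show "f \<oplus>\<^bsub>free_mod R n\<^esub> g \<in> carrier (free_mod R n)"
      using f g by (simp add: free_mod_carrier)
    show "f \<oplus>\<^bsub>free_mod R n\<^esub> g = g \<oplus>\<^bsub>free_mod R n\<^esub> f"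
      by (simp add: cl[OF f] cl[OF g] a_comm)
    assume h: "h \<in> carrier (free_mod R n)"
    show "f \<oplus>\<^bsub>free_mod R n\<^esub> g \<oplus>\<^bsub>free_mod R n\<^esub> h = f \<oplus>\<^bsub>free_mod R n\<^esub> (g \<oplus>\<^bsub>free_mod R n\<^esub> h)"
      by (simp add: cl[OF f] cl[OF g] cl[OF h] a_assoc)
  qed (simp add: free_mod_carrier)
  then show ?thesis
    by (rule left_moduleI[OF assms])
      (auto simp: fun_eq_iff l_distr r_distr m_assoc cl, auto simp: free_mod_carrier)
qed

lemma projective_free:
  assumes "ring R" shows "projective R (free_mod R n)"
proof -
  let ?F = "free_mod R n"
  interpret F: left_module R ?F by (rule free_left_module[OF assms])
  have "carrier ?F <+>\<^bsub>?F\<^esub> {\<zero>\<^bsub>?F\<^esub>} = carrier ?F"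
    unfolding set_add_def'
    using F.M.r_zero F.M.zero_closed by (auto simp del: free_mod_simps)
  then have "direct_decomp R ?F (carrier ?F) {\<zero>\<^bsub>?F\<^esub>}"
    unfolding direct_decomp_def
    using F.carrier_submodule F.zero_submodule F.M.zero_closed by blast
  moreover have "restrict_mod ?F (carrier ?F) = ?F" by simp
  ultimately show ?thesis
    unfolding projective_def
    by (intro conjI exI[of _ n] exI[of _ "carrier ?F"] exI[of _ "{\<zero>\<^bsub>?F\<^esub>}"])
      (simp_all only: F.left_module_axioms mod_iso_refl)
qed

definition unit_vec :: "'r ring \<Rightarrow> nat \<Rightarrow> nat \<Rightarrow> 'r" where
  "unit_vec R k = (\<lambda>i. if i = k then \<one>\<^bsub>R\<^esub> else \<zero>\<^bsub>R\<^esub>)"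

lemma unit_vec_carrier: "\<lbrakk>ring R; k < n\<rbrakk> \<Longrightarrow> unit_vec R k \<in> carrier (free_mod R n)"
  by (auto simp: free_mod_carrier unit_vec_def ring.ring_simprules)

text \<open>By induction on \<open>k\<close> the formula holds for the vector cut off after \<open>k\<close> coordinates, since
  cutting off one coordinate later adds a single multiple of a unit vector.\<close>

lemma Hom_free_expansion:
  assumes "ring R" "left_module R B" and f: "f \<in> Hom R (free_mod R n) B"
    and x: "x \<in> carrier (free_mod R n)"
  shows "f x = (\<Oplus>\<^bsub>B\<^esub>i\<in>{..<n}. x i \<odot>\<^bsub>B\<^esub> f (unit_vec R i))"
proof -
  interpret R: ring R by fact
  interpret F: left_module R "free_mod R n" by (rule free_left_module[OF assms(1)])
  interpret B: left_module R B by fact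
  note xc = free_mod_coord[OF assms(1) x]
  note e = unit_vec_carrier[OF assms(1), of _ n]
  define T where "T k = (\<lambda>i. if i < k then x i else \<zero>\<^bsub>R\<^esub>)" for k
  have "f (T k) = (\<Oplus>\<^bsub>B\<^esub>i\<in>{..<k}. x i \<odot>\<^bsub>B\<^esub> f (unit_vec R i))" if "k \<le> n" for k
    using that
  proof (induction k)
    case 0
    have "T 0 = \<zero>\<^bsub>free_mod R n\<^esub>" by (simp add: T_def)
    then show ?case using Hom_zero[OF F.left_module_axioms assms(2) f] by simp
  next
    case (Suc k)
    have Tk: "T k \<in> carrier (free_mod R n)"
      using Suc.prems xc by (auto simp: free_mod_carrier T_def)
    have "T (Suc k) = (x k \<odot>\<^bsub>free_mod R n\<^esub> unit_vec R k) \<oplus>\<^bsub>free_mod R n\<^esub> T k"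
      using xc by (auto simp: T_def unit_vec_def fun_eq_iff less_Suc_eq)
    then have "f (T (Suc k)) = x k \<odot>\<^bsub>B\<^esub> f (unit_vec R k) \<oplus>\<^bsub>B\<^esub> f (T k)"
      using Suc.prems xc e[of k] Tk
      by (simp del: free_mod_simps add: Hom_add[OF f] Hom_smult[OF f] F.smult_closed)
    moreover have "(\<lambda>i. x i \<odot>\<^bsub>B\<^esub> f (unit_vec R i)) \<in> {..<Suc k} \<rightarrow> carrier B"
      using Suc.prems xc e Hom_closed[OF f] B.smult_closed by auto
    ultimately show ?case
      using Suc by (simp add: lessThan_Suc Pi_def)
  qed
  moreover have "T n = x" using x by (auto simp: T_def free_mod_carrier fun_eq_iff)
  ultimately show ?thesis by auto
qed

lemma Hom_free_ext:
  assumes "ring R" "left_module R B" and f: "f \<in> Hom R (free_mod R n) B"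
    and g: "g \<in> Hom R (free_mod R n) B"
    and "\<And>i. i < n \<Longrightarrow> f (unit_vec R i) = g (unit_vec R i)" and x: "x \<in> carrier (free_mod R n)"
  shows "f x = g x"
proof -
  interpret B: left_module R B by fact
  show ?thesis
    unfolding Hom_free_expansion[OF assms(1,2) f x] Hom_free_expansion[OF assms(1,2) g x]
    using free_mod_coord[OF assms(1) x] unit_vec_carrier[OF assms(1)] Hom_closed[OF g] B.smult_closed
    by (intro B.M.finsum_cong') (auto simp: assms(5))
qed

lemma free_mod_extend:
  assumes "ring R" "left_module R A" and a: "\<And>i. i < n \<Longrightarrow> a i \<in> carrier A"
  shows "\<exists>h\<in>Hom R (free_mod R n) A. \<forall>i<n. h (unit_vec R i) = a i"
proof -
  interpret R: ring R by fact
  interpret A: left_module R A by fact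
  note xc = free_mod_coord[OF assms(1), of _ n]
  let ?s = "\<lambda>x. \<Oplus>\<^bsub>A\<^esub>i\<in>{..<n}. x i \<odot>\<^bsub>A\<^esub> a i"
  have cl: "(\<lambda>i. x i \<odot>\<^bsub>A\<^esub> a i) \<in> {..<n} \<rightarrow> carrier A" if "x \<in> carrier (free_mod R n)" for x
    using that xc a A.smult_closed by auto
  have scal: "(\<Oplus>\<^bsub>A\<^esub>i\<in>I. (r \<otimes>\<^bsub>R\<^esub> x i) \<odot>\<^bsub>A\<^esub> a i) = r \<odot>\<^bsub>A\<^esub> (\<Oplus>\<^bsub>A\<^esub>i\<in>I. x i \<odot>\<^bsub>A\<^esub> a i)"
    if "finite I" "I \<subseteq> {..<n}" "r \<in> carrier R" "x \<in> carrier (free_mod R n)" for r x I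
    using that
  proof (induction I rule: finite_induct)
    case (insert j I)
    then show ?case
      using xc a A.smult_closed
      by (subst A.M.finsum_insert, auto simp: subset_iff)+
        (auto simp: A.smult_r_distr A.smult_assoc Pi_def)
  qed simp
  have "(\<lambda>x\<in>carrier (free_mod R n). ?s x) \<in> Hom R (free_mod R n) A"
  proof (rule restrict_Hom[OF free_left_module[OF assms(1)]])
    fix x y assume xy: "x \<in> carrier (free_mod R n)" "y \<in> carrier (free_mod R n)"
    show "?s x \<in> carrier A" using cl[OF xy(1)] by (rule A.M.finsum_closed)
    have "?s (x \<oplus>\<^bsub>free_mod R n\<^esub> y) = (\<Oplus>\<^bsub>A\<^esub>i\<in>{..<n}. x i \<odot>\<^bsub>A\<^esub> a i \<oplus>\<^bsub>A\<^esub> y i \<odot>\<^bsub>A\<^esub> a i)"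
      using cl[OF xy(1)] cl[OF xy(2)]
      by (intro A.M.finsum_cong') (auto simp: A.smult_l_distr xc[OF xy(1)] xc[OF xy(2)] a)
    also have "\<dots> = ?s x \<oplus>\<^bsub>A\<^esub> ?s y"
      using cl[OF xy(1)] cl[OF xy(2)] by (rule A.M.finsum_addf)
    finally show "?s (x \<oplus>\<^bsub>free_mod R n\<^esub> y) = ?s x \<oplus>\<^bsub>A\<^esub> ?s y" .
  qed (simp add: scal)
  moreover have "?s (unit_vec R k) = a k" if k: "k < n" for k
  proof -
    have "?s (unit_vec R k) = (\<Oplus>\<^bsub>A\<^esub>i\<in>{..<n}. if k = i then a i else \<zero>\<^bsub>A\<^esub>)"
      using a by (intro A.M.finsum_cong') (auto simp: unit_vec_def A.smult_one)
    also have "\<dots> = a k" using k a by (intro A.M.finsum_singleton) auto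
    finally show ?thesis .
  qed
  ultimately show ?thesis
    by (intro bexI) (use unit_vec_carrier[OF assms(1)] in auto)
qed

lemma free_lift:
  assumes "ring R" "left_module R A" "left_module R B"
    and g: "g \<in> Hom R A B" "g ` carrier A = carrier B" and f: "f \<in> Hom R (free_mod R n) B"
  shows "\<exists>h\<in>Hom R (free_mod R n) A. \<forall>x\<in>carrier (free_mod R n). g (h x) = f x"
proof -
  let ?F = "free_mod R n"
  have F: "left_module R ?F" by (rule free_left_module[OF assms(1)])
  have "\<forall>i<n. \<exists>y\<in>carrier A. g y = f (unit_vec R i)"
    using Hom_closed[OF f] unit_vec_carrier[OF assms(1), of _ n] g(2) by (metis imageE)
  then obtain a where a: "\<And>i. i < n \<Longrightarrow> a i \<in> carrier A \<and> g (a i) = f (unit_vec R i)" by metis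
  then obtain h where h: "h \<in> Hom R ?F A" "\<And>i. i < n \<Longrightarrow> h (unit_vec R i) = a i"
    using free_mod_extend[OF assms(1,2)] by metis
  have "compose (carrier ?F) g h x = f x" if "x \<in> carrier ?F" for x
  proof (rule Hom_free_ext[OF assms(1,3) Hom_compose[OF F h(1) g(1)] f _ that])
    fix i assume "i < n"
    then show "compose (carrier ?F) g h (unit_vec R i) = f (unit_vec R i)"
      using a h unit_vec_carrier[OF assms(1)] by (simp add: compose_eq)
  qed
  then show ?thesis using h(1) by (auto simp: compose_eq)
qed

text \<open>Taking the \<open>U\<close>-component is well defined and linear because \<open>U\<close> and \<open>V\<close> meet in zero. Through
  this projection a summand of a free module inherits the lifting property of the free module.\<close>

lemma direct_decomp_projection:
  assumes "left_module R M" "direct_decomp R M U V"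
  obtains p where "p \<in> Hom R M (restrict_mod M U)" "\<And>u. u \<in> U \<Longrightarrow> p u = u"
proof -
  interpret M: left_module R M by fact
  have sub: "submodule U R M" "submodule V R M" and int: "U \<inter> V = {\<zero>\<^bsub>M\<^esub>}"
    and sum: "U <+>\<^bsub>M\<^esub> V = carrier M"
    using assms(2) by (auto simp: direct_decomp_def)
  note U = M.submoduleD[OF sub(1)] and V = M.submoduleD[OF sub(2)]
  have uniq: "u = u'" if "u \<in> U" "v \<in> V" "u' \<in> U" "v' \<in> V" "u \<oplus>\<^bsub>M\<^esub> v = u' \<oplus>\<^bsub>M\<^esub> v'" for u v u' v'
  proof -
    have c: "u \<in> carrier M" "v \<in> carrier M" "u' \<in> carrier M" "v' \<in> carrier M" using that U V by auto
    have "\<ominus>\<^bsub>M\<^esub> u' \<oplus>\<^bsub>M\<^esub> (u \<oplus>\<^bsub>M\<^esub> v) \<oplus>\<^bsub>M\<^esub> \<ominus>\<^bsub>M\<^esub> v = \<ominus>\<^bsub>M\<^esub> u' \<oplus>\<^bsub>M\<^esub> (u' \<oplus>\<^bsub>M\<^esub> v') \<oplus>\<^bsub>M\<^esub> \<ominus>\<^bsub>M\<^esub> v"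
      using that(5) by simp
    then have "\<ominus>\<^bsub>M\<^esub> u' \<oplus>\<^bsub>M\<^esub> u = v' \<oplus>\<^bsub>M\<^esub> \<ominus>\<^bsub>M\<^esub> v"
      using c by (simp add: M.M.a_assoc M.M.r_neg M.M.r_neg1)
    moreover have "\<ominus>\<^bsub>M\<^esub> u' \<oplus>\<^bsub>M\<^esub> u \<in> U" "v' \<oplus>\<^bsub>M\<^esub> \<ominus>\<^bsub>M\<^esub> v \<in> V"
      using U(3)[OF U(4)[OF that(3)] that(1)] V(3)[OF that(4) V(4)[OF that(2)]] .
    ultimately have "\<ominus>\<^bsub>M\<^esub> u' \<oplus>\<^bsub>M\<^esub> u = \<zero>\<^bsub>M\<^esub>" using int by auto
    then show ?thesis using c by (metis M.M.add.inv_closed M.M.minus_equality M.M.minus_minus M.M.a_comm)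
  qed
  have ex: "\<exists>u v. u \<in> U \<and> v \<in> V \<and> x = u \<oplus>\<^bsub>M\<^esub> v" if "x \<in> carrier M" for x
    using that sum by (auto simp: set_add_def')
  define p where "p x = (SOME u. u \<in> U \<and> (\<exists>v\<in>V. x = u \<oplus>\<^bsub>M\<^esub> v))" for x
  have p: "p x \<in> U \<and> (\<exists>v\<in>V. x = p x \<oplus>\<^bsub>M\<^esub> v)" if "x \<in> carrier M" for x
    unfolding p_def by (rule someI_ex) (use ex[OF that] in blast)
  have peq: "p (u \<oplus>\<^bsub>M\<^esub> v) = u" if "u \<in> U" "v \<in> V" for u v
  proof -
    have "u \<oplus>\<^bsub>M\<^esub> v \<in> carrier M" using that U V by auto
    from p[OF this] show ?thesis using uniq that by metis
  qed
  show ?thesis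
  proof
    show "(\<lambda>x\<in>carrier M. p x) \<in> Hom R M (restrict_mod M U)"
    proof (rule restrict_Hom[OF assms(1)])
      fix x y assume x: "x \<in> carrier M" and y: "y \<in> carrier M"
      show "p x \<in> carrier (restrict_mod M U)" using p[OF x] by simp
      obtain v w where v: "v \<in> V" "x = p x \<oplus>\<^bsub>M\<^esub> v" and w: "w \<in> V" "y = p y \<oplus>\<^bsub>M\<^esub> w"
        using p[OF x] p[OF y] by blast
      have c: "p x \<in> carrier M" "p y \<in> carrier M" "v \<in> carrier M" "w \<in> carrier M"
        using p[OF x] p[OF y] v w U(1) V(1) by auto
      have "x \<oplus>\<^bsub>M\<^esub> y = (p x \<oplus>\<^bsub>M\<^esub> v) \<oplus>\<^bsub>M\<^esub> (p y \<oplus>\<^bsub>M\<^esub> w)" using v w by simp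
      also have "\<dots> = (p x \<oplus>\<^bsub>M\<^esub> p y) \<oplus>\<^bsub>M\<^esub> (v \<oplus>\<^bsub>M\<^esub> w)" using c by (simp add: M.M.a_ac)
      finally show "p (x \<oplus>\<^bsub>M\<^esub> y) = p x \<oplus>\<^bsub>restrict_mod M U\<^esub> p y"
        using peq U(3) V(3) p[OF x] p[OF y] v w by simp
    next
      fix a x assume a: "a \<in> carrier R" and x: "x \<in> carrier M"
      obtain v where v: "v \<in> V" "x = p x \<oplus>\<^bsub>M\<^esub> v" using p[OF x] by blast
      have c: "p x \<in> carrier M" "v \<in> carrier M" using p[OF x] v U(1) V(1) by auto
      have "a \<odot>\<^bsub>M\<^esub> x = a \<odot>\<^bsub>M\<^esub> (p x \<oplus>\<^bsub>M\<^esub> v)" using v by simp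
      also have "\<dots> = a \<odot>\<^bsub>M\<^esub> p x \<oplus>\<^bsub>M\<^esub> a \<odot>\<^bsub>M\<^esub> v" using c a by (simp add: M.smult_r_distr)
      finally show "p (a \<odot>\<^bsub>M\<^esub> x) = a \<odot>\<^bsub>restrict_mod M U\<^esub> p x"
        using peq U(5) V(5) p[OF x] v a by simp
    qed
    show "(\<lambda>x\<in>carrier M. p x) u = u" if "u \<in> U" for u
      using peq[OF that V(2)] that U(1) by auto
  qed
qed

lemma projective_lift:
  assumes "projective R P" "left_module R A" "left_module R B"
    and g: "g \<in> Hom R A B" "g ` carrier A = carrier B" and f: "f \<in> Hom R P B"
  obtains h where "h \<in> Hom R P A" "\<And>x. x \<in> carrier P \<Longrightarrow> g (h x) = f x"
proof -
  obtain n U V where P: "left_module R P" and D: "direct_decomp R (free_mod R n) U V"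
    and iso: "mod_iso R P (restrict_mod (free_mod R n) U)"
    using assms(1) by (auto simp: projective_def)
  interpret P: left_module R P by fact
  let ?F = "free_mod R n"
  interpret F: left_module R ?F by (rule free_left_module[OF P.R.ring_axioms])
  have sub: "submodule U R ?F" using D by (simp add: direct_decomp_def)
  note U = F.submoduleD[OF sub]
  have RU: "left_module R (restrict_mod ?F U)" by (rule F.restrict_left_module[OF sub])
  obtain i where i: "i \<in> Hom R P (restrict_mod ?F U)" "bij_betw i (carrier P) U"
    using iso by (auto simp: mod_iso_def)
  have "bij_betw i (carrier P) (carrier (restrict_mod ?F U))" using i(2) by simp
  then obtain j where j: "j \<in> Hom R (restrict_mod ?F U) P" 
      "bij_betw j (carrier (restrict_mod ?F U)) (carrier P)"
      "\<And>x. x \<in> carrier P \<Longrightarrow> j (i x) = x" "\<And>y. y \<in> carrier (restrict_mod ?F U) \<Longrightarrow> i (j y) = y"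
    by (rule Hom_inverse[OF P RU i(1)]) (rule that)
  obtain p where p: "p \<in> Hom R ?F (restrict_mod ?F U)" "\<And>u. u \<in> U \<Longrightarrow> p u = u"
    by (rule direct_decomp_projection[OF F.left_module_axioms D]) (rule that)
  have pj: "compose (carrier ?F) j p \<in> Hom R ?F P" by (rule Hom_compose[OF F.left_module_axioms p(1) j(1)])
  then obtain h where h: "h \<in> Hom R ?F A"
      "\<And>x. x \<in> carrier ?F \<Longrightarrow> g (h x) = compose (carrier ?F) f (compose (carrier ?F) j p) x"
    using free_lift[OF P.R.ring_axioms assms(2,3) g Hom_compose[OF F.left_module_axioms pj f]] by blast
  have i': "i x \<in> U" "i x \<in> carrier ?F" if "x \<in> carrier P" for x
    using Hom_closed[OF i(1) that] U(1) by auto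
  have "i \<in> Hom R P ?F"
    by (rule HomI) (simp_all add: i' Hom_ext[OF i(1)] Hom_add[OF i(1)] Hom_smult[OF i(1)])
  then have "compose (carrier P) h i \<in> Hom R P A" by (rule Hom_compose[OF P _ h(1)])
  moreover have "g (compose (carrier P) h i x) = f x" if "x \<in> carrier P" for x
    using that i'[OF that] h(2) p(2) j(3) by (simp add: compose_eq)
  ultimately show ?thesis using that by blast
qed

section \<open>Stable retracts and their syzygies\<close>

lemma Hom_restrict:
  assumes "f \<in> Hom R A B" "left_module R A" "submodule U R A" "\<And>x. x \<in> U \<Longrightarrow> f x \<in> V"
  shows "(\<lambda>x\<in>U. f x) \<in> Hom R (restrict_mod A U) (restrict_mod B V)"
proof -
  interpret A: left_module R A by fact
  note U = A.submoduleD[OF assms(3)]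
  have "(\<lambda>x\<in>carrier (restrict_mod A U). f x) \<in> Hom R (restrict_mod A U) (restrict_mod B V)"
    by (rule restrict_Hom[OF A.restrict_left_module[OF assms(3)]])
      (use U(1) assms(4) in \<open>auto simp: subset_iff Hom_add[OF assms(1)] Hom_smult[OF assms(1)]\<close>)
  then show ?thesis by simp
qed

lemma Hom_inclusion:
  assumes "left_module R M" "submodule U R M"
  shows "(\<lambda>x\<in>U. x) \<in> Hom R (restrict_mod M U) M"
  using Hom_restrict[OF Hom_id[OF assms(1)] assms, of "carrier M"]
    left_module.submoduleD(1)[OF assms]
  by (simp add: subset_iff cong: restrict_cong)

lemma Hom_into_submodule:
  assumes "f \<in> Hom R A B" "\<And>x. x \<in> carrier A \<Longrightarrow> f x \<in> V"
  shows "f \<in> Hom R A (restrict_mod B V)"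
  by (rule HomI) (simp_all add: assms(2) Hom_ext[OF assms(1)] Hom_add[OF assms(1)] Hom_smult[OF assms(1)])

lemma Hom_from_submodule:
  assumes "f \<in> Hom R A (restrict_mod B V)" "V \<subseteq> carrier B"
  shows "f \<in> Hom R A B"
  using assms(2) Hom_closed[OF assms(1)]
  by (intro HomI)
    (auto simp: subset_iff Hom_ext[OF assms(1)] Hom_add[OF assms(1)] Hom_smult[OF assms(1)])

text \<open>The identity of \<open>A\<close> factors through \<open>B\<close> up to a map that factors through a projective module. Unlike
  an isomorphism, this relation passes to syzygies taken with respect to arbitrary projective
  presentations, and it is all that is needed to pull back the vanishing of Ext.\<close>

definition stable_retract :: "'r ring \<Rightarrow> ('r, 'a) module \<Rightarrow> ('r, 'b) module \<Rightarrow> bool" where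
  "stable_retract R A B \<longleftrightarrow>
     (\<exists>u\<in>Hom R A B. \<exists>w\<in>Hom R B A. \<exists>Q :: ('r, nat \<Rightarrow> 'r) module. \<exists>a\<in>Hom R A Q. \<exists>b\<in>Hom R Q A.
        projective R Q \<and> (\<forall>x\<in>carrier A. x = w (u x) \<oplus>\<^bsub>A\<^esub> b (a x)))"

text \<open>For a projective \<open>P\<close> this says that \<open>Ext\<^sup>1(P/K, N)\<close> vanishes.\<close>

definition extends_from :: "'r ring \<Rightarrow> ('r, 'p) module \<Rightarrow> 'p set \<Rightarrow> ('r, 'n) module \<Rightarrow> bool" where
  "extends_from R P K N \<longleftrightarrow> (\<forall>\<phi>\<in>Hom R (restrict_mod P K) N. \<exists>\<psi>\<in>Hom R P N. \<forall>x\<in>K. \<psi> x = \<phi> x)"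

text \<open>Lift \<open>u\<close> and \<open>w\<close> to the projective modules. The correction \<open>b a\<close> lifts to \<open>b' a f\<close> on \<open>P\<close>, which
  vanishes on the kernel of \<open>f\<close>; the remaining error \<open>h\<close> takes all of \<open>P\<close> into that kernel.\<close>

lemma stable_retract_lift:
  assumes M: "left_module R M" and M': "left_module R M'" and SR: "stable_retract R M M'"
    and P: "projective R P" and f: "f \<in> Hom R P M" "f ` carrier P = carrier M"
    and P': "projective R P'" and f': "f' \<in> Hom R P' M'" "f' ` carrier P' = carrier M'"
  obtains U W h where "U \<in> Hom R P P'" "W \<in> Hom R P' P" "h \<in> Hom R P P"
    "\<And>x. x \<in> carrier P \<Longrightarrow> h x \<in> a_kernel P M f"
    "\<And>x. x \<in> a_kernel P M f \<Longrightarrow> U x \<in> a_kernel P' M' f'"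
    "\<And>x. x \<in> a_kernel P' M' f' \<Longrightarrow> W x \<in> a_kernel P M f"
    "\<And>x. x \<in> a_kernel P M f \<Longrightarrow> x = W (U x) \<oplus>\<^bsub>P\<^esub> h x"
proof -
  obtain u w and Q :: "('a, nat \<Rightarrow> 'a) module" and a b where
    u: "u \<in> Hom R M M'" and w: "w \<in> Hom R M' M" and Q: "projective R Q"
    and a: "a \<in> Hom R M Q" and b: "b \<in> Hom R Q M"
    and eq: "\<And>x. x \<in> carrier M \<Longrightarrow> x = w (u x) \<oplus>\<^bsub>M\<^esub> b (a x)"
    using SR unfolding stable_retract_def by blast
  have PM: "left_module R P" and PM': "left_module R P'" and QM: "left_module R Q"
    using P P' Q by (auto simp: projective_def)
  interpret M: left_module R M by fact
  interpret M': left_module R M' by fact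
  interpret P: left_module R P by fact
  interpret P': left_module R P' by fact
  obtain U where U: "U \<in> Hom R P P'" "\<And>x. x \<in> carrier P \<Longrightarrow> f' (U x) = compose (carrier P) u f x"
    by (rule projective_lift[OF P PM' M' f' Hom_compose[OF PM f(1) u]]) (rule that)
  obtain W where W: "W \<in> Hom R P' P" "\<And>x. x \<in> carrier P' \<Longrightarrow> f (W x) = compose (carrier P') w f' x"
    by (rule projective_lift[OF P' PM M f Hom_compose[OF PM' f'(1) w]]) (rule that)
  obtain b' where b': "b' \<in> Hom R Q P" "\<And>x. x \<in> carrier Q \<Longrightarrow> f (b' x) = b x"
    by (rule projective_lift[OF Q PM M f b]) (rule that)
  (* s lifts w u + b a, which is the identity of M, so x - s x lies in the kernel of f *)
  define s where "s = (\<lambda>x\<in>carrier P. W (U x) \<oplus>\<^bsub>P\<^esub> b' (a (f x)))"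
  have fc: "f x \<in> carrier M" if "x \<in> carrier P" for x using Hom_closed[OF f(1) that] .
  have s: "s \<in> Hom R P P"
    using Hom_pointwise_add[OF PM PM Hom_compose[OF PM U(1) W(1)]
        Hom_compose[OF PM Hom_compose[OF PM f(1) a] b'(1)]]
    unfolding s_def by (simp add: compose_eq cong: restrict_cong)
  have sc: "s x \<in> carrier P" if "x \<in> carrier P" for x using Hom_closed[OF s that] .
  have fs: "f (s x) = f x" if x: "x \<in> carrier P" for x
  proof -
    have c: "W (U x) \<in> carrier P" "b' (a (f x)) \<in> carrier P" "U x \<in> carrier P'" "a (f x) \<in> carrier Q"
      using x Hom_closed[OF U(1)] Hom_closed[OF W(1)] Hom_closed[OF b'(1)] Hom_closed[OF a] fc by auto
    have "f (s x) = w (u (f x)) \<oplus>\<^bsub>M\<^esub> b (a (f x))"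
      using x c by (simp add: s_def Hom_add[OF f(1)] W(2) U(2) b'(2) compose_eq)
    then show ?thesis using eq[OF fc[OF x]] by simp
  qed
  define h where "h = (\<lambda>x\<in>carrier P. x \<oplus>\<^bsub>P\<^esub> \<ominus>\<^bsub>P\<^esub> s x)"
  have h: "h \<in> Hom R P P"
    using Hom_pointwise_add[OF PM PM Hom_id[OF PM] Hom_pointwise_neg[OF PM PM s]]
    unfolding h_def by (simp cong: restrict_cong)
  have hK: "h x \<in> a_kernel P M f" if x: "x \<in> carrier P" for x
    using x sc[OF x] fs[OF x] fc[OF x]
    by (simp add: a_kernel_iff h_def Hom_add[OF f(1)] Hom_neg[OF PM M f(1)] M.M.r_neg)
  have UK: "U x \<in> a_kernel P' M' f'" if "x \<in> a_kernel P M f" for x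
    using that Hom_closed[OF U(1)] by (simp add: a_kernel_iff U(2) compose_eq Hom_zero[OF M M' u])
  have WK: "W x \<in> a_kernel P M f" if "x \<in> a_kernel P' M' f'" for x
    using that Hom_closed[OF W(1)] by (simp add: a_kernel_iff W(2) compose_eq Hom_zero[OF M' M w])
  have dec: "x = W (U x) \<oplus>\<^bsub>P\<^esub> h x" if "x \<in> a_kernel P M f" for x
  proof -
    have x: "x \<in> carrier P" "f x = \<zero>\<^bsub>M\<^esub>" using that by (auto simp: a_kernel_iff)
    have WU: "W (U x) \<in> carrier P" using Hom_closed[OF W(1) Hom_closed[OF U(1) x(1)]] .
    have "s x = W (U x)"
      using x WU Hom_zero[OF M QM a] Hom_zero[OF QM PM b'(1)] by (simp add: s_def)
    then show ?thesis using x WU by (simp add: h_def P.M.a_lcomm P.M.r_neg)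
  qed
  show ?thesis by (rule that[OF U(1) W(1) h hK UK WK dec])
qed

text \<open>On the kernel the identity is \<open>W U + h\<close>, and restricting \<open>h\<close> to the kernel factors through the
  projective module \<open>P\<close>.\<close>

lemma stable_retract_syzygy:
  fixes P :: "('r, nat \<Rightarrow> 'r) module"
  assumes M: "left_module R M" and M': "left_module R M'" and SR: "stable_retract R M M'"
    and P: "projective R P" and f: "f \<in> Hom R P M" "f ` carrier P = carrier M"
    and P': "projective R P'" and f': "f' \<in> Hom R P' M'" "f' ` carrier P' = carrier M'"
  shows "stable_retract R (restrict_mod P (a_kernel P M f)) (restrict_mod P' (a_kernel P' M' f'))"
proof -
  let ?K = "a_kernel P M f" and ?K' = "a_kernel P' M' f'"
  have PM: "left_module R P" and PM': "left_module R P'"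
    using P P' by (auto simp: projective_def)
  obtain U W h where U: "U \<in> Hom R P P'" and W: "W \<in> Hom R P' P" and h: "h \<in> Hom R P P"
    and K: "\<And>x. x \<in> carrier P \<Longrightarrow> h x \<in> ?K" "\<And>x. x \<in> ?K \<Longrightarrow> U x \<in> ?K'" "\<And>x. x \<in> ?K' \<Longrightarrow> W x \<in> ?K"
    and eq: "\<And>x. x \<in> ?K \<Longrightarrow> x = W (U x) \<oplus>\<^bsub>P\<^esub> h x"
    by (rule stable_retract_lift[OF assms]) (rule that)
  have KS: "submodule ?K R P" and KS': "submodule ?K' R P'"
    using kernel_submodule[OF PM M f(1)] kernel_submodule[OF PM' M' f'(1)] .
  show ?thesis
    unfolding stable_retract_def
  proof (intro bexI exI conjI)
    show "(\<lambda>x\<in>?K. U x) \<in> Hom R (restrict_mod P ?K) (restrict_mod P' ?K')"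
      by (rule Hom_restrict[OF U PM KS K(2)])
    show "(\<lambda>x\<in>?K'. W x) \<in> Hom R (restrict_mod P' ?K') (restrict_mod P ?K)"
      by (rule Hom_restrict[OF W PM' KS' K(3)])
    show "(\<lambda>x\<in>?K. x) \<in> Hom R (restrict_mod P ?K) P" by (rule Hom_inclusion[OF PM KS])
    show "h \<in> Hom R P (restrict_mod P ?K)" by (rule Hom_into_submodule[OF h K(1)])
    show "projective R P" by fact
    show "\<forall>x\<in>carrier (restrict_mod P ?K).
        x = (\<lambda>x\<in>?K'. W x) ((\<lambda>x\<in>?K. U x) x) \<oplus>\<^bsub>restrict_mod P ?K\<^esub> h ((\<lambda>x\<in>?K. x) x)"
      using eq K(2) by simp
  qed
qed

text \<open>A map \<open>\<phi>\<close> on the kernel is \<open>\<phi> W U + \<phi> h\<close>. In the first summand \<open>\<phi> W\<close> extends by hypothesis, and the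
  second is defined on all of \<open>P\<close>.\<close>

lemma stable_retract_extends:
  assumes M: "left_module R M" and M': "left_module R M'" and SR: "stable_retract R M M'"
    and P: "projective R P" and f: "f \<in> Hom R P M" "f ` carrier P = carrier M"
    and P': "projective R P'" and f': "f' \<in> Hom R P' M'" "f' ` carrier P' = carrier M'"
    and N: "left_module R N" and ext: "extends_from R P' (a_kernel P' M' f') N"
  shows "extends_from R P (a_kernel P M f) N"
  unfolding extends_from_def
proof
  let ?K = "a_kernel P M f" and ?K' = "a_kernel P' M' f'"
  have PM: "left_module R P" and PM': "left_module R P'"
    using P P' by (auto simp: projective_def)
  obtain U W h where U: "U \<in> Hom R P P'" and W: "W \<in> Hom R P' P" and h: "h \<in> Hom R P P"
    and K: "\<And>x. x \<in> carrier P \<Longrightarrow> h x \<in> ?K" "\<And>x. x \<in> ?K \<Longrightarrow> U x \<in> ?K'" "\<And>x. x \<in> ?K' \<Longrightarrow> W x \<in> ?K"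
    and eq: "\<And>x. x \<in> ?K \<Longrightarrow> x = W (U x) \<oplus>\<^bsub>P\<^esub> h x"
    by (rule stable_retract_lift[OF assms(1-9)]) (rule that)
  have KS: "submodule ?K R P" and KS': "submodule ?K' R P'"
    using kernel_submodule[OF PM M f(1)] kernel_submodule[OF PM' M' f'(1)] .
  interpret PM: left_module R P by fact
  interpret PM': left_module R P' by fact
  fix \<phi> assume phi: "\<phi> \<in> Hom R (restrict_mod P ?K) N"
  have "compose (carrier (restrict_mod P' ?K')) \<phi> (\<lambda>x\<in>?K'. W x) \<in> Hom R (restrict_mod P' ?K') N"
    by (rule Hom_compose[OF PM'.restrict_left_module[OF KS'] Hom_restrict[OF W PM' KS' K(3)] phi])
  then obtain \<psi> where psi: "\<psi> \<in> Hom R P' N"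
      "\<And>x. x \<in> ?K' \<Longrightarrow> \<psi> x = compose (carrier (restrict_mod P' ?K')) \<phi> (\<lambda>x\<in>?K'. W x) x"
    using ext unfolding extends_from_def by blast
  have hK: "h \<in> Hom R P (restrict_mod P ?K)" by (rule Hom_into_submodule[OF h K(1)])
  have KP: "?K \<subseteq> carrier P" by (auto simp: a_kernel_iff)
  show "\<exists>\<psi>\<in>Hom R P N. \<forall>x\<in>?K. \<psi> x = \<phi> x"
  proof (intro bexI ballI)
    show "(\<lambda>x\<in>carrier P. compose (carrier P) \<psi> U x \<oplus>\<^bsub>N\<^esub> compose (carrier P) \<phi> h x) \<in> Hom R P N"
      by (rule Hom_pointwise_add[OF PM N Hom_compose[OF PM U psi(1)] Hom_compose[OF PM hK phi]])
    fix x assume x: "x \<in> ?K"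
    then have xP: "x \<in> carrier P" using KP by auto
    have "(\<lambda>x\<in>carrier P. compose (carrier P) \<psi> U x \<oplus>\<^bsub>N\<^esub> compose (carrier P) \<phi> h x) x
        = \<phi> (W (U x)) \<oplus>\<^bsub>N\<^esub> \<phi> (h x)"
      using xP x K(2) by (simp add: compose_eq psi(2))
    also have "\<dots> = \<phi> (W (U x) \<oplus>\<^bsub>P\<^esub> h x)"
      using Hom_add[OF phi, of "W (U x)" "h x"] K xP x by simp
    finally show "(\<lambda>x\<in>carrier P. compose (carrier P) \<psi> U x \<oplus>\<^bsub>N\<^esub> compose (carrier P) \<phi> h x) x = \<phi> x"
      using eq[OF x] by simp
  qed
qed

section \<open>Vanishing of Ext does not depend on the resolution\<close>

lemma factor_through_surjection:
  assumes A: "left_module R A" and B: "left_module R B" and N: "left_module R N"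
    and f: "f \<in> Hom R A B" "f ` carrier A = carrier B"
    and phi: "\<phi> \<in> Hom R A N" "\<And>x. x \<in> a_kernel A B f \<Longrightarrow> \<phi> x = \<zero>\<^bsub>N\<^esub>"
  obtains \<psi> where "\<psi> \<in> Hom R B N" "\<And>x. x \<in> carrier A \<Longrightarrow> \<psi> (f x) = \<phi> x"
proof -
  interpret A: left_module R A by fact
  interpret B: left_module R B by fact
  interpret N: left_module R N by fact
  have eq: "\<phi> x = \<phi> y" if "x \<in> carrier A" "y \<in> carrier A" "f x = f y" for x y
  proof -
    have "f (x \<ominus>\<^bsub>A\<^esub> y) = \<zero>\<^bsub>B\<^esub>"
      using that Hom_closed[OF f(1)] by (simp add: Hom_minus[OF A B f(1)] B.minus_eq_zero_iff)
    then have "\<phi> (x \<ominus>\<^bsub>A\<^esub> y) = \<zero>\<^bsub>N\<^esub>" using phi(2) that by (simp add: a_kernel_iff)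
    then show ?thesis
      using that Hom_closed[OF phi(1)] by (simp add: Hom_minus[OF A N phi(1)] N.minus_eq_zero_iff)
  qed
  define r where "r y = (SOME x. x \<in> carrier A \<and> f x = y)" for y
  have r: "r y \<in> carrier A \<and> f (r y) = y" if "y \<in> carrier B" for y
  proof -
    have "y \<in> f ` carrier A" using that f(2) by simp
    then show ?thesis unfolding r_def by (intro someI_ex[of "\<lambda>x. x \<in> carrier A \<and> f x = y"]) auto
  qed
  show ?thesis
  proof
    show "(\<lambda>y\<in>carrier B. \<phi> (r y)) \<in> Hom R B N"
    proof (rule restrict_Hom[OF B])
      fix x y assume xy: "x \<in> carrier B" "y \<in> carrier B"
      show "\<phi> (r x) \<in> carrier N" using r[OF xy(1)] by (simp add: Hom_closed[OF phi(1)])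
      have "\<phi> (r (x \<oplus>\<^bsub>B\<^esub> y)) = \<phi> (r x \<oplus>\<^bsub>A\<^esub> r y)"
        using r[OF xy(1)] r[OF xy(2)] r[of "x \<oplus>\<^bsub>B\<^esub> y"] xy by (intro eq) (auto simp: Hom_add[OF f(1)])
      then show "\<phi> (r (x \<oplus>\<^bsub>B\<^esub> y)) = \<phi> (r x) \<oplus>\<^bsub>N\<^esub> \<phi> (r y)"
        using r[OF xy(1)] r[OF xy(2)] by (simp add: Hom_add[OF phi(1)])
    next
      fix a y assume ay: "a \<in> carrier R" "y \<in> carrier B"
      have "\<phi> (r (a \<odot>\<^bsub>B\<^esub> y)) = \<phi> (a \<odot>\<^bsub>A\<^esub> r y)"
        using r[OF ay(2)] r[OF B.smult_closed[OF ay]] ay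
        by (intro eq) (auto simp: Hom_smult[OF f(1)] A.smult_closed)
      then show "\<phi> (r (a \<odot>\<^bsub>B\<^esub> y)) = a \<odot>\<^bsub>N\<^esub> \<phi> (r y)"
        using r[OF ay(2)] ay by (simp add: Hom_smult[OF phi(1)])
    qed
    show "(\<lambda>y\<in>carrier B. \<phi> (r y)) (f x) = \<phi> x" if x: "x \<in> carrier A" for x
    proof -
      have "f x \<in> carrier B" using Hom_closed[OF f(1) x] .
      then show ?thesis using r[of "f x"] eq[of "r (f x)" x] x by simp
    qed
  qed
qed

lemma zero_hom_iff: "f \<in> Hom R M N \<Longrightarrow> f = zero_hom M N \<longleftrightarrow> (\<forall>x\<in>carrier M. f x = \<zero>\<^bsub>N\<^esub>)"
  using Hom_ext[of f R M N] by (auto simp: zero_hom_def fun_eq_iff restrict_def)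

lemma ker_pullback_iff:
  assumes "left_module R A" "f \<in> Hom R A B"
  shows "\<phi> \<in> ker_pullback R A f B N \<longleftrightarrow> \<phi> \<in> Hom R B N \<and> (\<forall>x\<in>carrier A. \<phi> (f x) = \<zero>\<^bsub>N\<^esub>)"
  using zero_hom_iff[OF Hom_compose[OF assms]] by (auto simp: ker_pullback_def compose_eq)

text \<open>A cocycle on \<open>P1\<close> is the same thing as a map on the image \<open>Z\<close> of \<open>P1\<close> in \<open>P0\<close>, and it is a
  coboundary precisely when that map extends to \<open>P0\<close>.\<close>

lemma exact_iff_extends_from:
  assumes P: "left_module R P0" "left_module R P1" "left_module R P2" and N: "left_module R N"
    and d0: "d0 \<in> Hom R P1 P0" "d0 ` carrier P1 = Z" and Z: "submodule Z R P0"
    and d1: "d1 \<in> Hom R P2 P1" "d1 ` carrier P2 = a_kernel P1 P0 d0"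
  shows "ker_pullback R P2 d1 P1 N \<subseteq> im_pullback R P1 d0 P0 N \<longleftrightarrow> extends_from R P0 Z N"
proof -
  interpret P0: left_module R P0 by (rule P(1))
  have ZM: "left_module R (restrict_mod P0 Z)" by (rule P0.restrict_left_module[OF Z])
  have ZP: "Z \<subseteq> carrier P0" by (rule P0.submoduleD(1)[OF Z])
  have dZ: "d0 \<in> Hom R P1 (restrict_mod P0 Z)" by (rule Hom_into_submodule[OF d0(1)]) (use d0(2) in blast)
  have surj: "d0 ` carrier P1 = carrier (restrict_mod P0 Z)" using d0(2) by simp
  have ker: "a_kernel P1 (restrict_mod P0 Z) d0 = a_kernel P1 P0 d0"
    by (simp add: a_kernel_def')
  have kerp: "\<phi> \<in> ker_pullback R P2 d1 P1 N \<longleftrightarrow>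
      \<phi> \<in> Hom R P1 N \<and> (\<forall>x\<in>a_kernel P1 P0 d0. \<phi> x = \<zero>\<^bsub>N\<^esub>)" for \<phi>
    unfolding ker_pullback_iff[OF P(3) d1(1)] d1(2)[symmetric] by blast
  show ?thesis
  proof
    assume L: "ker_pullback R P2 d1 P1 N \<subseteq> im_pullback R P1 d0 P0 N"
    show "extends_from R P0 Z N"
      unfolding extends_from_def
    proof
      fix \<phi> assume phi: "\<phi> \<in> Hom R (restrict_mod P0 Z) N"
      have "compose (carrier P1) \<phi> d0 \<in> ker_pullback R P2 d1 P1 N"
        unfolding kerp using Hom_compose[OF P(2) dZ phi] Hom_zero[OF ZM N phi]
        by (auto simp: a_kernel_iff compose_eq)
      then obtain \<psi> where psi: "\<psi> \<in> Hom R P0 N" "compose (carrier P1) \<phi> d0 = compose (carrier P1) \<psi> d0"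
        using L by (auto simp: im_pullback_def)
      have "\<psi> (d0 x) = \<phi> (d0 x)" if "x \<in> carrier P1" for x
        using fun_cong[OF psi(2), of x] that by (simp add: compose_eq)
      then show "\<exists>\<psi>\<in>Hom R P0 N. \<forall>x\<in>Z. \<psi> x = \<phi> x" using psi(1) d0(2) by blast
    qed
  next
    assume E: "extends_from R P0 Z N"
    show "ker_pullback R P2 d1 P1 N \<subseteq> im_pullback R P1 d0 P0 N"
    proof
      fix \<phi> assume "\<phi> \<in> ker_pullback R P2 d1 P1 N"
      then have phi: "\<phi> \<in> Hom R P1 N" "\<And>x. x \<in> a_kernel P1 (restrict_mod P0 Z) d0 \<Longrightarrow> \<phi> x = \<zero>\<^bsub>N\<^esub>"
        unfolding kerp ker by auto
      obtain \<chi> where chi: "\<chi> \<in> Hom R (restrict_mod P0 Z) N" "\<And>x. x \<in> carrier P1 \<Longrightarrow> \<chi> (d0 x) = \<phi> x"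
        by (rule factor_through_surjection[OF P(2) ZM N dZ surj phi]) (assumption, rule that)
      then obtain \<psi> where psi: "\<psi> \<in> Hom R P0 N" "\<And>x. x \<in> Z \<Longrightarrow> \<psi> x = \<chi> x"
        using E unfolding extends_from_def by blast
      have "\<phi> = compose (carrier P1) \<psi> d0"
      proof (rule Hom_eqI[OF phi(1) Hom_compose[OF P(2) d0(1) psi(1)]])
        fix x assume x: "x \<in> carrier P1"
        then have "d0 x \<in> Z" using d0(2) by blast
        then show "\<phi> x = compose (carrier P1) \<psi> d0 x" using x psi(2) chi(2) by (simp add: compose_eq)
      qed
      then show "\<phi> \<in> im_pullback R P1 d0 P0 N" using psi(1) by (auto simp: im_pullback_def)
    qed
  qed
qed

text \<open>A resolution is cut into presentations of its successive kernels, so that the comparison of single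
  presentations can be iterated.\<close>

lemma resolution_syzygies:
  assumes "left_module R M" "projective_resolution R M P d e"
  defines "Z \<equiv> \<lambda>n. case n of 0 \<Rightarrow> a_kernel (P 0) M e | Suc m \<Rightarrow> a_kernel (P (Suc m)) (P m) (d m)"
  shows "submodule (Z n) R (P n)" "d n \<in> Hom R (P (Suc n)) (restrict_mod (P n) (Z n))"
    "d n ` carrier (P (Suc n)) = carrier (restrict_mod (P n) (Z n))"
    "a_kernel (P (Suc n)) (restrict_mod (P n) (Z n)) (d n) = Z (Suc n)"
    "left_module R (P n)" "left_module R (restrict_mod (P n) (Z n))"
proof -
  have P: "\<And>n. projective R (P n)" "\<And>n. left_module R (P n)"
      and d: "\<And>n. d n \<in> Hom R (P (Suc n)) (P n)"
      and e: "e \<in> Hom R (P 0) M"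
      and ex: "d 0 ` carrier (P 1) = a_kernel (P 0) M e"
        "\<And>n. d (Suc n) ` carrier (P (Suc (Suc n))) = a_kernel (P (Suc n)) (P n) (d n)"
    using assms(2) by (auto simp: projective_resolution_def projective_def)
  show Zs: "submodule (Z n) R (P n)"
    unfolding Z_def
    using kernel_submodule[OF P(2) assms(1) e] kernel_submodule[OF P(2) P(2) d]
    by (cases n) simp_all
  have im: "d n ` carrier (P (Suc n)) = Z n"
    unfolding Z_def using ex by (cases n) simp_all
  then show "d n ` carrier (P (Suc n)) = carrier (restrict_mod (P n) (Z n))" by simp
  show "d n \<in> Hom R (P (Suc n)) (restrict_mod (P n) (Z n))"
    by (rule Hom_into_submodule[OF d]) (use im in blast)
  show "a_kernel (P (Suc n)) (restrict_mod (P n) (Z n)) (d n) = Z (Suc n)"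
    by (simp add: Z_def a_kernel_def')
  show "left_module R (P n)" by (rule P(2))
  then show "left_module R (restrict_mod (P n) (Z n))"
    using Zs by (rule left_module.restrict_left_module)
qed

text \<open>The module is a stable retract of itself, so by induction each kernel in \<open>P\<close> is a stable retract of
  the corresponding kernel in \<open>F\<close>, and extendability is inherited from \<open>F\<close>. This replaces the
  construction of a chain homotopy equivalence.\<close>

lemma exactness_independent_of_resolution:
  assumes M: "left_module R M" and N: "left_module R N"
    and P: "projective_resolution R M P d e" and F: "projective_resolution R M F \<delta> \<epsilon>"
    and exact: "\<And>j. ker_pullback R (F (Suc (Suc j))) (\<delta> (Suc j)) (F (Suc j)) N
            \<subseteq> im_pullback R (F (Suc j)) (\<delta> j) (F j) N"
  shows "ker_pullback R (P (Suc (Suc j))) (d (Suc j)) (P (Suc j)) N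
            \<subseteq> im_pullback R (P (Suc j)) (d j) (P j) N"
proof -
  define Z where "Z = (\<lambda>n. case n of 0 \<Rightarrow> a_kernel (P 0) M e | Suc m \<Rightarrow> a_kernel (P (Suc m)) (P m) (d m))"
  define Y where "Y = (\<lambda>n. case n of 0 \<Rightarrow> a_kernel (F 0) M \<epsilon> | Suc m \<Rightarrow> a_kernel (F (Suc m)) (F m) (\<delta> m))"
  note Zf = resolution_syzygies[OF M P, folded Z_def] and Yf = resolution_syzygies[OF M F, folded Y_def]
  have Pp: "\<And>n. projective R (P n)" "\<And>n. d n \<in> Hom R (P (Suc n)) (P n)"
      "e \<in> Hom R (P 0) M" "e ` carrier (P 0) = carrier M"
    and Fp: "\<And>n. projective R (F n)" "\<And>n. \<delta> n \<in> Hom R (F (Suc n)) (F n)"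
      "\<epsilon> \<in> Hom R (F 0) M" "\<epsilon> ` carrier (F 0) = carrier M"
    using P F by (auto simp: projective_resolution_def)
  have base: "stable_retract R M M"
    unfolding stable_retract_def
  proof (intro bexI exI conjI)
    interpret M: left_module R M by (rule M)
    show "(\<lambda>x\<in>carrier M. x) \<in> Hom R M M" "(\<lambda>x\<in>carrier M. x) \<in> Hom R M M"
      by (rule Hom_id[OF M])+
    show "projective R (P 0)" by (rule Pp)
    show "zero_hom M (P 0) \<in> Hom R M (P 0)" "zero_hom (P 0) M \<in> Hom R (P 0) M"
      by (rule zero_hom_Hom[OF M Zf(5)] zero_hom_Hom[OF Zf(5) M])+
    show "\<forall>x\<in>carrier M. x = (\<lambda>x\<in>carrier M. x) ((\<lambda>x\<in>carrier M. x) x) \<oplus>\<^bsub>M\<^esub> zero_hom (P 0) M (zero_hom M (P 0) x)"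
    proof
      interpret P0: left_module R "P 0" by (rule Zf(5))
      show "x = (\<lambda>x\<in>carrier M. x) ((\<lambda>x\<in>carrier M. x) x) \<oplus>\<^bsub>M\<^esub> zero_hom (P 0) M (zero_hom M (P 0) x)"
        if "x \<in> carrier M" for x using that by (simp add: zero_hom_def)
    qed
  qed
  have SR: "stable_retract R (restrict_mod (P n) (Z n)) (restrict_mod (F n) (Y n))" for n
  proof (induction n)
    case 0
    show ?case
      using stable_retract_syzygy[OF M M base Pp(1,3,4) Fp(1,3,4)] by (simp add: Z_def Y_def)
  next
    case (Suc n)
    show ?case
      using stable_retract_syzygy[OF Zf(6) Yf(6) Suc Pp(1) Zf(2,3) Fp(1) Yf(2,3)]
      unfolding Zf(4) Yf(4) .
  qed
  have SE: "extends_from R (F j) (Y j) N \<Longrightarrow> extends_from R (P j) (Z j) N"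
  proof (cases j)
    case 0
    then show "extends_from R (F j) (Y j) N \<Longrightarrow> extends_from R (P j) (Z j) N"
      using stable_retract_extends[OF M M base Pp(1,3,4) Fp(1,3,4) N] by (simp add: Z_def Y_def)
  next
    case (Suc n)
    show "extends_from R (F j) (Y j) N \<Longrightarrow> extends_from R (P j) (Z j) N"
      using stable_retract_extends[OF Zf(6) Yf(6) SR Pp(1) Zf(2,3) Fp(1) Yf(2,3) N]
      unfolding Zf(4) Yf(4) Suc .
  qed
  have imP: "d n ` carrier (P (Suc n)) = Z n" and imF: "\<delta> n ` carrier (F (Suc n)) = Y n" for n
    using Zf(3) Yf(3) by simp_all
  have kP: "d (Suc n) ` carrier (P (Suc (Suc n))) = a_kernel (P (Suc n)) (P n) (d n)"
    and kF: "\<delta> (Suc n) ` carrier (F (Suc (Suc n))) = a_kernel (F (Suc n)) (F n) (\<delta> n)" for n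
    using imP[of "Suc n"] imF[of "Suc n"] by (simp_all add: Z_def Y_def)
  show ?thesis
    unfolding exact_iff_extends_from[OF Zf(5) Zf(5) Zf(5) N Pp(2) imP Zf(1) Pp(2) kP]
    using SE exact[of j]
    unfolding exact_iff_extends_from[OF Yf(5) Yf(5) Yf(5) N Fp(2) imF Yf(1) Fp(2) kF]
    by blast
qed

lemma im_pullback_le_ker_pullback:
  assumes "left_module R P0" "left_module R P1" "left_module R P2" "left_module R N"
    and d0: "d0 \<in> Hom R P1 P0" and d1: "d1 \<in> Hom R P2 P1"
    and comp: "\<And>x. x \<in> carrier P2 \<Longrightarrow> d0 (d1 x) = \<zero>\<^bsub>P0\<^esub>"
  shows "im_pullback R P1 d0 P0 N \<subseteq> ker_pullback R P2 d1 P1 N"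
proof
  fix \<phi> assume "\<phi> \<in> im_pullback R P1 d0 P0 N"
  then obtain \<psi> where psi: "\<psi> \<in> Hom R P0 N" "\<phi> = compose (carrier P1) \<psi> d0"
    by (auto simp: im_pullback_def)
  then show "\<phi> \<in> ker_pullback R P2 d1 P1 N"
    unfolding ker_pullback_iff[OF assms(3) d1]
    using Hom_compose[OF assms(2) d0 psi(1)] Hom_closed[OF d1] comp Hom_zero[OF assms(1,4) psi(1)]
    by (auto simp: compose_eq)
qed

lemma ker_pullback_group:
  assumes A: "left_module R A" and B: "left_module R B" and N: "left_module R N" and f: "f \<in> Hom R A B"
  shows "group ((Hom_group R B N)\<lparr>carrier := ker_pullback R A f B N\<rparr>)"
proof -
  interpret B: left_module R B by (rule B)
  interpret N: left_module R N by (rule N)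
  note k = ker_pullback_iff[OF A f, where N = N]
  have eq: "f = g" if "f \<in> Hom R B N" "g \<in> Hom R B N" "\<And>x. x \<in> carrier B \<Longrightarrow> f x = g x" for f g
    by (rule Hom_eqI[OF that])
  note fc = Hom_closed[OF f]
  show ?thesis
  proof (rule groupI, goal_cases)
    case (1 x y)
    then show ?case
      using fc Hom_pointwise_add[OF B N] by (simp add: Hom_group_def k)
  next
    case 2
    show ?case
      using fc zero_hom_Hom[OF B N] by (simp add: Hom_group_def k zero_hom_def)
  next
    case (3 x y z)
    then have xyz: "x \<in> Hom R B N" "y \<in> Hom R B N" "z \<in> Hom R B N" by (simp_all add: k)
    show ?case
      using Hom_closed[OF xyz(1)] Hom_closed[OF xyz(2)] Hom_closed[OF xyz(3)]
      by (simp add: Hom_group_def N.M.a_assoc cong: restrict_cong)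
  next
    case (4 x)
    then have x: "x \<in> Hom R B N" by (simp add: k)
    have "(\<lambda>m\<in>carrier B. zero_hom B N m \<oplus>\<^bsub>N\<^esub> x m) = x"
      by (rule eq[OF Hom_pointwise_add[OF B N zero_hom_Hom[OF B N] x] x])
        (simp add: zero_hom_def Hom_closed[OF x])
    then show ?case by (simp add: Hom_group_def)
  next
    case (5 x)
    then have x: "x \<in> Hom R B N" "\<forall>a\<in>carrier A. x (f a) = \<zero>\<^bsub>N\<^esub>" by (simp_all add: k)
    note neg = Hom_pointwise_neg[OF B N x(1)]
    have "(\<lambda>m\<in>carrier B. (\<lambda>x'\<in>carrier B. \<ominus>\<^bsub>N\<^esub> x x') m \<oplus>\<^bsub>N\<^esub> x m) = zero_hom B N"
      by (rule eq[OF Hom_pointwise_add[OF B N neg x(1)] zero_hom_Hom[OF B N]])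
        (simp add: zero_hom_def Hom_closed[OF x(1)] N.M.l_neg)
    moreover have "(\<lambda>m\<in>carrier B. \<ominus>\<^bsub>N\<^esub> x m) \<in> ker_pullback R A f B N"
      using neg x(2) fc by (simp add: k)
    ultimately show ?case
      by (intro bexI[of _ "\<lambda>m\<in>carrier B. \<ominus>\<^bsub>N\<^esub> x m"]) (simp_all only: Hom_group_def monoid.simps partial_object.simps)
  qed
qed

lemma (in group) trivial_self_quotient: "trivial_group (G Mod carrier G)"
proof -
  have "carrier (G Mod carrier G) = {carrier G}"
    unfolding carrier_FactGroup using coset_join2[OF _ subgroup_self] one_closed by fastforce
  then show ?thesis
    unfolding trivial_group_def using normal.factorgroup_is_group[OF normal_self] by simp
qed

text \<open>Whatever resolution is chosen in the definition of Ext, its cohomology vanishes as soon as that of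
  one resolution does.\<close>

theorem Ext_trivial:
  assumes M: "left_module R M" and N: "left_module R N" and F: "projective_resolution R M F \<delta> \<epsilon>"
    and exact: "\<And>j. ker_pullback R (F (Suc (Suc j))) (\<delta> (Suc j)) (F (Suc j)) N
            \<subseteq> im_pullback R (F (Suc j)) (\<delta> j) (F j) N"
    and i: "i \<ge> 1"
  shows "trivial_group (Ext R i M N)"
proof -
  obtain P d where Pd: "(SOME (P, d). \<exists>e. projective_resolution R M P d e) = (P, d)"
    by (cases "SOME (P, d). \<exists>e. projective_resolution R M P d e")
  have "case (F, \<delta>) of (P, d) \<Rightarrow> \<exists>e. projective_resolution R M P d e" using F by auto
  from someI[of "\<lambda>(P, d). \<exists>e. projective_resolution R M P d e", OF this]
  obtain e where P: "projective_resolution R M P d e" unfolding Pd by auto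
  obtain j where j: "i = Suc j" using i by (cases i) auto
  have Pm: "\<And>n. left_module R (P n)" "\<And>n. d n \<in> Hom R (P (Suc n)) (P n)"
    and ex: "\<And>n. d (Suc n) ` carrier (P (Suc (Suc n))) = a_kernel (P (Suc n)) (P n) (d n)"
    using P by (auto simp: projective_resolution_def projective_def)
  have comp: "d j (d (Suc j) x) = \<zero>\<^bsub>P j\<^esub>" if "x \<in> carrier (P (Suc (Suc j)))" for x
    using imageI[OF that, of "d (Suc j)"] unfolding ex by (simp add: a_kernel_iff)
  let ?K = "ker_pullback R (P (Suc i)) (d i) (P i) N"
  have "?K = im_pullback R (P i) (d j) (P j) N"
    unfolding j using exactness_independent_of_resolution[OF M N P F exact]
      im_pullback_le_ker_pullback[where ?d0.0 = "d j" and ?d1.0 = "d (Suc j)", OF Pm(1) Pm(1) Pm(1) N Pm(2) Pm(2) comp]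
    by blast
  then have "Ext R i M N = (Hom_group R (P i) N)\<lparr>carrier := ?K\<rparr> Mod ?K"
    unfolding Ext_def Pd by (simp add: Hom_cohomology_def j)
  then show ?thesis
    using group.trivial_self_quotient[OF ker_pullback_group[OF Pm(1) Pm(1) N Pm(2)]] by simp
qed

section \<open>Projective covers\<close>

text \<open>The image of \<open>u\<close> together with the kernel of \<open>f'\<close> is everything, and that kernel is superfluous.\<close>

lemma cover_lift_surjective:
  assumes L: "left_module R L" and P: "left_module R P" and C: "projective_cover R P' f' L"
    and f: "f ` carrier P = carrier L" and u: "u \<in> Hom R P P'" "\<And>x. x \<in> carrier P \<Longrightarrow> f' (u x) = f x"
  shows "u ` carrier P = carrier P'"
proof -
  have P': "left_module R P'" and f': "f' \<in> Hom R P' L" "f' ` carrier P' = carrier L"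
    and ess: "\<And>U. \<lbrakk>submodule U R P'; U <+>\<^bsub>P'\<^esub> a_kernel P' L f' = carrier P'\<rbrakk> \<Longrightarrow> U = carrier P'"
    using C by (auto simp: projective_cover_def projective_def)
  interpret L: left_module R L by (rule L)
  interpret P: left_module R P by (rule P)
  interpret P': left_module R P' by (rule P')
  have uc: "u x \<in> carrier P'" if "x \<in> carrier P" for x using Hom_closed[OF u(1) that] .
  show ?thesis
  proof (rule ess)
    show "submodule (u ` carrier P) R P'"
      by (rule image_submodule[OF P P' u(1) P.carrier_submodule])
    show "u ` carrier P <+>\<^bsub>P'\<^esub> a_kernel P' L f' = carrier P'"
    proof (intro equalityI subsetI)
      fix y assume "y \<in> u ` carrier P <+>\<^bsub>P'\<^esub> a_kernel P' L f'"
      then show "y \<in> carrier P'" using uc by (auto simp: set_add_def' a_kernel_iff)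
    next
      fix y assume y: "y \<in> carrier P'"
      then have "f' y \<in> f ` carrier P" using Hom_closed[OF f'(1)] f by simp
      then obtain x where x: "x \<in> carrier P" "f' y = f x" by blast
      have "f x \<in> carrier L" using Hom_closed[OF f'(1) y] x(2) by simp
      then have "f' (y \<ominus>\<^bsub>P'\<^esub> u x) = \<zero>\<^bsub>L\<^esub>"
        using x y uc Hom_closed[OF f'(1)] u(2)
        by (simp add: Hom_minus[OF P' L f'(1)] L.minus_eq_zero_iff)
      then have "y \<ominus>\<^bsub>P'\<^esub> u x \<in> a_kernel P' L f'" using x y uc by (simp add: a_kernel_iff)
      moreover have "y = u x \<oplus>\<^bsub>P'\<^esub> (y \<ominus>\<^bsub>P'\<^esub> u x)"
        using x y uc[OF x(1)] by (simp add: a_minus_def P'.M.a_lcomm P'.M.r_neg)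
      ultimately show "y \<in> u ` carrier P <+>\<^bsub>P'\<^esub> a_kernel P' L f'"
        using x(1) unfolding set_add_def' by blast
    qed
  qed
qed

text \<open>A lift \<open>u\<close> between the covers is onto, hence splits since its target is projective. The section is a
  lift as well, so it is also onto and therefore an isomorphism matching the two kernels.\<close>

theorem projective_cover_kernel_unique:
  assumes L: "left_module R L" and C: "projective_cover R P f L" and C': "projective_cover R P' f' L"
  shows "mod_iso R (restrict_mod P' (a_kernel P' L f')) (restrict_mod P (a_kernel P L f))"
proof -
  have P: "projective R P" "left_module R P" and f: "f \<in> Hom R P L" "f ` carrier P = carrier L"
    using C by (auto simp: projective_cover_def projective_def)
  have P': "projective R P'" "left_module R P'" and f': "f' \<in> Hom R P' L" "f' ` carrier P' = carrier L"
    using C' by (auto simp: projective_cover_def projective_def)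
  interpret P': left_module R P' by (rule P'(2))
  obtain u where u: "u \<in> Hom R P P'" "\<And>x. x \<in> carrier P \<Longrightarrow> f' (u x) = f x"
    by (rule projective_lift[OF P(1) P'(2) L f' f(1)]) (rule that)
  have us: "u ` carrier P = carrier P'"
    by (rule cover_lift_surjective[OF L P(2) C' f(2) u])
  obtain s where s: "s \<in> Hom R P' P" "\<And>x. x \<in> carrier P' \<Longrightarrow> u (s x) = (\<lambda>x\<in>carrier P'. x) x"
    by (rule projective_lift[OF P'(1) P(2) P'(2) u(1) us Hom_id[OF P'(2)]]) (rule that)
  have sc: "s x \<in> carrier P" if "x \<in> carrier P'" for x using Hom_closed[OF s(1) that] .
  have fs: "f (s x) = f' x" if "x \<in> carrier P'" for x
    using u(2)[OF sc[OF that]] s(2)[OF that] that by simp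
  have ss: "s ` carrier P' = carrier P"
    by (rule cover_lift_surjective[OF L P'(2) C f'(2) s(1) fs])
  have inj: "inj_on s (carrier P')"
    by (rule inj_on_inverseI[of _ u]) (simp add: s(2))
  have K: "s x \<in> a_kernel P L f" if "x \<in> a_kernel P' L f'" for x
    using that sc fs by (simp add: a_kernel_iff)
  have im: "s ` a_kernel P' L f' = a_kernel P L f"
  proof (intro equalityI subsetI)
    fix y assume y: "y \<in> a_kernel P L f"
    then have "y \<in> s ` carrier P'" unfolding ss by (simp add: a_kernel_iff)
    then obtain x where "x \<in> carrier P'" "y = s x" by blast
    then show "y \<in> s ` a_kernel P' L f'" using y fs by (auto simp: a_kernel_iff)
  qed (use K in blast)
  have inj': "inj_on s (a_kernel P' L f')"
    by (rule inj_on_subset[OF inj]) (auto simp: a_kernel_iff)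
  have "bij_betw (\<lambda>x\<in>a_kernel P' L f'. s x) (carrier (restrict_mod P' (a_kernel P' L f')))
      (carrier (restrict_mod P (a_kernel P L f)))"
    using inj' im by (simp add: bij_betw_def)
  moreover have "(\<lambda>x\<in>a_kernel P' L f'. s x) \<in> 
      Hom R (restrict_mod P' (a_kernel P' L f')) (restrict_mod P (a_kernel P L f))"
    by (rule Hom_restrict[OF s(1) P'(2) kernel_submodule[OF P'(2) L f'(1)] K])
  ultimately show ?thesis unfolding mod_iso_def by blast
qed

section \<open>Cyclic modules over a local ring\<close>

text \<open>\<open>M\<close> is isomorphic to \<open>R / I\<close>. The carrier type of \<open>M\<close> is arbitrary, which avoids forming
  the quotient.\<close>

definition cyclic_with :: "'r ring \<Rightarrow> ('r, 'm) module \<Rightarrow> 'r set \<Rightarrow> bool" where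
  "cyclic_with R M I \<longleftrightarrow> left_module R M \<and>
     (\<exists>g\<in>carrier M. (\<lambda>r. r \<odot>\<^bsub>M\<^esub> g) ` carrier R = carrier M \<and> {r \<in> carrier R. r \<odot>\<^bsub>M\<^esub> g = \<zero>\<^bsub>M\<^esub>} = I)"

definition principal :: "'r ring \<Rightarrow> 'r \<Rightarrow> 'r set" where
  "principal R m = (\<lambda>r. r \<otimes>\<^bsub>R\<^esub> m) ` carrier R"

text \<open>Locality, phrased without the radical so that it applies directly to the two components of a
  generator.\<close>

definition left_local :: "'r ring \<Rightarrow> bool" where
  "left_local R \<longleftrightarrow> ring R \<and> (\<forall>a\<in>carrier R. \<forall>b\<in>carrier R. a \<oplus>\<^bsub>R\<^esub> b = \<one>\<^bsub>R\<^esub> \<longrightarrow>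
     (\<exists>c\<in>carrier R. c \<otimes>\<^bsub>R\<^esub> a = \<one>\<^bsub>R\<^esub>) \<or> (\<exists>c\<in>carrier R. c \<otimes>\<^bsub>R\<^esub> b = \<one>\<^bsub>R\<^esub>))"

lemma cyclic_withE:
  assumes "cyclic_with R M I"
  obtains g where "left_module R M" "g \<in> carrier M" "(\<lambda>r. r \<odot>\<^bsub>M\<^esub> g) ` carrier R = carrier M"
    "\<And>r. r \<in> carrier R \<Longrightarrow> r \<odot>\<^bsub>M\<^esub> g = \<zero>\<^bsub>M\<^esub> \<longleftrightarrow> r \<in> I" "I \<subseteq> carrier R"
  using assms unfolding cyclic_with_def by blast

lemma cyclic_with_iso:
  assumes C: "cyclic_with R M I" and N: "left_module R N" and iso: "mod_iso R M N"
  shows "cyclic_with R N I"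
proof -
  obtain g where M: "left_module R M" and g: "g \<in> carrier M" "(\<lambda>r. r \<odot>\<^bsub>M\<^esub> g) ` carrier R = carrier M"
    and ann: "\<And>r. r \<in> carrier R \<Longrightarrow> r \<odot>\<^bsub>M\<^esub> g = \<zero>\<^bsub>M\<^esub> \<longleftrightarrow> r \<in> I" "I \<subseteq> carrier R"
    by (rule cyclic_withE[OF C]) (rule that)
  interpret M: left_module R M by (rule M)
  obtain f where f: "f \<in> Hom R M N" "bij_betw f (carrier M) (carrier N)"
    using iso unfolding mod_iso_def by blast
  have eq: "r \<odot>\<^bsub>N\<^esub> f g = f (r \<odot>\<^bsub>M\<^esub> g)" if "r \<in> carrier R" for r
    using Hom_smult[OF f(1) that g(1)] by simp
  have im: "(\<lambda>r. r \<odot>\<^bsub>N\<^esub> f g) ` carrier R = carrier N"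
  proof -
    have "(\<lambda>r. r \<odot>\<^bsub>N\<^esub> f g) ` carrier R = f ` (\<lambda>r. r \<odot>\<^bsub>M\<^esub> g) ` carrier R"
      unfolding image_image by (rule image_cong[OF refl eq])
    then show ?thesis using g(2) f(2) by (simp add: bij_betw_def)
  qed
  have "r \<odot>\<^bsub>N\<^esub> f g = \<zero>\<^bsub>N\<^esub> \<longleftrightarrow> r \<in> I" if r: "r \<in> carrier R" for r
    unfolding eq[OF r] ann(1)[OF r, symmetric] Hom_zero[OF M N f(1), symmetric]
    using f(2) M.smult_closed[OF r g(1)] M.M.zero_closed
    by (auto simp: bij_betw_def inj_on_def)
  then have "{r \<in> carrier R. r \<odot>\<^bsub>N\<^esub> f g = \<zero>\<^bsub>N\<^esub>} = I" using ann(2) by auto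
  then show ?thesis
    unfolding cyclic_with_def using N im Hom_closed[OF f(1) g(1)] by blast
qed

lemma principal_submodule:
  assumes "ring R" "m \<in> carrier R" shows "submodule (principal R m) R (regular R)"
proof -
  interpret ring R by fact
  interpret L: left_module R "regular R" by (rule regular_left_module[OF assms(1)])
  show ?thesis
  proof (rule L.submoduleI)
    show "principal R m \<subseteq> carrier (regular R)" using assms(2) by (auto simp: principal_def)
    have "\<zero>\<^bsub>R\<^esub> = \<zero>\<^bsub>R\<^esub> \<otimes>\<^bsub>R\<^esub> m" using assms(2) by simp
    then show "\<zero>\<^bsub>regular R\<^esub> \<in> principal R m" unfolding principal_def by auto
    fix a b assume "a \<in> principal R m" "b \<in> principal R m"
    then obtain r s where rs: "r \<in> carrier R" "s \<in> carrier R" "a = r \<otimes>\<^bsub>R\<^esub> m" "b = s \<otimes>\<^bsub>R\<^esub> m"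
      by (auto simp: principal_def)
    then have "a \<oplus>\<^bsub>R\<^esub> b = (r \<oplus>\<^bsub>R\<^esub> s) \<otimes>\<^bsub>R\<^esub> m" using assms(2) by (simp add: l_distr)
    then show "a \<oplus>\<^bsub>regular R\<^esub> b \<in> principal R m" using rs by (auto simp: principal_def)
  next
    fix a b assume a: "a \<in> carrier R" "b \<in> principal R m"
    then obtain s where s: "s \<in> carrier R" "b = s \<otimes>\<^bsub>R\<^esub> m" by (auto simp: principal_def)
    then have "a \<otimes>\<^bsub>R\<^esub> b = (a \<otimes>\<^bsub>R\<^esub> s) \<otimes>\<^bsub>R\<^esub> m" using assms(2) a by (simp add: m_assoc)
    then show "a \<odot>\<^bsub>regular R\<^esub> b \<in> principal R m" using s a by (auto simp: principal_def)
  qed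
qed

lemma principal_cyclic:
  assumes "ring R" "m \<in> carrier R"
  shows "cyclic_with R (restrict_mod (regular R) (principal R m)) {r \<in> carrier R. r \<otimes>\<^bsub>R\<^esub> m = \<zero>\<^bsub>R\<^esub>}"
proof -
  interpret ring R by fact
  interpret L: left_module R "regular R" by (rule regular_left_module[OF assms(1)])
  have "m = \<one>\<^bsub>R\<^esub> \<otimes>\<^bsub>R\<^esub> m" using assms(2) by simp
  then have "m \<in> principal R m" unfolding principal_def by blast
  then show ?thesis
    unfolding cyclic_with_def
    using L.restrict_left_module[OF principal_submodule[OF assms]]
    by (intro conjI bexI[of _ m]) (simp_all, simp add: principal_def)
qed

text \<open>The rank is \<open>Suc 0\<close> because this is the form into which the simplifier brings the numeral.\<close>

abbreviation free1 :: "'r ring \<Rightarrow> ('r, nat \<Rightarrow> 'r) module" where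
  "free1 R \<equiv> free_mod R (Suc 0)"

definition vec1 :: "'r ring \<Rightarrow> 'r \<Rightarrow> nat \<Rightarrow> 'r" where
  "vec1 R r = (\<lambda>i. if i = 0 then r else \<zero>\<^bsub>R\<^esub>)"

lemma vec1_0 [simp]: "vec1 R r 0 = r" by (simp add: vec1_def)

lemma free1_carrier: "x \<in> carrier (free1 R) \<longleftrightarrow> x 0 \<in> carrier R \<and> x = vec1 R (x 0)"
  by (auto simp: free_mod_carrier vec1_def fun_eq_iff)

lemma vec1_carrier [simp]: "vec1 R r \<in> carrier (free1 R) \<longleftrightarrow> r \<in> carrier R"
  by (simp add: free1_carrier)

lemma vec1_eq_iff [simp]: "vec1 R r = vec1 R s \<longleftrightarrow> r = s"
  by (auto simp: vec1_def fun_eq_iff)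

lemma vec1_smult:
  assumes "ring R" "a \<in> carrier R"
  shows "vec1 R (a \<otimes>\<^bsub>R\<^esub> r) = a \<odot>\<^bsub>free1 R\<^esub> vec1 R r"
proof -
  interpret ring R by fact
  show ?thesis using assms(2) by (auto simp: vec1_def)
qed

lemma vec1_zero: "vec1 R \<zero>\<^bsub>R\<^esub> = \<zero>\<^bsub>free1 R\<^esub>"
  by (auto simp: vec1_def)

definition vec1_hom :: "'r ring \<Rightarrow> ('r, 'm) module \<Rightarrow> 'm \<Rightarrow> (nat \<Rightarrow> 'r) \<Rightarrow> 'm" where
  "vec1_hom R M g = (\<lambda>x\<in>carrier (free1 R). x 0 \<odot>\<^bsub>M\<^esub> g)"

lemma vec1_hom_Hom:
  assumes "left_module R M" "g \<in> carrier M"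
  shows "vec1_hom R M g \<in> Hom R (free1 R) M"
proof -
  interpret M: left_module R M by fact
  show ?thesis
    unfolding vec1_hom_def
    by (rule restrict_Hom[OF free_left_module[OF M.R.ring_axioms]])
      (use assms(2) in \<open>auto simp: free1_carrier M.smult_closed M.smult_l_distr M.smult_assoc\<close>)
qed

lemma vec1_hom_image: "vec1_hom R M g ` carrier (free1 R) = (\<lambda>r. r \<odot>\<^bsub>M\<^esub> g) ` carrier R"
proof (intro equalityI subsetI)
  fix y assume "y \<in> (\<lambda>r. r \<odot>\<^bsub>M\<^esub> g) ` carrier R"
  then obtain r where "r \<in> carrier R" "y = r \<odot>\<^bsub>M\<^esub> g" by blast
  then show "y \<in> vec1_hom R M g ` carrier (free1 R)"
    by (intro image_eqI[of _ _ "vec1 R r"]) (auto simp: vec1_hom_def)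
qed (auto simp: vec1_hom_def free1_carrier)

text \<open>If a submodule and the kernel \<open>I\<close> together contain \<open>1\<close>, one of the two summands of \<open>1\<close> has a left
  inverse. It cannot be the one in the proper left ideal \<open>I\<close>, so the submodule is everything.\<close>

lemma cyclic_projective_cover:
  assumes loc: "left_local R" and C: "cyclic_with R L I" and I: "I \<noteq> carrier R"
  obtains f where "projective_cover R (free1 R) f L"
    "mod_iso R (restrict_mod (free1 R) (a_kernel (free1 R) L f)) (restrict_mod (regular R) I)"
proof -
  let ?F = "free1 R"
  obtain g where L: "left_module R L" and g: "g \<in> carrier L" "(\<lambda>r. r \<odot>\<^bsub>L\<^esub> g) ` carrier R = carrier L"
    and ann: "\<And>r. r \<in> carrier R \<Longrightarrow> r \<odot>\<^bsub>L\<^esub> g = \<zero>\<^bsub>L\<^esub> \<longleftrightarrow> r \<in> I" "I \<subseteq> carrier R"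
    by (rule cyclic_withE[OF C]) (rule that)
  interpret L: left_module R L by (rule L)
  have R: "ring R" by (rule L.R.ring_axioms)
  interpret F: left_module R ?F by (rule free_left_module[OF R])
  let ?f = "vec1_hom R L g"
  have f: "?f \<in> Hom R ?F L" by (rule vec1_hom_Hom[OF L g(1)])
  have ker: "a_kernel ?F L ?f = vec1 R ` I"
  proof (intro equalityI subsetI)
    fix x assume "x \<in> a_kernel ?F L ?f"
    then have x: "x 0 \<in> carrier R" "x = vec1 R (x 0)" "x 0 \<odot>\<^bsub>L\<^esub> g = \<zero>\<^bsub>L\<^esub>"
      unfolding a_kernel_iff free1_carrier by (auto simp: vec1_hom_def free1_carrier)
    then have "x 0 \<in> I" using ann(1) by blast
    then show "x \<in> vec1 R ` I" using x(2) by blast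
  next
    fix x assume "x \<in> vec1 R ` I"
    then obtain r where "r \<in> I" "x = vec1 R r" by blast
    moreover have "r \<in> carrier R" using \<open>r \<in> I\<close> ann(2) by blast
    ultimately show "x \<in> a_kernel ?F L ?f"
      using ann(1) by (simp add: a_kernel_iff vec1_hom_def)
  qed
  have "projective_cover R ?F ?f L"
    unfolding projective_cover_def
  proof (intro conjI allI impI)
    show "projective R ?F" by (rule projective_free[OF R])
    show "?f \<in> Hom R ?F L" by (rule f)
    show "?f ` carrier ?F = carrier L" unfolding vec1_hom_image by (rule g(2))
    fix U assume "submodule U R ?F \<and> U <+>\<^bsub>?F\<^esub> a_kernel ?F L ?f = carrier ?F"
    then have U: "submodule U R ?F" and sum: "U <+>\<^bsub>?F\<^esub> vec1 R ` I = carrier ?F" by (auto simp: ker)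
    note US = F.submoduleD[OF U]
    have "vec1 R \<one>\<^bsub>R\<^esub> \<in> U <+>\<^bsub>?F\<^esub> vec1 R ` I" unfolding sum by simp
    then obtain u k where uk: "u \<in> U" "k \<in> I" "vec1 R \<one>\<^bsub>R\<^esub> = u \<oplus>\<^bsub>?F\<^esub> vec1 R k"
      unfolding set_add_def' by blast
    have u: "u 0 \<in> carrier R" "u = vec1 R (u 0)" using uk(1) US(1) free1_carrier by blast+
    have k: "k \<in> carrier R" using uk(2) ann(2) by blast
    have "u 0 \<oplus>\<^bsub>R\<^esub> k = \<one>\<^bsub>R\<^esub>" using fun_cong[OF uk(3), of 0] by simp
    then consider c where "c \<in> carrier R" "c \<otimes>\<^bsub>R\<^esub> u 0 = \<one>\<^bsub>R\<^esub>" | c where "c \<in> carrier R" "c \<otimes>\<^bsub>R\<^esub> k = \<one>\<^bsub>R\<^esub>"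
      using loc u(1) k unfolding left_local_def by blast
    then show "U = carrier ?F"
    proof cases
      case 1
      have "x \<in> U" if "x \<in> carrier ?F" for x
      proof -
        have x: "x 0 \<in> carrier R" "x = vec1 R (x 0)" using that free1_carrier by blast+
        have "x = vec1 R ((x 0 \<otimes>\<^bsub>R\<^esub> c) \<otimes>\<^bsub>R\<^esub> u 0)"
          using x 1 u(1) by (simp add: L.R.m_assoc)
        also have "\<dots> = (x 0 \<otimes>\<^bsub>R\<^esub> c) \<odot>\<^bsub>?F\<^esub> u"
          using vec1_smult[OF R, of "x 0 \<otimes>\<^bsub>R\<^esub> c" "u 0"] x(1) 1(1) u(2) by simp
        finally show ?thesis using US(5)[of "x 0 \<otimes>\<^bsub>R\<^esub> c" u] x(1) 1(1) uk(1) by simp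
      qed
      then show ?thesis using US(1) by blast
    next
      case 2
      (* a left invertible element of I would kill the generator, against I being proper *)
      have "k \<odot>\<^bsub>L\<^esub> g = \<zero>\<^bsub>L\<^esub>" using ann(1)[OF k] uk(2) by simp
      then have "g = \<zero>\<^bsub>L\<^esub>" using 2 k g(1) L.smult_assoc[of c k g] L.smult_one[of g] by simp
      then have "carrier R \<subseteq> I" using ann(1) by auto
      then show ?thesis using I ann(2) by blast
    qed
  qed
  moreover have "mod_iso R (restrict_mod ?F (a_kernel ?F L ?f)) (restrict_mod (regular R) I)"
    unfolding mod_iso_def
  proof (rule bexI)
    have "(\<lambda>x\<in>carrier ?F. x 0) \<in> Hom R ?F (regular R)"
      by (rule restrict_Hom[OF F.left_module_axioms]) (auto simp: free1_carrier)
    then have "(\<lambda>x\<in>a_kernel ?F L ?f. (\<lambda>x\<in>carrier ?F. x 0) x) \<in> 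
        Hom R (restrict_mod ?F (a_kernel ?F L ?f)) (restrict_mod (regular R) I)"
      by (rule Hom_restrict[OF _ F.left_module_axioms kernel_submodule[OF F.left_module_axioms L f]])
        (use ann(2) in \<open>auto simp: ker\<close>)
    also have "(\<lambda>x\<in>a_kernel ?F L ?f. (\<lambda>x\<in>carrier ?F. x 0) x) = (\<lambda>x\<in>a_kernel ?F L ?f. x 0)"
      by (auto simp: a_kernel_iff fun_eq_iff)
    finally show "(\<lambda>x\<in>a_kernel ?F L ?f. x 0) \<in> 
        Hom R (restrict_mod ?F (a_kernel ?F L ?f)) (restrict_mod (regular R) I)" .
    show "bij_betw (\<lambda>x\<in>a_kernel ?F L ?f. x 0) (carrier (restrict_mod ?F (a_kernel ?F L ?f)))
        (carrier (restrict_mod (regular R) I))"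
      unfolding ker by (auto simp: bij_betw_def inj_on_def image_image)
  qed
  ultimately show ?thesis by (rule that)
qed

text \<open>Syzygies are required to live on a fixed carrier type, so a module has to be copied there before its
  syzygies exist.\<close>

lemma transport_module:
  fixes M :: "('r, 'm) module" and j :: "'m \<Rightarrow> 'n"
  assumes M: "left_module R M" and j: "inj_on j (carrier M)"
  obtains N :: "('r, 'n) module" where "left_module R N" "mod_iso R N M"
proof -
  interpret M: left_module R M by fact
  define h where "h = the_inv_into (carrier M) j"
  have h: "h (j x) = x" if "x \<in> carrier M" for x
    unfolding h_def using the_inv_into_f_f[OF j that] .
  define N :: "('r, 'n) module" where "N = \<lparr>carrier = j ` carrier M, monoid.mult = undefined, monoid.one = undefined,
     ring.zero = j \<zero>\<^bsub>M\<^esub>, ring.add = \<lambda>x y. j (h x \<oplus>\<^bsub>M\<^esub> h y), module.smult = \<lambda>r x. j (r \<odot>\<^bsub>M\<^esub> h x)\<rparr>"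
  have Ns: "carrier N = j ` carrier M" "\<zero>\<^bsub>N\<^esub> = j \<zero>\<^bsub>M\<^esub>" "x \<oplus>\<^bsub>N\<^esub> y = j (h x \<oplus>\<^bsub>M\<^esub> h y)"
     "r \<odot>\<^bsub>N\<^esub> x = j (r \<odot>\<^bsub>M\<^esub> h x)" for x y r
    by (simp_all add: N_def)
  have "abelian_group N"
  proof (rule abelian_groupI)
    fix x assume "x \<in> carrier N"
    then obtain m where "m \<in> carrier M" "x = j m" by (auto simp: Ns)
    then show "\<exists>y\<in>carrier N. y \<oplus>\<^bsub>N\<^esub> x = \<zero>\<^bsub>N\<^esub>"
      by (intro bexI[of _ "j (\<ominus>\<^bsub>M\<^esub> m)"]) (auto simp: Ns h M.M.l_neg)
  qed (auto simp: Ns h M.M.a_ac)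
  then have N: "left_module R N"
    by (rule left_moduleI[OF M.R.ring_axioms])
      (auto simp: Ns h M.smult_closed M.smult_l_distr M.smult_r_distr M.smult_assoc M.smult_one)
  have "(\<lambda>x\<in>carrier N. h x) \<in> Hom R N M"
    by (rule restrict_Hom[OF N]) (auto simp: Ns h M.smult_closed)
  moreover have "bij_betw (\<lambda>x\<in>carrier N. h x) (carrier N) (carrier M)"
    by (auto simp: bij_betw_def Ns inj_on_def h image_image)
  ultimately have "mod_iso R N M" unfolding mod_iso_def by blast
  then show ?thesis using that N by blast
qed

lemma syzygy_0_of_cyclic:
  assumes C: "cyclic_with R M I"
  shows "\<exists>N. is_syzygy R 0 M N" and "is_syzygy R 0 M N \<Longrightarrow> cyclic_with R N I"
proof -
  obtain g where M: "left_module R M" and g: "g \<in> carrier M" "(\<lambda>r. r \<odot>\<^bsub>M\<^esub> g) ` carrier R = carrier M"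
    and ann: "\<And>r. r \<in> carrier R \<Longrightarrow> r \<odot>\<^bsub>M\<^esub> g = \<zero>\<^bsub>M\<^esub> \<longleftrightarrow> r \<in> I" "I \<subseteq> carrier R"
    by (rule cyclic_withE[OF C]) (rule that)
  define rep where "rep x = (SOME r. r \<in> carrier R \<and> r \<odot>\<^bsub>M\<^esub> g = x)" for x
  have rep: "rep x \<odot>\<^bsub>M\<^esub> g = x" if "x \<in> carrier M" for x
  proof -
    have "x \<in> (\<lambda>r. r \<odot>\<^bsub>M\<^esub> g) ` carrier R" using that g(2) by simp
    then have "\<exists>r. r \<in> carrier R \<and> r \<odot>\<^bsub>M\<^esub> g = x" by blast
    from someI_ex[OF this] show ?thesis by (simp add: rep_def)
  qed
  have "inj_on (\<lambda>x. vec1 R (rep x)) (carrier M)"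
    by (rule inj_onI) (metis rep vec1_0)
  then obtain N :: "('a, nat \<Rightarrow> 'a) module" where "left_module R N" "mod_iso R N M"
    by (rule transport_module[OF M]) (rule that)
  then show "\<exists>N. is_syzygy R 0 M N" by auto
  show "is_syzygy R 0 M N \<Longrightarrow> cyclic_with R N I" for N
    using cyclic_with_iso[OF C _ mod_iso_sym[OF _ M]] by auto
qed

text \<open>If the \<open>t\<close>-th syzygy is \<open>R / I\<close>, the ring itself covers it and the next syzygy is \<open>I\<close>.\<close>

lemma syzygy_Suc_of_cyclic:
  assumes loc: "left_local R" and I: "I \<noteq> carrier R"
    and ex: "\<exists>L. is_syzygy R t M L" and C: "\<And>L. is_syzygy R t M L \<Longrightarrow> cyclic_with R L I"
  shows "\<exists>N. is_syzygy R (Suc t) M N"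
    and "is_syzygy R (Suc t) M N \<Longrightarrow> left_module R N \<and> mod_iso R N (restrict_mod (regular R) I)"
proof -
  let ?F = "free1 R"
  have R: "ring R" using loc by (simp add: left_local_def)
  interpret F: left_module R ?F by (rule free_left_module[OF R])
  have L: "left_module R L" if "is_syzygy R t M L" for L using C[OF that] by (simp add: cyclic_with_def)
  have KL: "left_module R (restrict_mod P (a_kernel P L f))"
    if "is_syzygy R t M L" "projective_cover R P f L" for P L and f :: "(nat \<Rightarrow> 'a) \<Rightarrow> nat \<Rightarrow> 'a"
  proof -
    have "left_module R P" "f \<in> Hom R P L" using that by (auto simp: projective_cover_def projective_def)
    then show ?thesis
      using kernel_submodule[OF _ L[OF that(1)]] left_module.restrict_left_module by blast
  qed
  obtain L where Ls: "is_syzygy R t M L" using ex by blast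
  obtain f where f: "projective_cover R ?F f L"
    by (rule cyclic_projective_cover[OF loc C[OF Ls] I]) (rule that)
  have "is_syzygy R (Suc t) M (restrict_mod ?F (a_kernel ?F L f))"
    unfolding is_syzygy.simps
    using KL[OF Ls f] Ls f mod_iso_refl[OF KL[OF Ls f]] by blast
  then show "\<exists>N. is_syzygy R (Suc t) M N" by blast
  show "left_module R N \<and> mod_iso R N (restrict_mod (regular R) I)" if "is_syzygy R (Suc t) M N" for N
  proof -
    from that obtain L and P :: "('a, nat \<Rightarrow> 'a) module" and f where N: "left_module R N" and Ls: "is_syzygy R t M L"
      and f: "projective_cover R P f L" and iso: "mod_iso R N (restrict_mod P (a_kernel P L f))"
      by auto
    obtain f' where f': "projective_cover R ?F f' L"
      "mod_iso R (restrict_mod ?F (a_kernel ?F L f')) (restrict_mod (regular R) I)"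
      by (rule cyclic_projective_cover[OF loc C[OF Ls] I]) (rule that)
    have "mod_iso R N (restrict_mod ?F (a_kernel ?F L f'))"
      by (rule mod_iso_trans[OF N iso projective_cover_kernel_unique[OF L[OF Ls] f'(1) f]])
    then show ?thesis using N mod_iso_trans[OF N _ f'(2)] by blast
  qed
qed

text \<open>The \<open>t\<close>-th syzygy is \<open>R / R m\<^sub>t\<close>. Its syzygy \<open>R m\<^sub>t\<close> is generated by \<open>m\<^sub>t\<close>, whose annihilator is
  \<open>R m\<^sub>t\<^sub>+\<^sub>1\<close>.\<close>

theorem syzygies_of_annihilator_chain:
  assumes loc: "left_local R" and m: "\<And>n. m n \<in> carrier R" "\<And>n. principal R (m n) \<noteq> carrier R"
    and ann: "\<And>n. {r \<in> carrier R. r \<otimes>\<^bsub>R\<^esub> m n = \<zero>\<^bsub>R\<^esub>} = principal R (m (Suc n))"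
    and C: "cyclic_with R M (principal R (m 0))"
  shows "(\<exists>N. is_syzygy R t M N) \<and> (\<forall>N. is_syzygy R t M N \<longrightarrow> cyclic_with R N (principal R (m t)))"
proof (induction t)
  case 0
  show ?case using syzygy_0_of_cyclic[OF C] by blast
next
  case (Suc t)
  have R: "ring R" using loc by (simp add: left_local_def)
  have "cyclic_with R N (principal R (m (Suc t)))" if "is_syzygy R (Suc t) M N" for N
  proof -
    have N: "left_module R N" "mod_iso R N (restrict_mod (regular R) (principal R (m t)))"
      using syzygy_Suc_of_cyclic(2)[OF loc m(2) _ _ that] Suc by blast+
    have RM: "left_module R (restrict_mod (regular R) (principal R (m t)))"
      by (rule left_module.restrict_left_module[OF regular_left_module[OF R] principal_submodule[OF R m(1)]])
    show ?thesis
      using cyclic_with_iso[OF principal_cyclic[OF R m(1)] N(1) mod_iso_sym[OF N(1) RM N(2)]]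
      unfolding ann .
  qed
  moreover have "\<exists>N. is_syzygy R (Suc t) M N"
    using syzygy_Suc_of_cyclic(1)[OF loc m(2)] Suc by blast
  ultimately show ?case by blast
qed

text \<open>Right multiplications by the \<open>m\<^sub>n\<close> resolve \<open>M\<close>. Evaluation at \<open>1\<close> turns a map from \<open>R\<close> to itself
  into an element, and turns composition with the \<open>n\<close>-th differential into left multiplication by
  \<open>m\<^sub>n\<close>; the hypothesis on right annihilators is exactness of the resulting complex.\<close>

theorem semi_Gorenstein_projective_of_annihilator_chain:
  assumes R: "ring R" and m: "\<And>n. m n \<in> carrier R"
    and ann: "\<And>n. {r \<in> carrier R. r \<otimes>\<^bsub>R\<^esub> m n = \<zero>\<^bsub>R\<^esub>} = principal R (m (Suc n))"
    and rann: "\<And>n s. \<lbrakk>s \<in> carrier R; m (Suc n) \<otimes>\<^bsub>R\<^esub> s = \<zero>\<^bsub>R\<^esub>\<rbrakk> \<Longrightarrow> \<exists>r\<in>carrier R. s = m n \<otimes>\<^bsub>R\<^esub> r"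
    and C: "cyclic_with R M (principal R (m 0))"
  shows "semi_Gorenstein_projective R M"
proof -
  obtain g where M: "left_module R M" and g: "g \<in> carrier M" "(\<lambda>r. r \<odot>\<^bsub>M\<^esub> g) ` carrier R = carrier M"
    and annM: "\<And>r. r \<in> carrier R \<Longrightarrow> r \<odot>\<^bsub>M\<^esub> g = \<zero>\<^bsub>M\<^esub> \<longleftrightarrow> r \<in> principal R (m 0)"
    by (rule cyclic_withE[OF C]) (rule that)
  interpret M: left_module R M by (rule M)
  interpret L: left_module R "regular R" by (rule regular_left_module[OF R])
  let ?F = "free1 R"
  interpret F: left_module R ?F by (rule free_left_module[OF R])
  let ?d = "\<lambda>n. vec1_hom R ?F (vec1 R (m n))" and ?e = "vec1_hom R M g"
  have d: "?d n \<in> Hom R ?F ?F" for n by (rule vec1_hom_Hom[OF F.left_module_axioms]) (simp add: m)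
  have dv: "?d n x = vec1 R (x 0 \<otimes>\<^bsub>R\<^esub> m n)" if "x \<in> carrier ?F" for n x
    using that vec1_smult[OF R, of "x 0" "m n"] by (simp add: vec1_hom_def free1_carrier)
  have im: "?d n ` carrier ?F = vec1 R ` principal R (m n)" for n
    unfolding vec1_hom_image principal_def image_image using vec1_smult[OF R, of _ "m n"]
    by (intro image_cong) auto
  have fg: "fg_module R M"
    unfolding fg_module_def
  proof (intro conjI exI[of _ "{g}"] allI impI)
    fix N assume N: "submodule N R M \<and> {g} \<subseteq> N"
    show "N = carrier M"
    proof
      show "N \<subseteq> carrier M" using N M.submoduleD(1) by blast
      show "carrier M \<subseteq> N"
        unfolding g(2)[symmetric] using M.submoduleD(5)[of N] N by blast
    qed
  qed (use M g in auto)
  have ke: "a_kernel ?F M ?e = vec1 R ` principal R (m 0)"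
  proof (intro equalityI subsetI)
    fix x assume "x \<in> a_kernel ?F M ?e"
    then have "x 0 \<in> carrier R" "x = vec1 R (x 0)" "x 0 \<odot>\<^bsub>M\<^esub> g = \<zero>\<^bsub>M\<^esub>"
      unfolding a_kernel_iff free1_carrier by (auto simp: vec1_hom_def free1_carrier)
    then show "x \<in> vec1 R ` principal R (m 0)" using annM by blast
  next
    fix x assume "x \<in> vec1 R ` principal R (m 0)"
    then obtain r where "r \<in> principal R (m 0)" "x = vec1 R r" by blast
    moreover from this have "r \<in> carrier R" using m by (auto simp: principal_def)
    ultimately show "x \<in> a_kernel ?F M ?e" using annM by (simp add: a_kernel_iff vec1_hom_def)
  qed
  have kd: "a_kernel ?F ?F (?d n) = vec1 R ` principal R (m (Suc n))" for n
  proof (intro equalityI subsetI)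
    fix x assume "x \<in> a_kernel ?F ?F (?d n)"
    then have x: "x \<in> carrier ?F" "?d n x = vec1 R \<zero>\<^bsub>R\<^esub>" unfolding a_kernel_iff vec1_zero by auto
    then have "x 0 \<in> carrier R" "x = vec1 R (x 0)" "x 0 \<otimes>\<^bsub>R\<^esub> m n = \<zero>\<^bsub>R\<^esub>"
      unfolding dv[OF x(1)] by (auto simp: free1_carrier)
    then show "x \<in> vec1 R ` principal R (m (Suc n))" using ann by blast
  next
    fix x assume "x \<in> vec1 R ` principal R (m (Suc n))"
    then obtain r where r: "r \<in> carrier R" "r \<otimes>\<^bsub>R\<^esub> m n = \<zero>\<^bsub>R\<^esub>" "x = vec1 R r" using ann by blast
    then have "?d n x = \<zero>\<^bsub>?F\<^esub>" using dv[of x n] vec1_zero[of R] by simp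
    then show "x \<in> a_kernel ?F ?F (?d n)" using r by (simp add: a_kernel_iff del: free_mod_simps)
  qed
  have res: "projective_resolution R M (\<lambda>n. ?F) ?d ?e"
    unfolding projective_resolution_def im ke kd
    using projective_free[OF R] d vec1_hom_Hom[OF M g(1)] vec1_hom_image[of R M g] g(2) by simp
  have "ker_pullback R ?F (?d (Suc j)) ?F (regular R) \<subseteq> im_pullback R ?F (?d j) ?F (regular R)" for j
  proof
    fix \<phi> assume "\<phi> \<in> ker_pullback R ?F (?d (Suc j)) ?F (regular R)"
    then have phi: "\<phi> \<in> Hom R ?F (regular R)" "\<And>x. x \<in> carrier ?F \<Longrightarrow> \<phi> (?d (Suc j) x) = \<zero>\<^bsub>R\<^esub>"
      unfolding ker_pullback_iff[OF F.left_module_axioms d] by auto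
    define l where "l = \<phi> (vec1 R \<one>\<^bsub>R\<^esub>)"
    have l: "l \<in> carrier R" using Hom_closed[OF phi(1), of "vec1 R \<one>\<^bsub>R\<^esub>"] by (simp add: l_def)
    have phil: "\<phi> (vec1 R r) = r \<otimes>\<^bsub>R\<^esub> l" if "r \<in> carrier R" for r
      using Hom_smult[OF phi(1) that, of "vec1 R \<one>\<^bsub>R\<^esub>"] vec1_smult[OF R that, of "\<one>\<^bsub>R\<^esub>"] that
      by (simp add: l_def)
    have "m (Suc j) \<otimes>\<^bsub>R\<^esub> l = \<zero>\<^bsub>R\<^esub>"
      using phi(2)[of "vec1 R \<one>\<^bsub>R\<^esub>"] dv[of "vec1 R \<one>\<^bsub>R\<^esub>" "Suc j"] phil[of "m (Suc j)"] m by simp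
    then obtain s where s: "s \<in> carrier R" "l = m j \<otimes>\<^bsub>R\<^esub> s" using rann l by blast
    have psi: "vec1_hom R (regular R) s \<in> Hom R ?F (regular R)"
      by (rule vec1_hom_Hom[OF L.left_module_axioms]) (simp add: s)
    have "\<phi> = compose (carrier ?F) (vec1_hom R (regular R) s) (?d j)"
    proof (rule Hom_eqI[OF phi(1) Hom_compose[OF F.left_module_axioms d psi]])
      fix x assume x: "x \<in> carrier ?F"
      then have x0: "x 0 \<in> carrier R" "x = vec1 R (x 0)" using free1_carrier by blast+
      have "\<phi> x = x 0 \<otimes>\<^bsub>R\<^esub> l" using phil[OF x0(1)] x0(2) by simp
      then show "\<phi> x = compose (carrier ?F) (vec1_hom R (regular R) s) (?d j) x"
        using x x0(1) m s by (simp add: compose_eq dv vec1_hom_def[of R "regular R"] M.R.m_assoc)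
    qed
    then show "\<phi> \<in> im_pullback R ?F (?d j) ?F (regular R)" using psi by (auto simp: im_pullback_def)
  qed
  then have "trivial_group (Ext R i M (regular R))" if "i \<ge> 1" for i
    by (rule Ext_trivial[OF M L.left_module_axioms res _ that])
  then show ?thesis using fg by (simp add: semi_Gorenstein_projective_def)
qed

text \<open>Write the generator as \<open>u + v\<close> along a decomposition, with \<open>u = a g\<close> and \<open>v = (1 - a) g\<close>. One of
  \<open>a\<close> and \<open>1 - a\<close> has a left inverse, so one of the summands contains \<open>g\<close>.\<close>

theorem cyclic_indecomposable:
  assumes loc: "left_local R" and C: "cyclic_with R M I" and I: "I \<noteq> carrier R"
  shows "indecomposable R M"
proof -
  obtain g where M: "left_module R M" and g: "g \<in> carrier M" "(\<lambda>r. r \<odot>\<^bsub>M\<^esub> g) ` carrier R = carrier M"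
    and ann: "\<And>r. r \<in> carrier R \<Longrightarrow> r \<odot>\<^bsub>M\<^esub> g = \<zero>\<^bsub>M\<^esub> \<longleftrightarrow> r \<in> I" "I \<subseteq> carrier R"
    by (rule cyclic_withE[OF C]) (rule that)
  interpret M: left_module R M by (rule M)
  have g0: "g \<noteq> \<zero>\<^bsub>M\<^esub>" using I ann by auto
  have gen: "W = carrier M" if W: "submodule W R M" and a: "a \<in> carrier R" "a \<odot>\<^bsub>M\<^esub> g \<in> W"
    and c: "c \<in> carrier R" "c \<otimes>\<^bsub>R\<^esub> a = \<one>\<^bsub>R\<^esub>" for W a c
  proof -
    have "c \<odot>\<^bsub>M\<^esub> (a \<odot>\<^bsub>M\<^esub> g) \<in> W" using M.submoduleD(5)[OF W c(1) a(2)] .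
    then have "g \<in> W" using M.smult_assoc[OF c(1) a(1) g(1)] c(2) M.smult_one[OF g(1)] by simp
    then have "carrier M \<subseteq> W" unfolding g(2)[symmetric] using M.submoduleD(5)[OF W] by blast
    then show ?thesis using M.submoduleD(1)[OF W] by blast
  qed
  have False if D: "direct_decomp R M U V" and ne: "U \<noteq> {\<zero>\<^bsub>M\<^esub>}" "V \<noteq> {\<zero>\<^bsub>M\<^esub>}" for U V
  proof -
    have UV: "submodule U R M" "submodule V R M" "U \<inter> V = {\<zero>\<^bsub>M\<^esub>}" "U <+>\<^bsub>M\<^esub> V = carrier M"
      using D by (auto simp: direct_decomp_def)
    note Us = M.submoduleD[OF UV(1)] and Vs = M.submoduleD[OF UV(2)]
    have "g \<in> U <+>\<^bsub>M\<^esub> V" using UV(4) g(1) by simp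
    then obtain u v where uv: "u \<in> U" "v \<in> V" "g = u \<oplus>\<^bsub>M\<^esub> v" unfolding set_add_def' by blast
    have "u \<in> (\<lambda>r. r \<odot>\<^bsub>M\<^esub> g) ` carrier R" unfolding g(2) using uv(1) Us(1) by blast
    then obtain a where a: "a \<in> carrier R" "u = a \<odot>\<^bsub>M\<^esub> g" by blast
    define b where "b = \<ominus>\<^bsub>R\<^esub> a \<oplus>\<^bsub>R\<^esub> \<one>\<^bsub>R\<^esub>"
    have b: "b \<in> carrier R" "a \<oplus>\<^bsub>R\<^esub> b = \<one>\<^bsub>R\<^esub>"
      using a(1) by (simp_all add: b_def M.R.r_neg2)
    have vc: "v \<in> carrier M" using uv(2) Vs(1) by blast
    have uc: "u \<in> carrier M" using uv(1) Us(1) by blast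
    have "u \<oplus>\<^bsub>M\<^esub> b \<odot>\<^bsub>M\<^esub> g = g"
      using M.smult_l_distr[OF a(1) b(1) g(1)] by (simp only: b(2) M.smult_one[OF g(1)] a(2))
    then have "u \<oplus>\<^bsub>M\<^esub> b \<odot>\<^bsub>M\<^esub> g = u \<oplus>\<^bsub>M\<^esub> v" by (rule trans[OF _ uv(3)])
    then have bv: "b \<odot>\<^bsub>M\<^esub> g = v"
      by (rule M.M.add.l_cancel[OF _ M.smult_closed[OF b(1) g(1)] vc uc])
    consider c where "c \<in> carrier R" "c \<otimes>\<^bsub>R\<^esub> a = \<one>\<^bsub>R\<^esub>" | c where "c \<in> carrier R" "c \<otimes>\<^bsub>R\<^esub> b = \<one>\<^bsub>R\<^esub>"
      using loc a(1) b unfolding left_local_def by blast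
    then have "U = carrier M \<or> V = carrier M"
    proof cases
      case (1 c)
      have "a \<odot>\<^bsub>M\<^esub> g \<in> U" using uv(1) a(2) by simp
      then show ?thesis using gen[OF UV(1) a(1) _ 1] by simp
    next
      case (2 c)
      have "b \<odot>\<^bsub>M\<^esub> g \<in> V" using uv(2) bv by simp
      then show ?thesis using gen[OF UV(2) b(1) _ 2] by simp
    qed
    then show False
    proof
      assume "U = carrier M"
      then have "V = {\<zero>\<^bsub>M\<^esub>}" using UV(3) Vs(1) by blast
      then show False using ne by simp
    next
      assume "V = carrier M"
      then have "U = {\<zero>\<^bsub>M\<^esub>}" using UV(3) Us(1) by blast
      then show False using ne by simp
    qed
  qed
  then show ?thesis
    unfolding indecomposable_def decomposable_def using g0 g(1) by (auto simp: set_eq_iff)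
qed

section \<open>Torsionless and Gorenstein-projective modules\<close>

lemma free_coord_Hom:
  assumes "ring R" shows "(\<lambda>x\<in>carrier (free_mod R n). x i) \<in> Hom R (free_mod R n) (regular R)"
  by (rule restrict_Hom[OF free_left_module[OF assms]])
    (use free_mod_coord[OF assms] in auto)

text \<open>An embedding into a free module has coordinates in the regular module, and a nonzero element has a
  nonzero coordinate.\<close>

lemma torsionless_separates:
  assumes M: "left_module R M" and T: "torsionless R M" and x: "x \<in> carrier M"
    and zero: "\<And>\<phi>. \<phi> \<in> Hom R M (regular R) \<Longrightarrow> \<phi> x = \<zero>\<^bsub>R\<^esub>"
  shows "x = \<zero>\<^bsub>M\<^esub>"
proof -
  interpret M: left_module R M by (rule M)
  have R: "ring R" by (rule M.R.ring_axioms)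
  obtain P :: "('a, nat \<Rightarrow> 'a) module" and f where P: "projective R P" and f: "f \<in> Hom R M P" "inj_on f (carrier M)"
    using T unfolding torsionless_def by blast
  obtain n U V where PM: "left_module R P" and D: "direct_decomp R (free_mod R n) U V"
    and iso: "mod_iso R P (restrict_mod (free_mod R n) U)"
    using P by (auto simp: projective_def)
  let ?F = "free_mod R n"
  interpret F: left_module R ?F by (rule free_left_module[OF R])
  interpret P: left_module R P by (rule PM)
  have U: "submodule U R ?F" using D by (simp add: direct_decomp_def)
  note Us = F.submoduleD[OF U]
  obtain i where i: "i \<in> Hom R P (restrict_mod ?F U)" "inj_on i (carrier P)"
    using iso by (auto simp: mod_iso_def bij_betw_def)
  have iF: "i \<in> Hom R P ?F" by (rule Hom_from_submodule[OF i(1) Us(1)])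
  have fx: "f x \<in> carrier P" by (rule Hom_closed[OF f(1) x])
  have ifx: "i (f x) \<in> carrier ?F" by (rule Hom_closed[OF iF fx])
  have "i (f x) k = \<zero>\<^bsub>R\<^esub>" for k
  proof -
    have "compose (carrier M) (\<lambda>x\<in>carrier ?F. x k) (compose (carrier M) i f) x = \<zero>\<^bsub>R\<^esub>"
      by (rule zero[OF Hom_compose[OF M Hom_compose[OF M f(1) iF] free_coord_Hom[OF R]]])
    then show ?thesis using x ifx by (simp add: compose_eq)
  qed
  then have "i (f x) = \<zero>\<^bsub>?F\<^esub>" by auto
  also have "\<dots> = i \<zero>\<^bsub>P\<^esub>" by (rule Hom_zero[OF PM F.left_module_axioms iF, symmetric])
  finally have "f x = \<zero>\<^bsub>P\<^esub>" using i(2) fx P.M.zero_closed by (auto dest: inj_onD)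
  also have "\<dots> = f \<zero>\<^bsub>M\<^esub>" by (rule Hom_zero[OF M PM f(1), symmetric])
  finally show ?thesis using f(2) x M.M.zero_closed by (auto dest: inj_onD)
qed

lemma Gorenstein_projective_torsionless:
  assumes "Gorenstein_projective R M" shows "torsionless R M"
proof -
  obtain P :: "int \<Rightarrow> ('a, nat \<Rightarrow> 'a) module" and d where P: "\<And>i. projective R (P i)"
    and d: "\<And>i. d i \<in> Hom R (P i) (P (i + 1))"
    and iso: "mod_iso R M (restrict_mod (P 1) (d 0 ` carrier (P 0)))"
    using assms unfolding Gorenstein_projective_def by blast
  obtain f where f: "f \<in> Hom R M (restrict_mod (P 1) (d 0 ` carrier (P 0)))" "inj_on f (carrier M)"
    using iso by (auto simp: mod_iso_def bij_betw_def)
  have "d 0 ` carrier (P 0) \<subseteq> carrier (P 1)" using Hom_closed[OF d[of 0]] by auto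
  from Hom_from_submodule[OF f(1) this] show ?thesis
    unfolding torsionless_def using P f(2) by blast
qed

section \<open>Duals\<close>

lemma opp_simps [simp]:
  "carrier (opp R) = carrier R" "\<zero>\<^bsub>opp R\<^esub> = \<zero>\<^bsub>R\<^esub>" "\<one>\<^bsub>opp R\<^esub> = \<one>\<^bsub>R\<^esub>"
  "a \<oplus>\<^bsub>opp R\<^esub> b = a \<oplus>\<^bsub>R\<^esub> b" "a \<otimes>\<^bsub>opp R\<^esub> b = b \<otimes>\<^bsub>R\<^esub> a"
  by (simp_all add: opp_def)

lemma opp_opp [simp]: "opp (opp R) = R"
  by (simp add: opp_def)

lemma opp_ring: assumes "ring R" shows "ring (opp R)"
proof -
  interpret ring R by fact
  show ?thesis
  proof (rule ringI)
    show "abelian_group (opp R)"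
    proof (rule abelian_groupI)
      fix x assume "x \<in> carrier (opp R)"
      then show "\<exists>y\<in>carrier (opp R). y \<oplus>\<^bsub>opp R\<^esub> x = \<zero>\<^bsub>opp R\<^esub>" by (auto intro: l_neg)
    qed (auto simp: a_ac)
    show "monoid (opp R)" by (rule monoidI) (auto simp: m_assoc)
  qed (auto simp: l_distr r_distr)
qed

lemma dual_simps:
  "carrier (dual R M) = Hom R M (regular R)" "\<zero>\<^bsub>dual R M\<^esub> = zero_hom M (regular R)"
  "f \<oplus>\<^bsub>dual R M\<^esub> g = (\<lambda>m\<in>carrier M. f m \<oplus>\<^bsub>R\<^esub> g m)"
  "r \<odot>\<^bsub>dual R M\<^esub> f = (\<lambda>m\<in>carrier M. f m \<otimes>\<^bsub>R\<^esub> r)"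
  by (simp_all add: dual_def)

lemma dual_left_module:
  assumes M: "left_module R M" shows "left_module (opp R) (dual R M)"
proof -
  interpret M: left_module R M by (rule M)
  have R: "ring R" by (rule M.R.ring_axioms)
  interpret L: left_module R "regular R" by (rule regular_left_module[OF R])
  have eq: "f = g" if "f \<in> Hom R M (regular R)" "g \<in> Hom R M (regular R)"
    "\<And>x. x \<in> carrier M \<Longrightarrow> f x = g x" for f g
    by (rule Hom_eqI[OF that])
  have add: "(\<lambda>m\<in>carrier M. f m \<oplus>\<^bsub>R\<^esub> g m) \<in> Hom R M (regular R)"
    if "f \<in> Hom R M (regular R)" "g \<in> Hom R M (regular R)" for f g
    using Hom_pointwise_add[OF M L.left_module_axioms that] by simp
  have neg: "(\<lambda>m\<in>carrier M. \<ominus>\<^bsub>R\<^esub> f m) \<in> Hom R M (regular R)"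
    if f: "f \<in> Hom R M (regular R)" for f
    by (rule restrict_Hom[OF M])
      (use Hom_closed[OF f] in \<open>auto simp: Hom_add[OF f] Hom_smult[OF f] M.R.minus_add M.R.r_minus\<close>)
  have smult: "(\<lambda>m\<in>carrier M. f m \<otimes>\<^bsub>R\<^esub> r) \<in> Hom R M (regular R)"
    if f: "f \<in> Hom R M (regular R)" and r: "r \<in> carrier R" for f r
    by (rule restrict_Hom[OF M])
      (use Hom_closed[OF f] r in \<open>auto simp: Hom_add[OF f] Hom_smult[OF f] M.R.l_distr M.R.m_assoc\<close>)
  have cl: "f x \<in> carrier R" if "f \<in> Hom R M (regular R)" "x \<in> carrier M" for f x
    using Hom_closed[OF that] by simp
  note zero = zero_hom_Hom[OF M L.left_module_axioms]
  show ?thesis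
  proof (rule left_moduleI)
    show "ring (opp R)" by (rule opp_ring[OF R])
    show "abelian_group (dual R M)"
    proof (rule abelian_groupI, goal_cases)
      case (5 f)
      then show ?case
        using eq[OF add[OF zero] , of f f] cl[of f]
        by (simp add: dual_simps) (auto simp: zero_hom_def)
    next
      case (6 f)
      then have f: "f \<in> Hom R M (regular R)" by (simp add: dual_simps)
      have "(\<lambda>m\<in>carrier M. \<ominus>\<^bsub>R\<^esub> f m) \<oplus>\<^bsub>dual R M\<^esub> f = zero_hom M (regular R)"
        unfolding dual_simps
        by (rule eq[OF add[OF neg[OF f] f] zero]) (simp add: zero_hom_def cl[OF f] M.R.l_neg)
      then show ?case using neg[OF f] unfolding dual_simps(1,2) by (rule bexI)
    qed (auto simp: dual_simps add zero cl M.R.a_ac cong: restrict_cong)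
    fix f assume "f \<in> carrier (dual R M)"
    then have f: "f \<in> Hom R M (regular R)" by (simp add: dual_simps)
    show "\<one>\<^bsub>opp R\<^esub> \<odot>\<^bsub>dual R M\<^esub> f = f"
      unfolding dual_simps opp_simps
      by (rule eq[OF smult[OF f] f]) (simp_all add: cl[OF f])
  qed (auto simp: dual_simps add smult cl M.R.l_distr M.R.r_distr M.R.m_assoc cong: restrict_cong)
qed

text \<open>A homomorphism on \<open>R g\<close> is determined by its value at \<open>g\<close>, and the possible values are the elements
  that the annihilator of \<open>g\<close> kills from the left.\<close>

lemma dual_of_cyclic:
  assumes C: "cyclic_with R M I"
  shows "submodule {s \<in> carrier R. \<forall>r\<in>I. r \<otimes>\<^bsub>R\<^esub> s = \<zero>\<^bsub>R\<^esub>} (opp R) (regular (opp R))" (is "submodule ?S _ _")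
    and "mod_iso (opp R) (dual R M) (restrict_mod (regular (opp R)) {s \<in> carrier R. \<forall>r\<in>I. r \<otimes>\<^bsub>R\<^esub> s = \<zero>\<^bsub>R\<^esub>})"
proof -
  obtain g where M: "left_module R M" and g: "g \<in> carrier M" "(\<lambda>r. r \<odot>\<^bsub>M\<^esub> g) ` carrier R = carrier M"
    and ann: "\<And>r. r \<in> carrier R \<Longrightarrow> r \<odot>\<^bsub>M\<^esub> g = \<zero>\<^bsub>M\<^esub> \<longleftrightarrow> r \<in> I" "I \<subseteq> carrier R"
    by (rule cyclic_withE[OF C]) (rule that)
  interpret M: left_module R M by (rule M)
  have R: "ring R" by (rule M.R.ring_axioms)
  interpret L: left_module R "regular R" by (rule regular_left_module[OF R])
  interpret O: left_module "opp R" "regular (opp R)" by (rule regular_left_module[OF opp_ring[OF R]])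
  show "submodule ?S (opp R) (regular (opp R))"
  proof (rule O.submoduleI)
    fix a b assume "a \<in> ?S" "b \<in> ?S"
    then show "a \<oplus>\<^bsub>regular (opp R)\<^esub> b \<in> ?S" using ann(2) by (auto simp: M.R.r_distr subset_iff)
  next
    fix a b assume "a \<in> carrier (opp R)" "b \<in> ?S"
    then show "a \<odot>\<^bsub>regular (opp R)\<^esub> b \<in> ?S"
      using ann(2) by (auto simp: subset_iff M.R.m_assoc[symmetric])
  qed (use ann(2) in auto)
  have gen: "\<exists>r\<in>carrier R. x = r \<odot>\<^bsub>M\<^esub> g" if "x \<in> carrier M" for x
    using that unfolding g(2)[symmetric] by blast
  have D: "left_module (opp R) (dual R M)" by (rule dual_left_module[OF M])
  have fg: "f g \<in> ?S" if f: "f \<in> Hom R M (regular R)" for f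
  proof -
    have "r \<otimes>\<^bsub>R\<^esub> f g = \<zero>\<^bsub>R\<^esub>" if "r \<in> I" for r
    proof -
      have r: "r \<in> carrier R" using that ann(2) by blast
      then have "r \<odot>\<^bsub>M\<^esub> g = \<zero>\<^bsub>M\<^esub>" using ann(1) that by blast
      then show ?thesis
        using Hom_smult[OF f r g(1)] Hom_zero[OF M L.left_module_axioms f] by simp
    qed
    then show ?thesis using Hom_closed[OF f g(1)] by simp
  qed
  let ?ev = "\<lambda>f\<in>carrier (dual R M). f g"
  have h: "?ev \<in> Hom (opp R) (dual R M) (restrict_mod (regular (opp R)) ?S)"
    by (rule restrict_Hom[OF D]) (use g(1) fg in \<open>auto simp: dual_simps\<close>)
  have inj: "inj_on ?ev (carrier (dual R M))"
  proof (rule inj_onI)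
    fix f h assume fh: "f \<in> carrier (dual R M)" "h \<in> carrier (dual R M)"
      "?ev f = ?ev h"
    then have f: "f \<in> Hom R M (regular R)" and h: "h \<in> Hom R M (regular R)" and eq: "f g = h g"
      by (auto simp: dual_simps)
    show "f = h"
    proof (rule Hom_eqI[OF f h])
      fix x assume "x \<in> carrier M"
      then obtain r where "r \<in> carrier R" "x = r \<odot>\<^bsub>M\<^esub> g" using gen by blast
      then show "f x = h x" using Hom_smult[OF f _ g(1)] Hom_smult[OF h _ g(1)] eq by simp
    qed
  qed
  have surj: "\<exists>f\<in>Hom R M (regular R). f g = s" if s: "s \<in> ?S" for s
  proof -
    have sc: "s \<in> carrier R" and ks: "\<And>r. r \<in> I \<Longrightarrow> r \<otimes>\<^bsub>R\<^esub> s = \<zero>\<^bsub>R\<^esub>" using s by auto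
    have reg: "(\<lambda>r\<in>carrier (regular R). r \<otimes>\<^bsub>R\<^esub> s) \<in> Hom R (regular R) (regular R)"
      by (rule restrict_Hom[OF L.left_module_axioms])
        (use sc in \<open>auto simp: M.R.l_distr M.R.m_assoc\<close>)
    have gm: "(\<lambda>r\<in>carrier (regular R). r \<odot>\<^bsub>M\<^esub> g) \<in> Hom R (regular R) M"
      by (rule restrict_Hom[OF L.left_module_axioms])
        (use g(1) in \<open>auto simp: M.smult_l_distr M.smult_assoc M.smult_closed\<close>)
    have gs: "(\<lambda>r\<in>carrier (regular R). r \<odot>\<^bsub>M\<^esub> g) ` carrier (regular R) = carrier M"
      using g(2) by auto
    obtain \<psi> where psi: "\<psi> \<in> Hom R M (regular R)"
      "\<And>x. x \<in> carrier (regular R) \<Longrightarrow>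
        \<psi> ((\<lambda>r\<in>carrier (regular R). r \<odot>\<^bsub>M\<^esub> g) x) = (\<lambda>r\<in>carrier (regular R). r \<otimes>\<^bsub>R\<^esub> s) x"
    proof (rule factor_through_surjection[OF L.left_module_axioms M L.left_module_axioms gm gs reg])
      fix x assume "x \<in> a_kernel (regular R) M (\<lambda>r\<in>carrier (regular R). r \<odot>\<^bsub>M\<^esub> g)"
      then have "x \<in> carrier R" "x \<in> I" using ann(1) by (auto simp: a_kernel_iff)
      then show "(\<lambda>r\<in>carrier (regular R). r \<otimes>\<^bsub>R\<^esub> s) x = \<zero>\<^bsub>regular R\<^esub>" using ks by simp
    qed (rule that)
    have "\<psi> g = s" using psi(2)[of "\<one>\<^bsub>R\<^esub>"] sc g(1) by (simp add: M.smult_one)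
    then show ?thesis using psi(1) by blast
  qed
  have im: "?ev ` carrier (dual R M) = ?S"
  proof (intro equalityI subsetI)
    fix s assume "s \<in> ?S"
    then obtain f where "f \<in> Hom R M (regular R)" "f g = s" using surj by blast
    then show "s \<in> ?ev ` carrier (dual R M)"
      by (intro image_eqI[of _ _ f]) (auto simp: dual_simps)
  next
    fix s assume "s \<in> ?ev ` carrier (dual R M)"
    then obtain f where f: "f \<in> Hom R M (regular R)" "s = f g" by (auto simp: dual_simps)
    show "s \<in> ?S" unfolding f(2) by (rule fg[OF f(1)])
  qed
  show "mod_iso (opp R) (dual R M) (restrict_mod (regular (opp R)) ?S)"
    unfolding mod_iso_def
  proof (rule bexI[OF _ h])
    show "bij_betw ?ev (carrier (dual R M))
        (carrier (restrict_mod (regular (opp R)) ?S))"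
      using inj im by (simp add: bij_betw_def)
  qed
qed

section \<open>Decomposability and dimension under isomorphisms\<close>

lemma decomposable_iso:
  assumes M: "left_module R M" and N: "left_module R N" and iso: "mod_iso R M N" and D: "decomposable R M"
  shows "decomposable R N"
proof -
  interpret M: left_module R M by (rule M)
  interpret N: left_module R N by (rule N)
  obtain f where f: "f \<in> Hom R M N" "bij_betw f (carrier M) (carrier N)"
    using iso unfolding mod_iso_def by blast
  have inj: "inj_on f (carrier M)" and surj: "f ` carrier M = carrier N" using f(2) by (auto simp: bij_betw_def)
  obtain U V where U: "submodule U R M" and V: "submodule V R M" and int: "U \<inter> V = {\<zero>\<^bsub>M\<^esub>}"
    and sum: "U <+>\<^bsub>M\<^esub> V = carrier M" and ne: "U \<noteq> {\<zero>\<^bsub>M\<^esub>}" "V \<noteq> {\<zero>\<^bsub>M\<^esub>}"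
    using D unfolding decomposable_def direct_decomp_def by blast
  note Us = M.submoduleD[OF U] and Vs = M.submoduleD[OF V]
  have f0: "f \<zero>\<^bsub>M\<^esub> = \<zero>\<^bsub>N\<^esub>" by (rule Hom_zero[OF M N f(1)])
  have nz: "f ` W \<noteq> {\<zero>\<^bsub>N\<^esub>}" if W: "W \<subseteq> carrier M" "\<zero>\<^bsub>M\<^esub> \<in> W" "W \<noteq> {\<zero>\<^bsub>M\<^esub>}" for W
  proof -
    obtain w where w: "w \<in> W" "w \<noteq> \<zero>\<^bsub>M\<^esub>" using W by blast
    then have "f w \<noteq> f \<zero>\<^bsub>M\<^esub>" using inj W(1,2) by (auto simp: inj_on_def)
    then show ?thesis using w(1) f0 by auto
  qed
  have "f ` U \<inter> f ` V = f ` (U \<inter> V)" by (rule inj_on_image_Int[OF inj Us(1) Vs(1), symmetric])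
  then have "f ` U \<inter> f ` V = {\<zero>\<^bsub>N\<^esub>}" using int f0 by simp
  moreover have "f ` U <+>\<^bsub>N\<^esub> f ` V = carrier N"
  proof -
    have "f ` U <+>\<^bsub>N\<^esub> f ` V = f ` (U <+>\<^bsub>M\<^esub> V)"
      using Us(1) Vs(1) unfolding set_add_def' by (auto simp: subset_iff image_iff Hom_add[OF f(1)]) (metis Hom_add[OF f(1)])+
    then show ?thesis using sum surj by simp
  qed
  ultimately have "direct_decomp R N (f ` U) (f ` V)"
    unfolding direct_decomp_def using image_submodule[OF M N f(1) U] image_submodule[OF M N f(1) V] by blast
  then show ?thesis
    unfolding decomposable_def using nz[OF Us(1,2) ne(1)] nz[OF Vs(1,2) ne(2)] by blast
qed

lemma has_dim_3I:
  assumes M: "left_module R M" and \<iota>: "\<And>c. \<iota> c \<in> carrier R"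
    and b: "b0 \<in> carrier M" "b1 \<in> carrier M" "b2 \<in> carrier M"
    and bij: "bij_betw (\<lambda>(c0, c1, c2). \<iota> c0 \<odot>\<^bsub>M\<^esub> b0 \<oplus>\<^bsub>M\<^esub> (\<iota> c1 \<odot>\<^bsub>M\<^esub> b1 \<oplus>\<^bsub>M\<^esub> \<iota> c2 \<odot>\<^bsub>M\<^esub> b2)) UNIV (carrier M)"
      (is "bij_betw ?comb _ _")
  shows "has_dim \<iota> M 3"
proof -
  interpret M: left_module R M by (rule M)
  define b where "b i = (if i = 0 then b0 else if i = 1 then b1 else b2)" for i :: nat
  have three: "{..<3::nat} = {0, 1, 2}" by auto
  have sum: "(\<Oplus>\<^bsub>M\<^esub>i\<in>{..<3}. \<iota> (c i) \<odot>\<^bsub>M\<^esub> b i) = ?comb (c 0, c 1, c 2)" for c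
    unfolding three using M.smult_closed[OF \<iota>] b by (simp add: b_def Pi_def)
  show ?thesis
    unfolding has_dim_def
  proof (intro bexI ballI)
    show "b \<in> {..<3} \<rightarrow> carrier M" using assms(3-5) by (auto simp: b_def)
    fix m assume "m \<in> carrier M"
    then obtain c0 c1 c2 where c: "m = ?comb (c0, c1, c2)"
      using bij unfolding bij_betw_def by (metis (no_types, lifting) imageE prod_cases3)
    show "\<exists>!c. c \<in> {..<3::nat} \<rightarrow>\<^sub>E UNIV \<and> m = (\<Oplus>\<^bsub>M\<^esub>i\<in>{..<3}. \<iota> (c i) \<odot>\<^bsub>M\<^esub> b i)"
      unfolding sum
    proof (rule ex1I)
      let ?c = "\<lambda>i\<in>{..<3::nat}. if i = 0 then c0 else if i = 1 then c1 else c2"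
      show "?c \<in> {..<3} \<rightarrow>\<^sub>E UNIV \<and> m = ?comb (?c 0, ?c 1, ?c 2)"
        using c by simp
      fix c assume c': "c \<in> {..<3::nat} \<rightarrow>\<^sub>E UNIV \<and> m = ?comb (c 0, c 1, c 2)"
      then have "?comb (c 0, c 1, c 2) = ?comb (c0, c1, c2)" using c by simp
      then have "(c 0, c 1, c 2) = (c0, c1, c2)" using bij by (meson UNIV_I bij_betw_def inj_onD)
      then show "c = ?c"
        using c' by (intro ext) (auto simp: PiE_def extensional_def restrict_def three)
    qed
  qed
qed

lemma has_dim_3_iso:
  assumes M: "left_module R M" and N: "left_module R N" and iso: "mod_iso R M N" and \<iota>: "\<And>c. \<iota> c \<in> carrier R"
    and b: "b0 \<in> carrier M" "b1 \<in> carrier M" "b2 \<in> carrier M"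
    and bij: "bij_betw (\<lambda>(c0, c1, c2). \<iota> c0 \<odot>\<^bsub>M\<^esub> b0 \<oplus>\<^bsub>M\<^esub> (\<iota> c1 \<odot>\<^bsub>M\<^esub> b1 \<oplus>\<^bsub>M\<^esub> \<iota> c2 \<odot>\<^bsub>M\<^esub> b2)) UNIV (carrier M)"
      (is "bij_betw ?comb _ _")
  shows "has_dim \<iota> N 3"
proof -
  interpret M: left_module R M by (rule M)
  obtain f where f: "f \<in> Hom R M N" "bij_betw f (carrier M) (carrier N)"
    using iso unfolding mod_iso_def by blast
  have eq: "f \<circ> ?comb = (\<lambda>(c0, c1, c2). \<iota> c0 \<odot>\<^bsub>N\<^esub> f b0 \<oplus>\<^bsub>N\<^esub> (\<iota> c1 \<odot>\<^bsub>N\<^esub> f b1 \<oplus>\<^bsub>N\<^esub> \<iota> c2 \<odot>\<^bsub>N\<^esub> f b2))"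
    using b M.smult_closed[OF \<iota>] by (auto simp: fun_eq_iff Hom_add[OF f(1)] Hom_smult[OF f(1)] \<iota>)
  show ?thesis
    by (rule has_dim_3I[where \<iota> = \<iota>, OF N \<iota> Hom_closed[OF f(1) b(1)] Hom_closed[OF f(1) b(2)] Hom_closed[OF f(1) b(3)]])
      (rule bij_betw_trans[OF bij f(2), unfolded eq])
qed

section \<open>The free algebra and coordinates on the quotient\<close>

lemma free_alg_simps [simp]:
  "f \<in> carrier free_alg \<longleftrightarrow> finite {w. f w \<noteq> 0}"
  "\<zero>\<^bsub>free_alg\<^esub> = (\<lambda>w. 0)" "\<one>\<^bsub>free_alg\<^esub> = word []"
  "f \<oplus>\<^bsub>free_alg\<^esub> g = (\<lambda>w. f w + g w)"
  by (simp_all add: free_alg_def word_def)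

abbreviation free_mult :: "(gen list \<Rightarrow> 'k::field) \<Rightarrow> (gen list \<Rightarrow> 'k) \<Rightarrow> gen list \<Rightarrow> 'k"
    (infixl \<open>\<star>\<close> 70) where
  "f \<star> g \<equiv> f \<otimes>\<^bsub>free_alg\<^esub> g"

lemma free_alg_mult: "(f \<star> g) w = (\<Sum>i\<le>length w. f (take i w) * g (drop i w))"
  by (simp add: free_alg_def)

text \<open>Both sides sum over the ways of cutting a word into three pieces; the substitution replaces the
  position of the second cut by the length of the middle piece.\<close>

lemma free_alg_mult_assoc:
  "((f \<star> g) \<star> h) = (f \<star> (g \<star> h))"
proof
  fix w :: "gen list"
  let ?n = "length w"
  define G where "G i l = f (take i w) * g (take l (drop i w)) * h (drop (i + l) w)" for i l
  have "((f \<star> g) \<star> h) w = (\<Sum>k\<le>?n. \<Sum>i\<le>k. G i (k - i))"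
    unfolding free_alg_mult sum_distrib_right
    by (intro sum.cong refl) (auto simp: G_def drop_take min_def)
  also have "\<dots> = (\<Sum>(i, l)\<in>{(i, l). i + l \<le> ?n}. G i l)"
    by (rule sum.triangle_reindex_eq[symmetric])
  also have "{(i, l). i + l \<le> ?n} = (SIGMA i:{..?n}. {..?n - i})" by auto
  also have "(\<Sum>(i, l)\<in>(SIGMA i:{..?n}. {..?n - i}). G i l) = (\<Sum>i\<le>?n. \<Sum>l\<le>?n - i. G i l)"
    by (rule sum.Sigma[symmetric]) auto
  also have "\<dots> = (f \<star> (g \<star> h)) w"
    unfolding free_alg_mult sum_distrib_left
    by (intro sum.cong refl) (auto simp: G_def mult.assoc add.commute)
  finally show "((f \<star> g) \<star> h) w = (f \<star> (g \<star> h)) w" .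
qed

lemma word_mult: "word u \<star> word v = (word (u @ v) :: gen list \<Rightarrow> 'k::field)"
proof
  fix w :: "gen list"
  show "(word u \<star> word v) w = (word (u @ v) w :: 'k)"
  proof (cases "w = u @ v")
    case True
    have "(word u \<star> word v) w = (\<Sum>i\<le>length w. if i = length u then 1 else (0::'k))"
      unfolding free_alg_mult
    proof (rule sum.cong[OF refl])
      fix i assume "i \<in> {..length w}"
      then have "take i w = u \<longleftrightarrow> i = length u" using True by (metis append_eq_conv_conj atMost_iff length_take min.absorb2)
      then show "word u (take i w) * word v (drop i w) = (if i = length u then 1 else 0)"
        using True by (auto simp: word_def)
    qed
    also have "\<dots> = 1" using True by simp
    finally show ?thesis using True by (simp add: word_def)
  next
    case False
    have "word u (take i w) * word v (drop i w) = (0::'k)" for i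
      using False append_take_drop_id[of i w] by (auto simp: word_def)
    then have "(word u \<star> word v) w = (0::'k)"
      unfolding free_alg_mult by (rule sum.neutral[OF ballI])
    then show ?thesis using False by (simp add: word_def)
  qed
qed

lemma scalar_word_mult: "(\<lambda>w. c * word [] w) \<star> f = (\<lambda>w. c * f w)"
proof
  fix w
  have "((\<lambda>w. c * word [] w) \<star> f) w = (\<Sum>i\<le>length w. if i = 0 then c * f w else 0)"
    unfolding free_alg_mult by (rule sum.cong[OF refl]) (auto simp: word_def)
  then show "((\<lambda>w. c * word [] w) \<star> f) w = c * f w" by simp
qed

lemma mult_empty_word: "f \<star> word [] = f"
proof
  fix w
  have "(f \<star> word []) w = (\<Sum>i\<le>length w. if i = length w then f w else 0)"
    unfolding free_alg_mult by (rule sum.cong[OF refl]) (auto simp: word_def)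
  then show "(f \<star> word []) w = f w" by simp
qed

lemma word_carrier [simp]: "finite {w. word u w \<noteq> 0}"
  by (rule finite_subset[of _ "{u}"]) (auto simp: word_def)

lemma scaled_carrier [simp]: "finite {w. f w \<noteq> 0} \<Longrightarrow> finite {w. (c::'k::field) * f w \<noteq> 0}"
  by (rule rev_finite_subset) auto

lemma add_carrier [simp]:
  "\<lbrakk>finite {w. f w \<noteq> 0}; finite {w. g w \<noteq> 0}\<rbrakk> \<Longrightarrow> finite {w. f w + (g w :: 'k::field) \<noteq> 0}"
  by (rule finite_subset[of _ "{w. f w \<noteq> 0} \<union> {w. g w \<noteq> 0}"]) auto

lemma mult_carrier:
  assumes "finite {w. f w \<noteq> 0}" "finite {w. g w \<noteq> 0}"
  shows "finite {w. (f \<star> g) w \<noteq> 0}"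
proof (rule finite_subset)
  show "{w. (f \<star> g) w \<noteq> 0} \<subseteq> (\<lambda>(u, v). u @ v) ` ({w. f w \<noteq> 0} \<times> {w. g w \<noteq> 0})"
  proof
    fix w assume "w \<in> {w. (f \<star> g) w \<noteq> 0}"
    then obtain i where "f (take i w) * g (drop i w) \<noteq> 0"
      unfolding free_alg_mult by (auto elim: sum.not_neutral_contains_not_neutral)
    then show "w \<in> (\<lambda>(u, v). u @ v) ` ({w. f w \<noteq> 0} \<times> {w. g w \<noteq> 0})"
      by (intro image_eqI[of _ _ "(take i w, drop i w)"]) auto
  qed
qed (use assms in auto)

lemma free_alg_ring: "ring (free_alg :: (gen list \<Rightarrow> 'k::field) ring)"
proof (rule ringI)
  show "abelian_group (free_alg :: (gen list \<Rightarrow> 'k) ring)"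
  proof (rule abelian_groupI)
    fix f :: "gen list \<Rightarrow> 'k" assume "f \<in> carrier free_alg"
    then show "\<exists>g\<in>carrier free_alg. g \<oplus>\<^bsub>free_alg\<^esub> f = \<zero>\<^bsub>free_alg\<^esub>"
      by (intro bexI[of _ "\<lambda>w. - f w"]) auto
  qed (auto simp: algebra_simps)
  show "monoid (free_alg :: (gen list \<Rightarrow> 'k) ring)"
  proof (rule monoidI)
    fix f :: "gen list \<Rightarrow> 'k"
    show "\<one>\<^bsub>free_alg\<^esub> \<star> f = f" using scalar_word_mult[of 1 f] by simp
  qed (auto simp: mult_carrier free_alg_mult_assoc mult_empty_word)
qed (auto simp: fun_eq_iff free_alg_mult algebra_simps sum.distrib)

type_synonym 'k six = "'k \<times> 'k \<times> 'k \<times> 'k \<times> 'k \<times> 'k"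

text \<open>The coordinates of the class of \<open>f\<close> in the basis \<open>1, x, y, z, yx, zx\<close>, using \<open>xy = -q yx\<close> and
  \<open>xz = zy = zx\<close>. Words of length at least three do not enter, as they turn out to be zero.\<close>

definition coords :: "'k::field \<Rightarrow> (gen list \<Rightarrow> 'k) \<Rightarrow> 'k six" where
  "coords q f = (f [], f [gx], f [gy], f [gz], f [gy, gx] - q * f [gx, gy],
     f [gz, gx] + f [gx, gz] + f [gz, gy])"

fun six_mult :: "'k::field \<Rightarrow> 'k six \<Rightarrow> 'k six \<Rightarrow> 'k six" where
  "six_mult q (a, b, c, d, e, f) (a', b', c', d', e', f') =
    (a * a', a * b' + b * a', a * c' + c * a', a * d' + d * a',
     a * e' + e * a' + c * b' - q * b * c',
     a * f' + f * a' + b * d' + d * b' + d * c')"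

fun six_add :: "'k::field six \<Rightarrow> 'k six \<Rightarrow> 'k six" where
  "six_add (a, b, c, d, e, f) (a', b', c', d', e', f') = (a + a', b + b', c + c', d + d', e + e', f + f')"

lemma coords_mult: "coords q (f \<star> g) = six_mult q (coords q f) (coords q g)"
  by (simp add: coords_def free_alg_mult atMost_Suc algebra_simps)

lemma coords_add: "coords q (f \<oplus>\<^bsub>free_alg\<^esub> g) = six_add (coords q f) (coords q g)"
  by (simp add: coords_def algebra_simps)

abbreviation rel_ideal :: "'k::field \<Rightarrow> (gen list \<Rightarrow> 'k) set" where
  "rel_ideal q \<equiv> Idl\<^bsub>free_alg\<^esub> (relations q)"

lemma relations_carrier: "relations q \<subseteq> carrier free_alg"
proof -
  have "finite {w. word u w - word v w \<noteq> (0::'a)}" for u v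
    by (rule finite_subset[of _ "{u, v}"]) (auto simp: word_def)
  then show ?thesis by (auto simp: relations_def)
qed

lemma rel_ideal_ideal: "ideal (rel_ideal q) free_alg"
  by (rule ring.genideal_ideal[OF free_alg_ring relations_carrier])

text \<open>The coordinates are multiplicative, so the elements with vanishing coordinates form an ideal; the seven
  relations lie in it.\<close>

lemma rel_ideal_coords: "f \<in> rel_ideal q \<Longrightarrow> f \<in> carrier free_alg \<and> coords q f = (0, 0, 0, 0, 0, 0)"
proof -
  interpret ring "free_alg :: (gen list \<Rightarrow> 'a) ring" by (rule free_alg_ring)
  let ?J = "{f \<in> carrier free_alg. coords q f = (0, 0, 0, 0, 0, 0)}"
  have "ideal ?J free_alg"
  proof (rule idealI)
    show "ring free_alg" by (rule free_alg_ring)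
    show "subgroup ?J (add_monoid free_alg)"
    proof (rule add.subgroupI)
      fix f assume f: "f \<in> ?J"
      then have "(\<lambda>w. - f w) \<oplus>\<^bsub>free_alg\<^esub> f = \<zero>\<^bsub>free_alg\<^esub>" "(\<lambda>w. - f w) \<in> carrier free_alg" by auto
      then have "\<ominus>\<^bsub>free_alg\<^esub> f = (\<lambda>w. - f w)" using f by (intro minus_equality) auto
      moreover have "(\<lambda>w. - f w) \<in> ?J" using f by (auto simp: coords_def add_eq_0_iff)
      ultimately show "\<ominus>\<^bsub>free_alg\<^esub> f \<in> ?J" by simp
    next
      fix f g assume "f \<in> ?J" "g \<in> ?J"
      then show "f \<oplus>\<^bsub>free_alg\<^esub> g \<in> ?J" using coords_add[of q f g] by auto
    qed (auto simp: coords_def intro: exI[of _ "\<lambda>w. 0"])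
  qed (auto simp: coords_mult mult_carrier, (simp add: coords_def)+)
  moreover have "relations q \<subseteq> ?J"
    using relations_carrier[of q] by (auto simp: relations_def coords_def word_def)
  ultimately have "rel_ideal q \<subseteq> ?J" by (rule genideal_minimal)
  then show "f \<in> rel_ideal q \<Longrightarrow> f \<in> carrier free_alg \<and> coords q f = (0, 0, 0, 0, 0, 0)" by blast
qed

lemma rel_ideal_add: "\<lbrakk>f \<in> rel_ideal q; g \<in> rel_ideal q\<rbrakk> \<Longrightarrow> (\<lambda>w. f w + g w) \<in> rel_ideal q"
  using additive_subgroup.a_closed[OF ideal.axioms(1)[OF rel_ideal_ideal]] by fastforce

lemma rel_ideal_zero: "(\<lambda>w. 0) \<in> rel_ideal q"
  using additive_subgroup.zero_closed[OF ideal.axioms(1)[OF rel_ideal_ideal]] by fastforce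

lemma rel_ideal_scale: "f \<in> rel_ideal q \<Longrightarrow> (\<lambda>w. c * f w) \<in> rel_ideal q"
  using ideal.I_l_closed[OF rel_ideal_ideal, of f q "\<lambda>w. c * word [] w"]
  by (simp add: scalar_word_mult)

lemma rel_ideal_diff: "\<lbrakk>f \<in> rel_ideal q; g \<in> rel_ideal q\<rbrakk> \<Longrightarrow> (\<lambda>w. f w - g w) \<in> rel_ideal q"
  using rel_ideal_add[OF _ rel_ideal_scale[of g q "- 1"]] by simp

lemma rel_ideal_multiple:
  assumes "f \<in> rel_ideal q"
  shows "word u \<star> f \<in> rel_ideal q" "f \<star> word v \<in> rel_ideal q"
  using ideal.I_l_closed[OF rel_ideal_ideal assms] ideal.I_r_closed[OF rel_ideal_ideal assms]
  by (simp_all add: word_carrier)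

lemma rel_ideal_gen: "f \<in> relations q \<Longrightarrow> f \<in> rel_ideal q"
  using ring.genideal_self[OF free_alg_ring relations_carrier] by blast

lemma rel_ideal_word: 
  assumes "word u \<in> rel_ideal q" shows "word (a @ u @ b) \<in> rel_ideal q"
  using rel_ideal_multiple(1)[OF rel_ideal_multiple(2)[OF assms, of b], of a] by (simp add: word_mult)

lemma linear_mult_word:
  "word a \<star> ((\<lambda>w. word u w + c * word v w) \<star> word b)
    = (\<lambda>w. word (a @ u @ b) w + c * word (a @ v @ b) w)" (is "?L = _")
proof -
  have l: "(\<lambda>w. word u w + c * word v w) \<star> word b = (\<lambda>w. word (u @ b) w + c * word (v @ b) w)"
    unfolding word_mult[symmetric]
    by (auto simp: fun_eq_iff free_alg_mult sum.distrib sum_distrib_left algebra_simps)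
  have "word a \<star> (\<lambda>w. word u' w + c * word v' w) = (\<lambda>w. word (a @ u') w + c * word (a @ v') w)" for u' v'
    unfolding word_mult[symmetric]
    by (auto simp: fun_eq_iff free_alg_mult sum.distrib sum_distrib_left algebra_simps)
  then show ?thesis unfolding l by simp
qed

lemma rel_ideal_exchange:
  assumes "(\<lambda>w. word u w + c * word v w) \<in> rel_ideal q" "word (a @ v @ b) \<in> rel_ideal q"
  shows "word (a @ u @ b) \<in> rel_ideal q"
proof -
  have "(\<lambda>w. word (a @ u @ b) w + c * word (a @ v @ b) w) \<in> rel_ideal q"
    using rel_ideal_multiple(1)[OF rel_ideal_multiple(2)[OF assms(1)]] unfolding linear_mult_word .
  from rel_ideal_diff[OF this rel_ideal_scale[OF assms(2), of c]] show ?thesis by simp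
qed

text \<open>A word of length three containing \<open>xx\<close>, \<open>yy\<close>, \<open>zz\<close> or \<open>yz\<close> vanishes at once. Each of the eight
  remaining ones is carried by a binomial relation to a word that is already known to vanish.\<close>

lemma rel_ideal_cubic: "word (a # b # c # u) \<in> rel_ideal q"
proof -
  have g: "word [gx, gx] \<in> rel_ideal q" "word [gy, gy] \<in> rel_ideal q" "word [gz, gz] \<in> rel_ideal q"
    "word [gy, gz] \<in> rel_ideal q" "(\<lambda>w. word [gx, gy] w + q * word [gy, gx] w) \<in> rel_ideal q"
    "(\<lambda>w. word [gx, gz] w - word [gz, gx] w) \<in> rel_ideal q"
    "(\<lambda>w. word [gz, gy] w - word [gz, gx] w) \<in> rel_ideal q"
    by (rule rel_ideal_gen, simp add: relations_def)+
  have h: "(\<lambda>w. word [gx, gz] w + (- 1) * word [gz, gx] w) \<in> rel_ideal q"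
    "(\<lambda>w. word [gz, gy] w + (- 1) * word [gz, gx] w) \<in> rel_ideal q"
    "(\<lambda>w. word [gz, gx] w + (- 1) * word [gz, gy] w) \<in> rel_ideal q"
    using g(6,7) rel_ideal_scale[OF g(7), of "- 1"] by simp_all
  have left: "word (v @ w) \<in> rel_ideal q" if "word v \<in> rel_ideal q" for v w
    using rel_ideal_word[OF that, of "[]" w] by simp
  have right: "word (v @ w) \<in> rel_ideal q" if "word w \<in> rel_ideal q" for v w
    using rel_ideal_word[OF that, of v "[]"] by simp
  note L = left[of "[_, _]" "[_]", simplified] and Rr = right[of "[_, _]" "[_]", simplified]
  have xyx: "word [gx, gy, gx] \<in> rel_ideal q"
    using rel_ideal_exchange[OF g(5), of "[]" "[gx]"] Rr[OF g(1), of gy] by simp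
  have xzx: "word [gx, gz, gx] \<in> rel_ideal q"
    using rel_ideal_exchange[OF h(1), of "[]" "[gx]"] Rr[OF g(1), of gz] by simp
  have xzy: "word [gx, gz, gy] \<in> rel_ideal q"
    using rel_ideal_exchange[OF h(2), of "[gx]" "[]"] xzx by simp
  have yxy: "word [gy, gx, gy] \<in> rel_ideal q"
    using rel_ideal_exchange[OF g(5), of "[gy]" "[]"] L[OF g(2), of gx] by simp
  have yxz: "word [gy, gx, gz] \<in> rel_ideal q"
    using rel_ideal_exchange[OF h(1), of "[gy]" "[]"] L[OF g(4), of gx] by simp
  have zxy: "word [gz, gx, gy] \<in> rel_ideal q"
    using rel_ideal_exchange[OF h(3), of "[]" "[gy]"] Rr[OF g(2), of gz] by simp
  have zxz: "word [gz, gx, gz] \<in> rel_ideal q"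
    using rel_ideal_exchange[OF h(1), of "[gz]" "[]"] L[OF g(3), of gx] by simp
  have zyx: "word [gz, gy, gx] \<in> rel_ideal q"
    using rel_ideal_exchange[OF h(2), of "[]" "[gx]"] Rr[OF g(1), of gz] by simp
  have "word [a, b, c] \<in> rel_ideal q"
    using L[OF g(1)] L[OF g(2)] L[OF g(3)] L[OF g(4)] Rr[OF g(1)] Rr[OF g(2)] Rr[OF g(3)] Rr[OF g(4)]
      xyx xzx xzy yxy yxz zxy zxz zyx
    by (cases a; cases b; cases c) auto
  from left[OF this, of u] show ?thesis by simp
qed

lemma rel_ideal_of_words:
  assumes "finite S" "\<And>w. w \<in> S \<Longrightarrow> word w \<in> rel_ideal q" "{w. f w \<noteq> 0} \<subseteq> S"
  shows "f \<in> rel_ideal q"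
  using assms
proof (induction S arbitrary: f rule: finite_induct)
  case empty
  then have "f = (\<lambda>w. 0)" by auto
  then show ?case using rel_ideal_zero by simp
next
  case (insert u S)
  have "f(u := 0) \<in> rel_ideal q" by (rule insert.IH) (use insert.prems in auto)
  from rel_ideal_add[OF this rel_ideal_scale[of "word u" q "f u"]] insert.prems(1)[of u]
  have "(\<lambda>w. (f(u := 0)) w + f u * word u w) \<in> rel_ideal q" by simp
  also have "(\<lambda>w. (f(u := 0)) w + f u * word u w) = f" by (auto simp: word_def)
  finally show ?case .
qed

text \<open>Modulo words of length at least three, an element with vanishing coordinates is the
  combination of the seven relations with its own coefficients at \<open>xx, yy, zz, yz, xy, xz, zy\<close>; the
  coefficients at \<open>yx\<close> and \<open>zx\<close> are then forced.\<close>

lemma rel_ideal_iff: "f \<in> rel_ideal q \<longleftrightarrow> f \<in> carrier free_alg \<and> coords q f = (0, 0, 0, 0, 0, 0)"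
proof
  assume f: "f \<in> carrier free_alg \<and> coords q f = (0, 0, 0, 0, 0, 0)"
  then have c: "f [] = 0" "f [gx] = 0" "f [gy] = 0" "f [gz] = 0" "f [gy, gx] = q * f [gx, gy]"
    "f [gz, gx] = - f [gx, gz] - f [gz, gy]"
    by (auto simp: coords_def algebra_simps eq_neg_iff_add_eq_0)
  define h where "h w = (if length w \<le> 2 then 0 else f w)" for w
  have "h \<in> rel_ideal q"
  proof (rule rel_ideal_of_words)
    show "finite {w. h w \<noteq> 0}"
      using f by (auto simp: h_def intro: rev_finite_subset)
    fix w assume "w \<in> {w. h w \<noteq> 0}"
    then have "length w > 2" by (auto simp: h_def split: if_splits)
    then obtain a b c u where "w = a # b # c # u" by (cases w rule: remdups_adj.cases; cases "tl (tl w)") auto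
    then show "word w \<in> rel_ideal q" by (simp add: rel_ideal_cubic)
  qed simp
  moreover have "(\<lambda>w. f [gx, gx] * word [gx, gx] w + (f [gy, gy] * word [gy, gy] w +
      (f [gz, gz] * word [gz, gz] w + (f [gy, gz] * word [gy, gz] w +
      (f [gx, gy] * (word [gx, gy] w + q * word [gy, gx] w) +
      (f [gx, gz] * (word [gx, gz] w - word [gz, gx] w) +
       f [gz, gy] * (word [gz, gy] w - word [gz, gx] w))))))) \<in> rel_ideal q" (is "?l \<in> _")
    by (intro rel_ideal_add rel_ideal_scale rel_ideal_gen) (simp_all add: relations_def)
  ultimately have "(\<lambda>w. h w + ?l w) \<in> rel_ideal q" by (rule rel_ideal_add)
  also have "(\<lambda>w. h w + ?l w) = f"
  proof
    fix w :: "gen list"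
    consider "w = []" | a where "w = [a]" | a b where "w = [a, b]" | "length w > 2"
      by (cases w rule: remdups_adj.cases; cases "tl (tl w)") auto
    then show "h w + ?l w = f w"
    proof cases
      case (2 a) then show ?thesis by (cases a) (simp_all add: h_def word_def c)
    next
      case (3 a b) then show ?thesis by (cases a; cases b) (simp_all add: h_def word_def c)
    qed (auto simp: h_def word_def c)
  qed
  finally show "f \<in> rel_ideal q" .
qed (rule rel_ideal_coords)

fun normal_form :: "'k::field six \<Rightarrow> gen list \<Rightarrow> 'k" where
  "normal_form (a, b, c, d, e, f) = (\<lambda>w. if w = [] then a else if w = [gx] then b else if w = [gy] then c
     else if w = [gz] then d else if w = [gy, gx] then e else if w = [gz, gx] then f else 0)"

lemma normal_form_carrier: "normal_form t \<in> carrier free_alg"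
proof (cases t)
  case (fields a b c d e f)
  have "{w. normal_form t w \<noteq> 0} \<subseteq> {[], [gx], [gy], [gz], [gy, gx], [gz, gx]}" unfolding fields by auto
  then show ?thesis by (simp add: finite_subset)
qed

lemma coords_normal_form [simp]: "coords q (normal_form t) = t"
  by (cases t) (simp add: coords_def)

text \<open>The element of \<open>\<Lambda>(q)\<close> with given coordinates. Since elements of the quotient are cosets, it is the set
  of all representatives.\<close>

definition elt :: "'k::field \<Rightarrow> 'k six \<Rightarrow> (gen list \<Rightarrow> 'k) set" where
  "elt q t = {f \<in> carrier free_alg. coords q f = t}"

lemma normal_form_in_elt: "normal_form t \<in> elt q t"
  unfolding elt_def using normal_form_carrier[of t] coords_normal_form[of q t] by blast

lemma coset_eq_elt:
  assumes f: "f \<in> carrier free_alg"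
  shows "rel_ideal q +>\<^bsub>free_alg\<^esub> f = elt q (coords q f)"
proof (intro equalityI subsetI)
  fix g assume "g \<in> rel_ideal q +>\<^bsub>free_alg\<^esub> f"
  then obtain i where i: "i \<in> rel_ideal q" "g = (\<lambda>w. i w + f w)" by (auto simp: a_r_coset_def')
  then show "g \<in> elt q (coords q f)"
    using f coords_add[of q i f] unfolding rel_ideal_iff elt_def by (cases "coords q f") auto
next
  fix g assume g: "g \<in> elt q (coords q f)"
  then have "(\<lambda>w. g w + (- 1) * f w) \<in> rel_ideal q"
    unfolding rel_ideal_iff using f add_carrier[of g "\<lambda>w. (- 1) * f w"] scaled_carrier[of f "- 1"]
    by (auto simp: elt_def coords_def algebra_simps)
  then show "g \<in> rel_ideal q +>\<^bsub>free_alg\<^esub> f"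
    unfolding a_r_coset_def' by (auto intro!: bexI[of _ "\<lambda>w. g w - f w"])
qed

lemma elt_eq_coset: "elt q t = rel_ideal q +>\<^bsub>free_alg\<^esub> normal_form t"
  using coset_eq_elt[OF normal_form_carrier, of q t] by simp

lemma Lam_ring: "ring (Lam q)"
  unfolding Lam_def by (rule ideal.quotient_is_ring[OF rel_ideal_ideal])

lemma elt_inj [simp]: "elt q s = elt q t \<longleftrightarrow> s = t"
proof
  assume "elt q s = elt q t"
  moreover have "normal_form s \<in> elt q s" by (rule normal_form_in_elt)
  ultimately show "s = t" by (auto simp: elt_def)
qed simp

lemma carrier_Lam: "carrier (Lam q) = range (elt q)"
proof -
  have "carrier (Lam q) = (\<lambda>f. rel_ideal q +>\<^bsub>free_alg\<^esub> f) ` carrier free_alg"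
    unfolding Lam_def FactRing_def A_RCOSETS_def' by auto
  also have "\<dots> = (\<lambda>f. elt q (coords q f)) ` carrier free_alg"
    by (rule image_cong[OF refl coset_eq_elt])
  also have "\<dots> = range (elt q)"
  proof (intro equalityI subsetI)
    fix r assume "r \<in> range (elt q)"
    then obtain t where "r = elt q t" by blast
    then show "r \<in> (\<lambda>f. elt q (coords q f)) ` carrier free_alg"
      using normal_form_carrier[of t] by (intro image_eqI[of _ _ "normal_form t"]) (simp_all only: coords_normal_form)
  qed blast
  finally show ?thesis .
qed

lemma elt_carrier [simp]: "elt q t \<in> carrier (Lam q)"
  by (simp add: carrier_Lam)

lemma Lam_elt_cases: assumes "r \<in> carrier (Lam q)" obtains a b c d e f where "r = elt q (a, b, c, d, e, f)"
  using assms unfolding carrier_Lam by (metis imageE prod_cases6)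

lemma quotient_hom: "(+>\<^bsub>free_alg\<^esub>) (rel_ideal q) \<in> ring_hom free_alg (Lam q)"
  unfolding Lam_def by (rule ideal.rcos_ring_hom[OF rel_ideal_ideal])

lemma elt_mult [simp]: "elt q s \<otimes>\<^bsub>Lam q\<^esub> elt q t = elt q (six_mult q s t)"
proof -
  have "elt q s \<otimes>\<^bsub>Lam q\<^esub> elt q t = rel_ideal q +>\<^bsub>free_alg\<^esub> (normal_form s \<star> normal_form t)"
    unfolding elt_eq_coset
    by (rule ring_hom_mult[OF quotient_hom normal_form_carrier normal_form_carrier, symmetric])
  also have "\<dots> = elt q (six_mult q s t)"
    by (simp only: coset_eq_elt[OF ring.ring_simprules(5)[OF free_alg_ring normal_form_carrier normal_form_carrier]]
      coords_mult coords_normal_form)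
  finally show ?thesis .
qed

lemma elt_add [simp]: "elt q s \<oplus>\<^bsub>Lam q\<^esub> elt q t = elt q (six_add s t)"
proof -
  have "elt q s \<oplus>\<^bsub>Lam q\<^esub> elt q t = rel_ideal q +>\<^bsub>free_alg\<^esub> (normal_form s \<oplus>\<^bsub>free_alg\<^esub> normal_form t)"
    unfolding elt_eq_coset
    by (rule ring_hom_add[OF quotient_hom normal_form_carrier normal_form_carrier, symmetric])
  also have "\<dots> = elt q (six_add s t)"
    by (simp only: coset_eq_elt[OF ring.ring_simprules(1)[OF free_alg_ring normal_form_carrier normal_form_carrier]]
      coords_add coords_normal_form)
  finally show ?thesis .
qed

lemma elt_zero [simp]: "\<zero>\<^bsub>Lam q\<^esub> = elt q (0, 0, 0, 0, 0, 0)"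
proof -
  have "\<zero>\<^bsub>Lam q\<^esub> = rel_ideal q" by (simp add: Lam_def FactRing_def)
  then show ?thesis using rel_ideal_iff by (auto simp: elt_def)
qed

lemma scal_eq [simp]: "scal q c = elt q (c, 0, 0, 0, 0, 0)"
  unfolding scal_def by (subst coset_eq_elt) (auto simp: coords_def word_def)

lemma elt_one [simp]: "\<one>\<^bsub>Lam q\<^esub> = elt q (1, 0, 0, 0, 0, 0)"
proof -
  have "\<one>\<^bsub>Lam q\<^esub> = rel_ideal q +>\<^bsub>free_alg\<^esub> word []" by (simp add: Lam_def FactRing_def)
  then show ?thesis by (simp add: coset_eq_elt) (simp add: coords_def word_def)
qed

text \<open>A word of length at least two acts as zero, because every generator sends the module into the span of
  \<open>v'\<close> and \<open>v''\<close>, which all generators annihilate.\<close>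

lemma free_act_eq:
  assumes f: "f \<in> carrier free_alg"
  shows "free_act \<alpha> f (a, b, c) =
    (f [] * a, f [] * b + (\<alpha> * f [gx] + f [gy]) * a, f [] * c + f [gz] * a)"
proof -
  have two: "foldr (gen_act \<alpha>) (u # v # w) m = (0, 0, 0)" for u v w m
    by (cases u; cases v; cases "foldr (gen_act \<alpha>) w m") auto
  let ?S = "{[], [gx], [gy], [gz]}"
  have z: "foldr (gen_act \<alpha>) w m = (0, 0, 0)" if "w \<notin> ?S" for w m
  proof (cases w rule: remdups_adj.cases)
    case (2 u) then show ?thesis using that by (cases u) auto
  qed (use that two in auto)
  have red: "(\<Sum>w | f w \<noteq> 0. f w * p (foldr (gen_act \<alpha>) w m)) = (\<Sum>w\<in>?S. f w * p (foldr (gen_act \<alpha>) w m))"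
    if "p (0, 0, 0) = 0" for p m
  proof -
    have "(\<Sum>w | f w \<noteq> 0. f w * p (foldr (gen_act \<alpha>) w m)) = (\<Sum>w\<in>{w. f w \<noteq> 0} \<union> ?S. f w * p (foldr (gen_act \<alpha>) w m))"
      using f by (intro sum.mono_neutral_left) auto
    also have "\<dots> = (\<Sum>w\<in>?S. f w * p (foldr (gen_act \<alpha>) w m))"
      using f z that by (intro sum.mono_neutral_right) auto
    finally show ?thesis .
  qed
  show ?thesis
    unfolding free_act_def
    using red[of fst] red[of "\<lambda>m. fst (snd m)"] red[of "\<lambda>m. snd (snd m)"]
    by (simp add: algebra_simps)
qed

lemma Mod_alpha_simps [simp]:
  "carrier (Mod_alpha \<alpha>) = UNIV" "\<zero>\<^bsub>Mod_alpha \<alpha>\<^esub> = (0, 0, 0)"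
  "(a, b, c) \<oplus>\<^bsub>Mod_alpha \<alpha>\<^esub> (a', b', c') = (a + a', b + b', c + c')"
  by (simp_all add: Mod_alpha_def)

lemma Mod_alpha_smult [simp]:
  "elt q (r0, rx, ry, rz, s, t) \<odot>\<^bsub>Mod_alpha \<alpha>\<^esub> (a, b, c) =
    (r0 * a, r0 * b + (\<alpha> * rx + ry) * a, r0 * c + rz * a)"
proof -
  let ?t = "(r0, rx, ry, rz, s, t)"
  have "(\<lambda>f. free_act \<alpha> f (a, b, c)) ` elt q ?t = {(r0 * a, r0 * b + (\<alpha> * rx + ry) * a, r0 * c + rz * a)}"
  proof -
    have "(\<lambda>f. free_act \<alpha> f (a, b, c)) ` elt q ?t =
        (\<lambda>f. (r0 * a, r0 * b + (\<alpha> * rx + ry) * a, r0 * c + rz * a)) ` elt q ?t"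
    proof (rule image_cong[OF refl])
      fix f assume "f \<in> elt q ?t"
      then show "free_act \<alpha> f (a, b, c) = (r0 * a, r0 * b + (\<alpha> * rx + ry) * a, r0 * c + rz * a)"
        by (subst free_act_eq) (auto simp: elt_def coords_def)
    qed
    moreover have "elt q ?t \<noteq> {}" using normal_form_in_elt by blast
    ultimately show ?thesis by (simp only: image_constant_conv if_False)
  qed
  then show ?thesis by (simp add: Mod_alpha_def)
qed

lemma Mod_alpha_left_module: "left_module (Lam q) (Mod_alpha \<alpha>)"
proof (rule left_moduleI[OF Lam_ring])
  show "abelian_group (Mod_alpha \<alpha>)"
  proof (rule abelian_groupI)
    fix x assume "x \<in> carrier (Mod_alpha \<alpha>)"
    obtain a b c where "x = (a, b, c)" by (cases x)
    then show "\<exists>y\<in>carrier (Mod_alpha \<alpha>). y \<oplus>\<^bsub>Mod_alpha \<alpha>\<^esub> x = \<zero>\<^bsub>Mod_alpha \<alpha>\<^esub>"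
      by (intro bexI[of _ "(- a, - b, - c)"]) auto
  qed (auto simp: algebra_simps)
qed (auto elim!: Lam_elt_cases simp: algebra_simps)

section \<open>Annihilators of the elements x - a y\<close>

text \<open>The element \<open>x - \<alpha> y\<close>.\<close>

definition xay :: "'k::field \<Rightarrow> 'k \<Rightarrow> (gen list \<Rightarrow> 'k) set" where
  "xay q \<alpha> = elt q (0, 1, - \<alpha>, 0, 0, 0)"

text \<open>The span of \<open>x - \<alpha> y\<close> and of the socle elements \<open>yx\<close> and \<open>zx\<close>.\<close>

definition xay_soc :: "'k::field \<Rightarrow> 'k \<Rightarrow> (gen list \<Rightarrow> 'k) set set" where
  "xay_soc q \<alpha> = {elt q (0, a, - \<alpha> * a, 0, s, t) | a s t. True}"

lemma elt_in_xay_soc [simp]: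
  "elt q (r0, rx, ry, rz, s, t) \<in> xay_soc q \<alpha> \<longleftrightarrow> r0 = 0 \<and> ry = - \<alpha> * rx \<and> rz = 0"
  by (auto simp: xay_soc_def)

lemma xay_soc_carrier: "xay_soc q \<alpha> \<subseteq> carrier (Lam q)"
  by (auto simp: xay_soc_def)

lemma xay_soc_proper: "xay_soc q \<alpha> \<noteq> carrier (Lam q)"
proof -
  have "elt q (1, 0, 0, 0, 0, 0) \<notin> xay_soc q \<alpha>" by simp
  then show ?thesis using elt_carrier by blast
qed

lemma xay_carrier [simp]: "xay q \<alpha> \<in> carrier (Lam q)"
  by (simp add: xay_def)

lemma xay_soc_eqI:
  assumes "S \<subseteq> carrier (Lam q)"
    and "\<And>r0 rx ry rz s t. elt q (r0, rx, ry, rz, s, t) \<in> S \<longleftrightarrow> r0 = 0 \<and> ry = - \<alpha> * rx \<and> rz = 0"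
  shows "S = xay_soc q \<alpha>"
proof (rule Set.set_eqI)
  fix r show "r \<in> S \<longleftrightarrow> r \<in> xay_soc q \<alpha>"
  proof (cases "r \<in> carrier (Lam q)")
    case True
    then show ?thesis by (rule Lam_elt_cases) (simp only: assms(2) elt_in_xay_soc)
  next
    case False then show ?thesis using assms(1) xay_soc_carrier by blast
  qed
qed

text \<open>The product of \<open>z\<close> with \<open>x - \<alpha> y\<close> is \<open>(1 - \<alpha>) zx\<close>, so \<open>zx\<close> is reached exactly because \<open>\<alpha>\<close> is not \<open>1\<close>.\<close>

lemma left_ideal_xay:
  assumes "\<alpha> \<noteq> 1" shows "principal (Lam q) (xay q \<alpha>) = xay_soc q \<alpha>"
proof (rule xay_soc_eqI)
  show "principal (Lam q) (xay q \<alpha>) \<subseteq> carrier (Lam q)"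
    using ring.ring_simprules(5)[OF Lam_ring[of q]] by (auto simp: principal_def)
  fix r0 rx ry rz s t
  show "elt q (r0, rx, ry, rz, s, t) \<in> principal (Lam q) (xay q \<alpha>) \<longleftrightarrow> r0 = 0 \<and> ry = - \<alpha> * rx \<and> rz = 0"
  proof
    assume "elt q (r0, rx, ry, rz, s, t) \<in> principal (Lam q) (xay q \<alpha>)"
    then show "r0 = 0 \<and> ry = - \<alpha> * rx \<and> rz = 0"
      by (auto simp: principal_def xay_def elim!: Lam_elt_cases)
  next
    assume r: "r0 = 0 \<and> ry = - \<alpha> * rx \<and> rz = 0"
    (* d is the coefficient of z in the left factor: z (x - a y) = (1 - a) zx *)
    define d where "d = t / (1 - \<alpha>)"
    have "t = d - d * \<alpha>" using assms nonzero_eq_divide_eq[of "1 - \<alpha>" d t] by (simp add: d_def right_diff_distrib)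
    then have "elt q (r0, rx, ry, rz, s, t) = elt q (rx, 0, s, d, 0, 0) \<otimes>\<^bsub>Lam q\<^esub> xay q \<alpha>"
      using r by (simp add: xay_def mult.commute)
    then show "elt q (r0, rx, ry, rz, s, t) \<in> principal (Lam q) (xay q \<alpha>)"
      unfolding principal_def by (rule image_eqI) simp
  qed
qed

text \<open>Here the socle is reached through \<open>(x - \<alpha> y) y = -q yx\<close> and \<open>(x - \<alpha> y) z = zx\<close>, for every \<open>\<alpha>\<close>.\<close>

lemma right_ideal_xay:
  assumes "q \<noteq> 0" shows "principal (opp (Lam q)) (xay q \<alpha>) = xay_soc q \<alpha>"
proof (rule xay_soc_eqI)
  show "principal (opp (Lam q)) (xay q \<alpha>) \<subseteq> carrier (Lam q)"
    using ring.ring_simprules(5)[OF Lam_ring[of q]] by (auto simp: principal_def)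
  fix r0 rx ry rz s t
  show "elt q (r0, rx, ry, rz, s, t) \<in> principal (opp (Lam q)) (xay q \<alpha>) \<longleftrightarrow> r0 = 0 \<and> ry = - \<alpha> * rx \<and> rz = 0"
  proof
    assume "elt q (r0, rx, ry, rz, s, t) \<in> principal (opp (Lam q)) (xay q \<alpha>)"
    then show "r0 = 0 \<and> ry = - \<alpha> * rx \<and> rz = 0"
      by (auto simp: principal_def xay_def elim!: Lam_elt_cases)
  next
    assume r: "r0 = 0 \<and> ry = - \<alpha> * rx \<and> rz = 0"
    (* the product is rx (x - a y) + s yx + t zx: y contributes -q yx and z contributes zx *)
    have "elt q (r0, rx, ry, rz, s, t) = elt q (rx, 0, - s / q, t, 0, 0) \<otimes>\<^bsub>opp (Lam q)\<^esub> xay q \<alpha>"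
      using r assms by (simp add: xay_def)
    then show "elt q (r0, rx, ry, rz, s, t) \<in> principal (opp (Lam q)) (xay q \<alpha>)"
      unfolding principal_def by (rule image_eqI) simp
  qed
qed

lemma left_annihilator_xay:
  assumes "\<alpha> \<noteq> 1"
  shows "{r \<in> carrier (Lam q). r \<otimes>\<^bsub>Lam q\<^esub> xay q \<alpha> = \<zero>\<^bsub>Lam q\<^esub>} = xay_soc q (q * \<alpha>)"
  by (rule xay_soc_eqI) (use assms in \<open>auto simp: xay_def algebra_simps eq_neg_iff_add_eq_0\<close>)

lemma right_annihilator_xay:
  assumes "q \<noteq> 0"
  shows "{r \<in> carrier (Lam q). xay q \<alpha> \<otimes>\<^bsub>Lam q\<^esub> r = \<zero>\<^bsub>Lam q\<^esub>} = xay_soc q (\<alpha> / q)"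
  by (rule xay_soc_eqI) (use assms in \<open>auto simp: xay_def field_simps\<close>)

lemma six_unit:
  assumes "a \<noteq> 0"
  shows "\<exists>s. six_mult q s (a, b, c, d, e, f) = (1, 0, 0, 0, 0, 0) \<and> six_mult q (a, b, c, d, e, f) s = (1, 0, 0, 0, 0, 0)"
  (* the geometric series for the inverse of a + n stops after n^2 / a^3, as n^3 = 0 *)
  by (rule exI[of _ "(1 / a, - b / a^2, - c / a^2, - d / a^2,
        - e / a^2 + (1 - q) * b * c / a^3, - f / a^2 + (2 * b * d + c * d) / a^3)"])
    (use assms in \<open>simp add: field_simps power2_eq_square power3_eq_cube\<close>)

text \<open>An element with nonzero constant coordinate is invertible, and the constant coordinate is additive.\<close>

lemma Lam_local: "left_local (Lam q)" "left_local (opp (Lam q))"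
proof -
  have unit: "\<exists>c\<in>carrier (Lam q). c \<otimes>\<^bsub>Lam q\<^esub> u = \<one>\<^bsub>Lam q\<^esub> \<and> u \<otimes>\<^bsub>Lam q\<^esub> c = \<one>\<^bsub>Lam q\<^esub>"
    if "u = elt q (a, b, c, d, e, f)" "a \<noteq> 0" for u a b c d e f
    using six_unit[OF that(2), of q b c d e f] that(1) by (metis elt_carrier elt_mult elt_one)
  have *: "(\<exists>c\<in>carrier (Lam q). c \<otimes>\<^bsub>Lam q\<^esub> u = \<one>\<^bsub>Lam q\<^esub> \<and> u \<otimes>\<^bsub>Lam q\<^esub> c = \<one>\<^bsub>Lam q\<^esub>) \<or>
      (\<exists>c\<in>carrier (Lam q). c \<otimes>\<^bsub>Lam q\<^esub> v = \<one>\<^bsub>Lam q\<^esub> \<and> v \<otimes>\<^bsub>Lam q\<^esub> c = \<one>\<^bsub>Lam q\<^esub>)"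
    if uc: "u \<in> carrier (Lam q)" and vc: "v \<in> carrier (Lam q)" and one: "u \<oplus>\<^bsub>Lam q\<^esub> v = \<one>\<^bsub>Lam q\<^esub>" for u v
  proof -
    obtain a b c d e f where u: "u = elt q (a, b, c, d, e, f)" by (rule Lam_elt_cases[OF uc]) (rule that)
    obtain a' b' c' d' e' f' where v: "v = elt q (a', b', c', d', e', f')" by (rule Lam_elt_cases[OF vc]) (rule that)
    have "a \<noteq> 0 \<or> a' \<noteq> 0" using one by (auto simp: u v)
    then show ?thesis using unit[OF u] unit[OF v] by blast
  qed
  show "left_local (Lam q)" unfolding left_local_def using Lam_ring * by blast
  show "left_local (opp (Lam q))" unfolding left_local_def opp_simps using opp_ring[OF Lam_ring] * by blast
qed

lemma Mod_alpha_cyclic: "cyclic_with (Lam q) (Mod_alpha \<alpha>) (xay_soc q \<alpha>)"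
  unfolding cyclic_with_def
proof (intro conjI bexI[of _ "(1, 0, 0)"])
  show "(\<lambda>r. r \<odot>\<^bsub>Mod_alpha \<alpha>\<^esub> (1, 0, 0)) ` carrier (Lam q) = carrier (Mod_alpha \<alpha>)"
  proof (intro equalityI subsetI)
    fix m :: "'a \<times> 'a \<times> 'a"
    obtain a b c where "m = (a, b, c)" by (cases m)
    then have "m = elt q (a, 0, b, c, 0, 0) \<odot>\<^bsub>Mod_alpha \<alpha>\<^esub> (1, 0, 0)" by simp
    then show "m \<in> (\<lambda>r. r \<odot>\<^bsub>Mod_alpha \<alpha>\<^esub> (1, 0, 0)) ` carrier (Lam q)"
      by (rule image_eqI) simp
  qed simp
  show "{r \<in> carrier (Lam q). r \<odot>\<^bsub>Mod_alpha \<alpha>\<^esub> (1, 0, 0) = \<zero>\<^bsub>Mod_alpha \<alpha>\<^esub>} = xay_soc q \<alpha>"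
    by (rule xay_soc_eqI) (auto simp: add_eq_0_iff)
qed (simp_all add: Mod_alpha_left_module)

text \<open>Modulo the span of \<open>x - \<alpha> y, yx, zx\<close> every element is a unique combination of \<open>1, y, z\<close>. The
  argument only uses sums and multiplication by scalars, so it applies on both sides.\<close>

lemma cyclic_has_dim_3:
  assumes R: "R = Lam q \<or> R = opp (Lam q)" and C: "cyclic_with R N (xay_soc q \<alpha>)"
  shows "has_dim (scal q) N 3"
proof -
  obtain g where N: "left_module R N" and g: "g \<in> carrier N" "(\<lambda>r. r \<odot>\<^bsub>N\<^esub> g) ` carrier R = carrier N"
    and ann: "\<And>r. r \<in> carrier R \<Longrightarrow> r \<odot>\<^bsub>N\<^esub> g = \<zero>\<^bsub>N\<^esub> \<longleftrightarrow> r \<in> xay_soc q \<alpha>"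
    by (rule cyclic_withE[OF C]) (rule that)
  interpret N: left_module R N by (rule N)
  have c [simp]: "elt q t \<in> carrier R" for t using R by auto
  have add: "elt q s \<oplus>\<^bsub>R\<^esub> elt q t = elt q (six_add s t)" for s t using R by auto
  have mult: "elt q (a, 0, 0, 0, 0, 0) \<otimes>\<^bsub>R\<^esub> elt q (0, 0, b, d, 0, 0) = elt q (0, 0, a * b, a * d, 0, 0)" for a b d
    using R by (auto simp: mult.commute)
  have cases: "\<exists>a b c d e f. r = elt q (a, b, c, d, e, f)" if "r \<in> carrier R" for r
    using that R by (auto elim!: Lam_elt_cases)
  let ?b = "elt q (0, 0, 1, 0, 0, 0)" and ?d = "elt q (0, 0, 0, 1, 0, 0)"
  have comb: "scal q u \<odot>\<^bsub>N\<^esub> g \<oplus>\<^bsub>N\<^esub> (scal q v \<odot>\<^bsub>N\<^esub> (?b \<odot>\<^bsub>N\<^esub> g) \<oplus>\<^bsub>N\<^esub> scal q w \<odot>\<^bsub>N\<^esub> (?d \<odot>\<^bsub>N\<^esub> g))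
      = elt q (u, 0, v, w, 0, 0) \<odot>\<^bsub>N\<^esub> g" for u v w
    using g(1) by (simp add: N.smult_assoc[symmetric] N.smult_l_distr[symmetric] mult add)
  have eq_iff: "elt q s \<odot>\<^bsub>N\<^esub> g = elt q t \<odot>\<^bsub>N\<^esub> g \<longleftrightarrow> (\<exists>k\<in>xay_soc q \<alpha>. elt q s = k \<oplus>\<^bsub>R\<^esub> elt q t)" for s t
  proof
    assume "\<exists>k\<in>xay_soc q \<alpha>. elt q s = k \<oplus>\<^bsub>R\<^esub> elt q t"
    then obtain k where k: "k \<in> xay_soc q \<alpha>" "elt q s = k \<oplus>\<^bsub>R\<^esub> elt q t" by blast
    then have "k \<in> carrier R" by (auto simp: xay_soc_def)
    then show "elt q s \<odot>\<^bsub>N\<^esub> g = elt q t \<odot>\<^bsub>N\<^esub> g"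
      using k g(1) ann[of k] N.smult_closed by (simp add: N.smult_l_distr)
  next
    assume eq: "elt q s \<odot>\<^bsub>N\<^esub> g = elt q t \<odot>\<^bsub>N\<^esub> g"
    let ?k = "elt q s \<ominus>\<^bsub>R\<^esub> elt q t"
    have "?k \<odot>\<^bsub>N\<^esub> g = \<zero>\<^bsub>N\<^esub>"
      using eq g(1) by (simp add: a_minus_def N.smult_l_distr N.smult_l_minus N.smult_closed N.M.r_neg)
    moreover have "elt q s = ?k \<oplus>\<^bsub>R\<^esub> elt q t" by (simp add: a_minus_def N.R.a_assoc N.R.l_neg)
    ultimately show "\<exists>k\<in>xay_soc q \<alpha>. elt q s = k \<oplus>\<^bsub>R\<^esub> elt q t" using ann[of ?k] by auto
  qed
  have eq_iff': "elt q s \<odot>\<^bsub>N\<^esub> g = elt q t \<odot>\<^bsub>N\<^esub> g \<longleftrightarrow> (\<exists>a e f. s = six_add (0, a, - \<alpha> * a, 0, e, f) t)" for s t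
  proof -
    have "(\<exists>k\<in>xay_soc q \<alpha>. elt q s = k \<oplus>\<^bsub>R\<^esub> elt q t) \<longleftrightarrow>
        (\<exists>a e f. elt q s = elt q (0, a, - \<alpha> * a, 0, e, f) \<oplus>\<^bsub>R\<^esub> elt q t)"
      unfolding xay_soc_def by blast
    then show ?thesis unfolding eq_iff add elt_inj .
  qed
  have "bij_betw (\<lambda>(u, v, w). elt q (u, 0, v, w, 0, 0) \<odot>\<^bsub>N\<^esub> g) UNIV (carrier N)"
  proof (rule bij_betwI')
    fix x y :: "'a \<times> 'a \<times> 'a"
    show "((case x of (u, v, w) \<Rightarrow> elt q (u, 0, v, w, 0, 0) \<odot>\<^bsub>N\<^esub> g) =
        (case y of (u, v, w) \<Rightarrow> elt q (u, 0, v, w, 0, 0) \<odot>\<^bsub>N\<^esub> g)) = (x = y)"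
      by (cases x; cases y) (auto simp: eq_iff')
    show "(case x of (u, v, w) \<Rightarrow> elt q (u, 0, v, w, 0, 0) \<odot>\<^bsub>N\<^esub> g) \<in> carrier N"
      using g(1) by (cases x) (simp add: N.smult_closed)
  next
    fix n assume "n \<in> carrier N"
    then obtain r where "r \<in> carrier R" "n = r \<odot>\<^bsub>N\<^esub> g" unfolding g(2)[symmetric] by blast
    then obtain a b c d e f where n: "n = elt q (a, b, c, d, e, f) \<odot>\<^bsub>N\<^esub> g" using cases by blast
    have "\<exists>k\<in>xay_soc q \<alpha>. elt q (a, b, c, d, e, f) = k \<oplus>\<^bsub>R\<^esub> elt q (a, 0, c + \<alpha> * b, d, 0, 0)"
      by (rule bexI[of _ "elt q (0, b, - \<alpha> * b, 0, e, f)"]) (simp_all add: add)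
    then have "n = elt q (a, 0, c + \<alpha> * b, d, 0, 0) \<odot>\<^bsub>N\<^esub> g" unfolding n eq_iff .
    then show "\<exists>x\<in>UNIV. n = (case x of (u, v, w) \<Rightarrow> elt q (u, 0, v, w, 0, 0) \<odot>\<^bsub>N\<^esub> g)"
      by (intro bexI[of _ "(a, c + \<alpha> * b, d)"]) auto
  qed
  then show ?thesis
    using g(1) by (intro has_dim_3I[where \<iota> = "scal q" and ?b0.0 = g and ?b1.0 = "?b \<odot>\<^bsub>N\<^esub> g" and ?b2.0 = "?d \<odot>\<^bsub>N\<^esub> g", OF N])
      (simp_all add: comb N.smult_closed del: scal_eq, simp)
qed

lemma xay_soc_1_submodule: "submodule (xay_soc q 1) (Lam q) (regular (Lam q))"
proof -
  interpret L: left_module "Lam q" "regular (Lam q)" by (rule regular_left_module[OF Lam_ring])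
  show ?thesis
  proof (rule L.submoduleI)
    fix a b assume "a \<in> xay_soc q 1" "b \<in> xay_soc q 1"
    then show "a \<oplus>\<^bsub>regular (Lam q)\<^esub> b \<in> xay_soc q 1" by (auto simp: xay_soc_def)
  next
    fix a b assume "a \<in> carrier (Lam q)" "b \<in> xay_soc q 1"
    then show "a \<odot>\<^bsub>regular (Lam q)\<^esub> b \<in> xay_soc q 1" by (auto simp: xay_soc_def elim!: Lam_elt_cases)
  qed (use xay_soc_carrier in auto)
qed

text \<open>For \<open>\<alpha> = 1\<close> the element \<open>z\<close> annihilates \<open>x - y\<close>, so \<open>x - y\<close> generates only the span of \<open>x - y\<close> and
  \<open>yx\<close>, and the span of \<open>zx\<close> is a complement.\<close>

lemma xay_soc_1_decomposable: "decomposable (Lam q) (restrict_mod (regular (Lam q)) (xay_soc q 1))"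
proof -
  let ?M = "restrict_mod (regular (Lam q)) (xay_soc q 1)"
  interpret L: left_module "Lam q" "regular (Lam q)" by (rule regular_left_module[OF Lam_ring])
  interpret M: left_module "Lam q" ?M by (rule L.restrict_left_module[OF xay_soc_1_submodule])
  (* the span of x - y and yx, and the span of zx *)
  let ?U = "range (\<lambda>(a, s). elt q (0, a, - a, 0, s, 0))" and ?V = "range (\<lambda>t. elt q (0, 0, 0, 0, 0, t))"
  have "submodule ?U (Lam q) ?M"
  proof (rule M.submoduleI)
    show "?U \<subseteq> carrier ?M" by auto
    show "\<zero>\<^bsub>?M\<^esub> \<in> ?U" by (auto intro!: image_eqI[of _ _ "(0, 0)"])
    fix a b assume "a \<in> ?U" "b \<in> ?U"
    then obtain a1 s1 a2 s2 where "a = elt q (0, a1, - a1, 0, s1, 0)" "b = elt q (0, a2, - a2, 0, s2, 0)" by auto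
    then show "a \<oplus>\<^bsub>?M\<^esub> b \<in> ?U" by (auto intro!: image_eqI[of _ _ "(a1 + a2, s1 + s2)"])
  next
    fix r b assume r: "r \<in> carrier (Lam q)" and "b \<in> ?U"
    then obtain a s where b: "b = elt q (0, a, - a, 0, s, 0)" by auto
    obtain r0 rx ry rz r4 r5 where "r = elt q (r0, rx, ry, rz, r4, r5)" by (rule Lam_elt_cases[OF r]) (rule that)
    then show "r \<odot>\<^bsub>?M\<^esub> b \<in> ?U"
      using b by (auto intro!: image_eqI[of _ _ "(r0 * a, r0 * s + ry * a + q * rx * a)"])
  qed
  moreover have "submodule ?V (Lam q) ?M"
  proof (rule M.submoduleI)
    fix r b assume r: "r \<in> carrier (Lam q)" and "b \<in> ?V"
    then obtain t where b: "b = elt q (0, 0, 0, 0, 0, t)" by auto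
    obtain r0 rx ry rz r4 r5 where "r = elt q (r0, rx, ry, rz, r4, r5)" by (rule Lam_elt_cases[OF r]) (rule that)
    then show "r \<odot>\<^bsub>?M\<^esub> b \<in> ?V" using b by auto
  qed auto
  moreover have "?U \<inter> ?V = {\<zero>\<^bsub>?M\<^esub>}"
  proof (intro equalityI subsetI)
    fix r assume "r \<in> {\<zero>\<^bsub>?M\<^esub>}"
    then have "r = (\<lambda>(a, s). elt q (0, a, - a, 0, s, 0)) (0, 0)" "r = elt q (0, 0, 0, 0, 0, 0)" by simp_all
    then show "r \<in> ?U \<inter> ?V" by blast
  next
    fix r assume r: "r \<in> ?U \<inter> ?V"
    then obtain a s where 1: "r = elt q (0, a, - a, 0, s, 0)" by auto
    obtain t where 2: "r = elt q (0, 0, 0, 0, 0, t)" using r by blast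
    have "t = 0" using 1 unfolding 2 by simp
    then show "r \<in> {\<zero>\<^bsub>?M\<^esub>}" unfolding 2 by simp
  qed
  moreover have "?U <+>\<^bsub>?M\<^esub> ?V = carrier ?M"
  proof (intro equalityI subsetI)
    fix r assume "r \<in> carrier ?M"
    then obtain a s t where "r = elt q (0, a, - a, 0, s, t)" by (auto simp: xay_soc_def)
    then have "r = elt q (0, a, - a, 0, s, 0) \<oplus>\<^bsub>?M\<^esub> elt q (0, 0, 0, 0, 0, t)" by simp
    then show "r \<in> ?U <+>\<^bsub>?M\<^esub> ?V" unfolding set_add_def' by fastforce
  qed (auto simp: set_add_def')
  ultimately have D: "direct_decomp (Lam q) ?M ?U ?V" unfolding direct_decomp_def by blast
  have ne: "W \<noteq> {z}" if "w \<in> W" "w \<noteq> z" for w z :: "(gen list \<Rightarrow> 'a) set" and W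
    using that by blast
  have U0: "?U \<noteq> {\<zero>\<^bsub>?M\<^esub>}" by (rule ne[OF rangeI[of _ "(0, 1)"]]) simp
  have V0: "?V \<noteq> {\<zero>\<^bsub>?M\<^esub>}" by (rule ne[OF rangeI[of _ 1]]) simp
  show ?thesis
    unfolding decomposable_def by (intro exI conjI) (rule D U0 V0)+
qed

lemma xay_soc_1_iso_has_dim_3:
  assumes "left_module (Lam q) N" "mod_iso (Lam q) (restrict_mod (regular (Lam q)) (xay_soc q 1)) N"
  shows "has_dim (scal q) N 3"
proof -
  let ?M = "restrict_mod (regular (Lam q)) (xay_soc q 1)"
  have M: "left_module (Lam q) ?M"
    by (rule left_module.restrict_left_module[OF regular_left_module[OF Lam_ring] xay_soc_1_submodule])
  show ?thesis
  proof (rule has_dim_3_iso[where \<iota> = "scal q" and ?b0.0 = "elt q (0, 1, - 1, 0, 0, 0)" and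
        ?b1.0 = "elt q (0, 0, 0, 0, 1, 0)" and ?b2.0 = "elt q (0, 0, 0, 0, 0, 1)", OF M assms])
    show "bij_betw (\<lambda>(c0, c1, c2). scal q c0 \<odot>\<^bsub>?M\<^esub> elt q (0, 1, - 1, 0, 0, 0) \<oplus>\<^bsub>?M\<^esub>
        (scal q c1 \<odot>\<^bsub>?M\<^esub> elt q (0, 0, 0, 0, 1, 0) \<oplus>\<^bsub>?M\<^esub> scal q c2 \<odot>\<^bsub>?M\<^esub> elt q (0, 0, 0, 0, 0, 1)))
        UNIV (carrier ?M)"
      by (rule bij_betwI') (auto simp: xay_soc_def)
  qed simp_all
qed

text \<open>The image of \<open>v\<close> under a homomorphism to \<open>\<Lambda>(q)\<close> is annihilated by \<open>x - q y\<close>, hence is a multiple of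
  \<open>x - y\<close> up to the socle, and is annihilated by \<open>z\<close>. So the nonzero element \<open>v'' = z v\<close> is killed by
  every homomorphism.\<close>

lemma Mod_alpha_not_torsionless:
  assumes "q \<noteq> 0" shows "\<not> torsionless (Lam q) (Mod_alpha q)"
proof
  assume T: "torsionless (Lam q) (Mod_alpha q)"
  have M: "left_module (Lam q) (Mod_alpha q)" by (rule Mod_alpha_left_module)
  have L: "left_module (Lam q) (regular (Lam q))" by (rule regular_left_module[OF Lam_ring])
  have "(0, 0, 1) = \<zero>\<^bsub>Mod_alpha q\<^esub>"
  proof (rule torsionless_separates[OF M T])
    fix \<phi> assume phi: "\<phi> \<in> Hom (Lam q) (Mod_alpha q) (regular (Lam q))"
    let ?l = "\<phi> (1, 0, 0)"
    have l: "?l \<in> carrier (Lam q)" using Hom_closed[OF phi, of "(1, 0, 0)"] by simp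
    have "xay q q \<otimes>\<^bsub>Lam q\<^esub> ?l = \<phi> (xay q q \<odot>\<^bsub>Mod_alpha q\<^esub> (1, 0, 0))"
      using Hom_smult[OF phi, of "xay q q" "(1, 0, 0)"] by simp
    also have "\<dots> = \<phi> \<zero>\<^bsub>Mod_alpha q\<^esub>" by (simp add: xay_def)
    also have "\<dots> = \<zero>\<^bsub>Lam q\<^esub>" using Hom_zero[OF M L phi] by simp
    finally have "?l \<in> xay_soc q (q / q)" using l right_annihilator_xay[OF assms, of q] by blast
    then obtain a s t where lk: "?l = elt q (0, a, - a, 0, s, t)" using assms by (auto simp: xay_soc_def)
    have "\<phi> (0, 0, 1) = \<phi> (elt q (0, 0, 0, 1, 0, 0) \<odot>\<^bsub>Mod_alpha q\<^esub> (1, 0, 0))" by simp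
    also have "\<dots> = elt q (0, 0, 0, 1, 0, 0) \<otimes>\<^bsub>Lam q\<^esub> ?l"
      using Hom_smult[OF phi, of "elt q (0, 0, 0, 1, 0, 0)" "(1, 0, 0)"] by simp
    also have "\<dots> = \<zero>\<^bsub>Lam q\<^esub>" unfolding lk by simp
    finally show "\<phi> (0, 0, 1) = \<zero>\<^bsub>Lam q\<^esub>" .
  qed simp
  then show False by simp
qed

text \<open>The dual is the right annihilator of \<open>x - q y\<close>, which is the right ideal generated by \<open>x - y\<close>. The
  annihilator of this generator gives the parameter \<open>1 / q\<close>.\<close>

lemma dual_Mod_alpha_cyclic:
  assumes "q \<noteq> 0" "q \<noteq> 1"
  shows "cyclic_with (opp (Lam q)) (dual (Lam q) (Mod_alpha q)) (xay_soc q (1 / q))"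
proof -
  let ?A = "Lam q" and ?S = "{s \<in> carrier (Lam q). \<forall>r\<in>xay_soc q q. r \<otimes>\<^bsub>Lam q\<^esub> s = \<zero>\<^bsub>Lam q\<^esub>}"
  have S: "?S = xay_soc q 1"
  proof (rule xay_soc_eqI)
    fix s0 sx sy sz s4 s5
    show "elt q (s0, sx, sy, sz, s4, s5) \<in> ?S \<longleftrightarrow> s0 = 0 \<and> sy = - 1 * sx \<and> sz = 0" (is "?l \<longleftrightarrow> ?r")
    proof
      assume l: ?l
      have "elt q (0, 1, - q, 0, 0, 0) \<in> xay_soc q q" by simp
      with l have "elt q (0, 1, - q, 0, 0, 0) \<otimes>\<^bsub>?A\<^esub> elt q (s0, sx, sy, sz, s4, s5) = \<zero>\<^bsub>?A\<^esub>" by blast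
      then have "s0 = 0" "q * (- sx) = q * sy" "sz = 0" by auto
      then show ?r using mult_left_cancel[OF assms(1), of "- sx" sy] by simp
    next
      assume ?r then show ?l by (auto simp: xay_soc_def)
    qed
  qed auto
  have P: "principal (opp ?A) (xay q 1) = ?S" unfolding S by (rule right_ideal_xay[OF assms(1)])
  have iso: "mod_iso (opp ?A) (dual ?A (Mod_alpha q)) (restrict_mod (regular (opp ?A)) ?S)"
    by (rule dual_of_cyclic(2)[OF Mod_alpha_cyclic])
  have D: "left_module (opp ?A) (dual ?A (Mod_alpha q))"
    by (rule dual_left_module[OF Mod_alpha_left_module])
  have RS: "left_module (opp ?A) (restrict_mod (regular (opp ?A)) ?S)"
    by (rule left_module.restrict_left_module[OF regular_left_module[OF opp_ring[OF Lam_ring]]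
        dual_of_cyclic(1)[OF Mod_alpha_cyclic]])
  have "cyclic_with (opp ?A) (restrict_mod (regular (opp ?A)) ?S)
      {r \<in> carrier (opp ?A). r \<otimes>\<^bsub>opp ?A\<^esub> xay q 1 = \<zero>\<^bsub>opp ?A\<^esub>}"
    using principal_cyclic[OF opp_ring[OF Lam_ring], of "xay q 1" q] unfolding P by simp
  also have "{r \<in> carrier (opp ?A). r \<otimes>\<^bsub>opp ?A\<^esub> xay q 1 = \<zero>\<^bsub>opp ?A\<^esub>} = xay_soc q (1 / q)"
    using right_annihilator_xay[OF assms(1), of 1] by simp
  finally show ?thesis
    by (rule cyclic_with_iso[OF _ D mod_iso_sym[OF D RS iso]])
qed

text \<open>Dualizing again yields the left annihilator of \<open>x - (1 / q) y\<close>. Multiplying the parameter by \<open>q\<close> returns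
  to \<open>1\<close>; the coordinate at \<open>z\<close> vanishes because \<open>1 / q\<close> is not \<open>1\<close>.\<close>

lemma bidual_Mod_alpha:
  assumes "q \<noteq> 0" "q \<noteq> 1"
  defines "D \<equiv> dual (opp (Lam q)) (dual (Lam q) (Mod_alpha q))"
  shows "left_module (Lam q) D" "mod_iso (Lam q) D (restrict_mod (regular (Lam q)) (xay_soc q 1))"
proof -
  let ?A = "Lam q"
  note C = dual_Mod_alpha_cyclic[OF assms(1,2)]
  have M': "left_module (opp ?A) (dual ?A (Mod_alpha q))"
    by (rule dual_left_module[OF Mod_alpha_left_module])
  show "left_module ?A D" using dual_left_module[OF M'] by (simp add: D_def)
  have "{s \<in> carrier (opp ?A). \<forall>r\<in>xay_soc q (1 / q). r \<otimes>\<^bsub>opp ?A\<^esub> s = \<zero>\<^bsub>opp ?A\<^esub>} = xay_soc q 1"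
  proof (rule xay_soc_eqI)
    fix s0 sx sy sz s4 s5
    show "elt q (s0, sx, sy, sz, s4, s5) \<in> {s \<in> carrier (opp ?A). \<forall>r\<in>xay_soc q (1 / q). r \<otimes>\<^bsub>opp ?A\<^esub> s = \<zero>\<^bsub>opp ?A\<^esub>}
        \<longleftrightarrow> s0 = 0 \<and> sy = - 1 * sx \<and> sz = 0" (is "?l \<longleftrightarrow> ?r")
    proof
      assume l: ?l
      have "elt q (0, 1, - (1 / q), 0, 0, 0) \<in> xay_soc q (1 / q)" by simp
      with l have "elt q (0, 1, - (1 / q), 0, 0, 0) \<otimes>\<^bsub>opp ?A\<^esub> elt q (s0, sx, sy, sz, s4, s5) = \<zero>\<^bsub>opp ?A\<^esub>"
        by blast
      then have "s0 = 0" "sy + sx = 0" "sz * (1 - 1 / q) = 0" using assms(1) by (auto simp: algebra_simps)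
      then show ?r using assms(1,2) by (auto simp: eq_neg_iff_add_eq_0)
    next
      assume ?r then show ?l using assms(1) by (auto simp: xay_soc_def)
    qed
  qed simp
  then show "mod_iso ?A D (restrict_mod (regular ?A) (xay_soc q 1))"
    using dual_of_cyclic(2)[OF C] by (simp add: D_def)
qed

theorem theorem1p6:
  fixes q :: "'k::field"
  assumes "q \<noteq> 0" and "\<forall>n>0. q ^ n \<noteq> 1"
  shows "let \<Lambda> = Lam q; \<Lambda>op = opp \<Lambda>; Mq = Mod_alpha q; M1 = Mod_alpha 1;
      Mq' = dual \<Lambda> Mq; Mq'' = dual \<Lambda>op Mq' in
    semi_Gorenstein_projective \<Lambda> Mq \<and> semi_Gorenstein_projective \<Lambda>op Mq' \<and>
    \<not> torsionless \<Lambda> Mq \<and> \<not> Gorenstein_projective \<Lambda> Mq \<and>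
    (\<forall>t. (\<exists>N. is_syzygy \<Lambda> t Mq N) \<and>
         (\<forall>N. is_syzygy \<Lambda> t Mq N \<longrightarrow> has_dim (scal q) N 3 \<and> indecomposable \<Lambda> N)) \<and>
    (\<forall>t. (\<exists>N. is_syzygy \<Lambda>op t Mq' N) \<and>
         (\<forall>N. is_syzygy \<Lambda>op t Mq' N \<longrightarrow> has_dim (scal q) N 3 \<and> indecomposable \<Lambda>op N)) \<and>
    left_module \<Lambda> Mq'' \<and>
    (\<exists>N. is_syzygy \<Lambda> 1 M1 N) \<and> (\<forall>N. is_syzygy \<Lambda> 1 M1 N \<longrightarrow> mod_iso \<Lambda> Mq'' N) \<and>
    has_dim (scal q) Mq'' 3 \<and> decomposable \<Lambda> Mq''"
proof -
  let ?A = "Lam q" and ?M = "Mod_alpha q"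
  let ?M' = "dual (Lam q) (Mod_alpha q)"
  let ?M'' = "dual (opp (Lam q)) ?M'"
  note q0 = assms(1)
  have pow: "q ^ Suc n \<noteq> 1" for n using assms(2) by blast
  have q1: "q \<noteq> 1" using pow[of 0] by simp
  (* the parameter of m n starts at q, that of M(q) itself, and is multiplied by q at each step; on the
     other side it starts at 1 / q and is divided by q *)
  define m where "m n = xay q (q ^ Suc n)" for n
  define m' where "m' n = xay q (1 / q ^ Suc n)" for n
  have pow': "1 / q ^ Suc n \<noteq> 1" for n using pow[of n] q0 by (simp add: divide_eq_1_iff)
  have P: "principal ?A (m n) = xay_soc q (q ^ Suc n)" for n
    unfolding m_def by (rule left_ideal_xay[OF pow])
  have P': "principal (opp ?A) (m' n) = xay_soc q (1 / q ^ Suc n)" for n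
    unfolding m'_def by (rule right_ideal_xay[OF q0])
  have mc: "m n \<in> carrier ?A" "m' n \<in> carrier (opp ?A)" for n by (simp_all add: m_def m'_def)
  have ann: "{r \<in> carrier ?A. r \<otimes>\<^bsub>?A\<^esub> m n = \<zero>\<^bsub>?A\<^esub>} = principal ?A (m (Suc n))" for n
    unfolding P unfolding m_def left_annihilator_xay[OF pow] by simp
  have ann': "{r \<in> carrier (opp ?A). r \<otimes>\<^bsub>opp ?A\<^esub> m' n = \<zero>\<^bsub>opp ?A\<^esub>} = principal (opp ?A) (m' (Suc n))" for n
    unfolding P' unfolding m'_def opp_simps right_annihilator_xay[OF q0] by (simp add: mult.commute)
  have rann: "\<exists>r\<in>carrier ?A. s = m n \<otimes>\<^bsub>?A\<^esub> r" if "s \<in> carrier ?A" "m (Suc n) \<otimes>\<^bsub>?A\<^esub> s = \<zero>\<^bsub>?A\<^esub>" for n s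
  proof -
    (* the right annihilator of m (n + 1) has the parameter of m n and is m n times the algebra *)
    have "s \<in> xay_soc q (q ^ Suc (Suc n) / q)"
      using that right_annihilator_xay[OF q0, of "q ^ Suc (Suc n)"] by (auto simp: m_def)
    then have "s \<in> principal (opp ?A) (m n)" unfolding m_def right_ideal_xay[OF q0] using q0 by simp
    then show ?thesis by (auto simp: principal_def)
  qed
  have rann': "\<exists>r\<in>carrier (opp ?A). s = m' n \<otimes>\<^bsub>opp ?A\<^esub> r"
    if "s \<in> carrier (opp ?A)" "m' (Suc n) \<otimes>\<^bsub>opp ?A\<^esub> s = \<zero>\<^bsub>opp ?A\<^esub>" for n s
  proof -
    have "s \<in> xay_soc q (q * (1 / q ^ Suc (Suc n)))"
      using that left_annihilator_xay[OF pow', of q "Suc n"] by (auto simp: m'_def)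
    then have "s \<in> principal ?A (m' n)" unfolding m'_def left_ideal_xay[OF pow'] using q0 by simp
    then show ?thesis by (auto simp: principal_def)
  qed
  have C: "cyclic_with ?A ?M (principal ?A (m 0))" unfolding P using Mod_alpha_cyclic[of q q] by simp
  have C': "cyclic_with (opp ?A) ?M' (principal (opp ?A) (m' 0))"
    unfolding P' using dual_Mod_alpha_cyclic[OF q0 q1] by simp
  have proper: "principal ?A (m n) \<noteq> carrier ?A" "principal (opp ?A) (m' n) \<noteq> carrier (opp ?A)" for n
    unfolding P P' using xay_soc_proper by simp_all
  note syz = syzygies_of_annihilator_chain[OF Lam_local(1) mc(1) proper(1) ann C]
  note syz' = syzygies_of_annihilator_chain[OF Lam_local(2) mc(2) proper(2) ann' C']
  have dims: "has_dim (scal q) N 3 \<and> indecomposable ?A N" if "is_syzygy ?A t ?M N" for t N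
  proof -
    have c: "cyclic_with ?A N (xay_soc q (q ^ Suc t))" using syz[of t] that unfolding P by blast
    show ?thesis using cyclic_has_dim_3[OF _ c] cyclic_indecomposable[OF Lam_local(1) c xay_soc_proper] by blast
  qed
  have dims': "has_dim (scal q) N 3 \<and> indecomposable (opp ?A) N" if "is_syzygy (opp ?A) t ?M' N" for t N
  proof -
    have c: "cyclic_with (opp ?A) N (xay_soc q (1 / q ^ Suc t))" using syz'[of t] that unfolding P' by blast
    have "xay_soc q (1 / q ^ Suc t) \<noteq> carrier (opp ?A)" unfolding opp_simps by (rule xay_soc_proper)
    then show ?thesis using cyclic_has_dim_3[OF _ c] cyclic_indecomposable[OF Lam_local(2) c] by blast
  qed
  have sgp: "semi_Gorenstein_projective ?A ?M"
    by (rule semi_Gorenstein_projective_of_annihilator_chain[OF Lam_ring mc(1) ann rann C])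
  have sgp': "semi_Gorenstein_projective (opp ?A) ?M'"
    by (rule semi_Gorenstein_projective_of_annihilator_chain[OF opp_ring[OF Lam_ring] mc(2) ann' rann' C'])
  have nt: "\<not> torsionless ?A ?M" by (rule Mod_alpha_not_torsionless[OF q0])
  have ngp: "\<not> Gorenstein_projective ?A ?M" using nt Gorenstein_projective_torsionless by blast
  note B = bidual_Mod_alpha[OF q0 q1]
  let ?K = "restrict_mod (regular ?A) (xay_soc q 1)"
  have KM: "left_module ?A ?K"
    by (rule left_module.restrict_left_module[OF regular_left_module[OF Lam_ring] xay_soc_1_submodule])
  note C1 = Mod_alpha_cyclic[of q 1]
  note S1 = syzygy_Suc_of_cyclic[OF Lam_local(1) xay_soc_proper syzygy_0_of_cyclic(1)[OF C1] syzygy_0_of_cyclic(2)[OF C1]]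
  have ex1: "\<exists>N. is_syzygy ?A 1 (Mod_alpha 1) N" using S1(1) by simp
  have iso1: "mod_iso ?A ?M'' N" if "is_syzygy ?A 1 (Mod_alpha 1) N" for N
  proof -
    have N: "left_module ?A N" "mod_iso ?A N ?K" using S1(2)[of N] that by simp_all
    show ?thesis by (rule mod_iso_trans[OF B mod_iso_sym[OF N(1) KM N(2)]])
  qed
  have dim'': "has_dim (scal q) ?M'' 3" by (rule xay_soc_1_iso_has_dim_3[OF B(1) mod_iso_sym[OF B(1) KM B(2)]])
  have dec'': "decomposable ?A ?M''"
    by (rule decomposable_iso[OF KM B(1) mod_iso_sym[OF B(1) KM B(2)] xay_soc_1_decomposable])
  show ?thesis
    unfolding Let_def
    by (intro conjI allI impI sgp sgp' nt ngp syz[THEN conjunct1] syz'[THEN conjunct1] B(1) ex1 iso1 dim'' dec''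
        dims[THEN conjunct1] dims[THEN conjunct2] dims'[THEN conjunct1] dims'[THEN conjunct2])
qed

end
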